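(* Let $X=(X_t)_{t\in[0,T]}$ be a solution of the stochastic Volterra equation $$X_t=x_0+\int_0^t k_1(t-s)\,b(s,X_s)\,\mathrm{d}s+\int_0^t k_2(t-s)\,\mathrm{d}W_s .$$ For every $t\in[0,T]$ define the $\mathbb{R}^d$-valued process $\theta_t=(\theta_t(\xi))_{\xi\in[t,T]}$ by $$\theta_t(\xi)=x_0+\int_0^t k_1(\xi-s)\,b(s,X_s)\,\mathrm{d}s+\int_0^t k_2(\xi-s)\,\mathrm{d}W_s,\qquad \xi\in[t,T],$$ and define the $H$-valued process $(w_t)_{t\in[0,T]}$ by setting, for each $t\in[0,T]$, $w_t(\xi)=X_\xi$ if $\xi\le t$ and $w_t(\xi)=\theta_t(\xi)$ if $\xi>t$. Then $(w_t)_{t\in[0,T]}$ is a solution of $$w_t=\phi+\int_0^t B(s,w_s)\,\mathrm{d}s+\int_0^t\sigma(s)\,\mathrm{d}W_s,$$ where $\phi\in H$ is the function identically equal to $x_0$; that is, $(w_t)_{t\in[0,T]}$ is an $\mathbb{F}$-adapted $H$-valued process which satisfies this equation $\mathbb{P}$-a.s., for every $t\in[0,T]$.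
   Context: Fix $T>0$, $d\in\mathbb{N}$, $x_0\in\mathbb{R}^d$. $(\Omega,\mathcal{F},\mathbb{P},\mathbb{F})$ is a complete filtered probability space, the filtration $\mathbb{F}=(\mathcal{F}_t)_{t\in[0,T]}$ satisfies the usual conditions, and $W=(W_t)_{t\ge0}$ is a standard $\mathbb{R}^d$-valued Brownian motion on it (with respect to $\mathbb{F}$). The kernel $k_2\colon(0,\infty)\to(0,\infty)$ is $k_2(t)=\frac{1}{\Gamma(\alpha)}t^{\alpha-1}$ for some $\alpha\in(\frac12,1)$. The kernel $k_1$ is real-valued, locally square-integrable, and continuous on $(0,\infty)$. The vector field $b\colon[0,T]\times\mathbb{R}^d\to\mathbb{R}^d$ is measurable and there is $L>0$ with $|b(t,x)|\le L(1+|x|)$ and $|b(t,x)-b(t,y)|\le L|x-y|$ for all $t\in[0,T]$, $x,y\in\mathbb{R}^d$. A solution of the stochastic Volterra equation is a continuous $\mathbb{F}$-adapted process satisfying the identity for every $t\in[0,T]$, $\mathbb{P}$-a.s. $H=L^2(0,T;\mathbb{R}^d)$ and $\Lambda=C([0,T];\mathbb{R}^d)$. The map $\sigma\colon[0,T]\to\mathcal{L}(\mathbb{R}^d;H)$ is $[\sigma(t)x](\xi)=k_2(\xi-t)1_{\{t<\xi\}}x$ for $x\in\mathbb{R}^d$, $t,\xi\in[0,T]$, and $\int_0^t\sigma(s)\,\mathrm{d}W_s$ is the corresponding $H$-valued stochastic integral. The map $B\colon[0,T]\times\Lambda\to H$ is $[B(t,w)](\xi)=k_1(\xi-t)1_{\{t<\xi\}}\,b(t,w(t))$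 for $t,\xi\in[0,T]$. The stochastic integral process $\big(\int_0^t k_2(\xi-s)\,\mathrm{d}W_s\big)_{\xi\in[t,T]}$ is taken in a version with trajectories continuous in $\xi$, so that $w_t$ has continuous trajectories and $B(s,w_s)$ is meaningful. The integral $\int_0^tB(s,w_s)\,\mathrm{d}s$ is a Bochner integral in $H$. *)

theory Defs
  imports "HOL-Probability.Probability"
begin

section \<open>The Hilbert space of square-integrable functions on the real line\<close>

text \<open>
  \<open>'a l2\<close> consists of the almost-everywhere classes of square-integrable Borel functions from the
  reals to \<open>'a\<close>. It is made an instance of \<open>real_inner\<close>, \<open>banach\<close> and \<open>second_countable_topology\<close>, so
  that the Borel measurability and the Bochner integral of the library apply to it.
\<close>

definition square_integrable :: "(real \<Rightarrow> 'a::euclidean_space) \<Rightarrow> bool" where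
  "square_integrable f \<longleftrightarrow>
     f \<in> borel_measurable lborel \<and> integrable lborel (\<lambda>x. (norm (f x))\<^sup>2)"

lemma square_integrable_inner:
  assumes "square_integrable f" "square_integrable g"
  shows "integrable lborel (\<lambda>x. f x \<bullet> g x)"
proof (rule Bochner_Integration.integrable_bound)
  show "integrable lborel (\<lambda>x. (norm (f x))\<^sup>2 + (norm (g x))\<^sup>2)"
    using assms by (auto simp: square_integrable_def)
  show "(\<lambda>x. f x \<bullet> g x) \<in> borel_measurable lborel"
    using assms by (auto simp: square_integrable_def)
  have "\<bar>f x \<bullet> g x\<bar> \<le> (norm (f x))\<^sup>2 + (norm (g x))\<^sup>2" for x
  proof -
    have "\<bar>f x \<bullet> g x\<bar> \<le> norm (f x) * norm (g x)" by (rule Cauchy_Schwarz_ineq2)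
    moreover have "2 * (norm (f x) * norm (g x)) \<le> (norm (f x))\<^sup>2 + (norm (g x))\<^sup>2"
      using sum_squares_bound[of "norm (f x)" "norm (g x)"] by (simp add: mult.assoc)
    moreover have "0 \<le> norm (f x) * norm (g x)" by simp
    ultimately show ?thesis by linarith
  qed
  then show "AE x in lborel. norm (f x \<bullet> g x) \<le> norm ((norm (f x))\<^sup>2 + (norm (g x))\<^sup>2)"
    by auto
qed

lemma square_integrable_add:
  assumes "square_integrable f" "square_integrable g"
  shows "square_integrable (\<lambda>x. f x + g x)"
proof -
  have "(norm (f x + g x))\<^sup>2 = (norm (f x))\<^sup>2 + 2 * (f x \<bullet> g x) + (norm (g x))\<^sup>2" for x
    by (simp add: power2_norm_eq_inner inner_add inner_commute)
  then show ?thesis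
    using assms square_integrable_inner[OF assms] by (auto simp: square_integrable_def)
qed

lemma square_integrable_scaleR:
  "square_integrable f \<Longrightarrow> square_integrable (\<lambda>x. c *\<^sub>R f x)"
  by (auto simp: square_integrable_def power_mult_distrib)

lemma square_integrable_uminus: "square_integrable f \<Longrightarrow> square_integrable (\<lambda>x. - f x)"
  by (auto simp: square_integrable_def)

lemma square_integrable_diff:
  "square_integrable f \<Longrightarrow> square_integrable g \<Longrightarrow> square_integrable (\<lambda>x. f x - g x)"
  using square_integrable_add[of f "\<lambda>x. - g x"] square_integrable_uminus[of g] by simp

lemma square_integrable_0: "square_integrable (\<lambda>x. 0)"
  by (auto simp: square_integrable_def)

lemma square_integrable_bound:
  fixes f :: "real \<Rightarrow> 'a::euclidean_space" and g :: "real \<Rightarrow> 'b::euclidean_space"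
  assumes "square_integrable g" "f \<in> borel_measurable lborel"
    "AE x in lborel. norm (f x) \<le> norm (g x)"
  shows "square_integrable f"
proof -
  have "integrable lborel (\<lambda>x. (norm (f x))\<^sup>2)"
  proof (rule Bochner_Integration.integrable_bound)
    show "integrable lborel (\<lambda>x. (norm (g x))\<^sup>2)"
      using assms by (auto simp: square_integrable_def)
    show "(\<lambda>x. (norm (f x))\<^sup>2) \<in> borel_measurable lborel" using assms by simp
    show "AE x in lborel. norm ((norm (f x))\<^sup>2) \<le> norm ((norm (g x))\<^sup>2)"
      using assms(3) by eventually_elim (auto intro: power_mono)
  qed
  then show ?thesis using assms by (auto simp: square_integrable_def)
qed

definition l2_rel :: "(real \<Rightarrow> 'a::euclidean_space) \<Rightarrow> (real \<Rightarrow> 'a) \<Rightarrow> bool" where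
  "l2_rel f g \<longleftrightarrow>
     square_integrable f \<and> square_integrable g \<and> (AE x in lborel. f x = g x)"

quotient_type (overloaded) 'a l2 = "real \<Rightarrow> 'a::euclidean_space" / partial: l2_rel
proof (rule part_equivpI)
  show "\<exists>f::real \<Rightarrow> 'a. l2_rel f f"
    by (rule exI[of _ "\<lambda>_. 0"]) (simp add: l2_rel_def square_integrable_0)
  show "symp (l2_rel :: (real \<Rightarrow> 'a) \<Rightarrow> _)"
    by (auto simp: symp_def l2_rel_def elim: AE_mp)
  show "transp (l2_rel :: (real \<Rightarrow> 'a) \<Rightarrow> _)"
    by (rule transpI) (auto simp: l2_rel_def elim!: AE_mp)
qed

instantiation l2 :: (euclidean_space) real_inner
begin

lift_definition zero_l2 :: "'a l2" is "\<lambda>_. 0"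
  by (simp add: l2_rel_def square_integrable_0)

lift_definition plus_l2 :: "'a l2 \<Rightarrow> 'a l2 \<Rightarrow> 'a l2" is "\<lambda>f g x. f x + g x"
  unfolding l2_rel_def by (auto intro: square_integrable_add elim!: AE_mp)

lift_definition uminus_l2 :: "'a l2 \<Rightarrow> 'a l2" is "\<lambda>f x. - f x"
  unfolding l2_rel_def by (auto intro: square_integrable_uminus elim!: AE_mp)

lift_definition minus_l2 :: "'a l2 \<Rightarrow> 'a l2 \<Rightarrow> 'a l2" is "\<lambda>f g x. f x - g x"
  unfolding l2_rel_def by (auto intro: square_integrable_diff elim!: AE_mp)

lift_definition scaleR_l2 :: "real \<Rightarrow> 'a l2 \<Rightarrow> 'a l2" is "\<lambda>c f x. c *\<^sub>R f x"
  unfolding l2_rel_def by (auto intro: square_integrable_scaleR elim!: AE_mp)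

lift_definition inner_l2 :: "'a l2 \<Rightarrow> 'a l2 \<Rightarrow> real" is "\<lambda>f g. LBINT x. f x \<bullet> g x"
proof -
  fix f f' g g' :: "real \<Rightarrow> 'a"
  assume "l2_rel f f'" "l2_rel g g'"
  then show "(LBINT x. f x \<bullet> g x) = (LBINT x. f' x \<bullet> g' x)"
    unfolding l2_rel_def by (intro integral_cong_AE) (auto simp: square_integrable_def elim!: AE_mp)
qed

definition norm_l2 :: "'a l2 \<Rightarrow> real" where "norm_l2 f = sqrt (f \<bullet> f)"

definition sgn_l2 :: "'a l2 \<Rightarrow> 'a l2" where "sgn_l2 f = scaleR (inverse (norm f)) f"

definition dist_l2 :: "'a l2 \<Rightarrow> 'a l2 \<Rightarrow> real" where "dist_l2 f g = norm (f - g)"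

definition uniformity_l2 :: "('a l2 \<times> 'a l2) filter" where
  "uniformity_l2 = (INF e\<in>{0 <..}. principal {(x, y). dist x y < e})"

definition open_l2 :: "'a l2 set \<Rightarrow> bool" where
  "open_l2 U \<longleftrightarrow> (\<forall>x\<in>U. eventually (\<lambda>(x', y). x' = x \<longrightarrow> y \<in> U) uniformity)"

instance
proof
  fix x y z :: "'a l2" and a b r :: real
  show "x + y + z = x + (y + z)"
    by transfer (auto simp: l2_rel_def add.assoc intro!: square_integrable_add)
  show "x + y = y + x"
    by transfer (auto simp: l2_rel_def add.commute intro!: square_integrable_add)
  show "0 + x = x"
    by transfer (auto simp: l2_rel_def)
  show "- x + x = 0"
    by transfer (auto simp: l2_rel_def square_integrable_0)
  show "x - y = x + - y"
    by transfer (auto simp: l2_rel_def intro: square_integrable_diff)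
  show "a *\<^sub>R (x + y) = a *\<^sub>R x + a *\<^sub>R y"
    by transfer (auto simp: l2_rel_def scaleR_add_right
        intro!: square_integrable_add square_integrable_scaleR)
  show "(a + b) *\<^sub>R x = a *\<^sub>R x + b *\<^sub>R x"
    by transfer (auto simp: l2_rel_def scaleR_add_left
        intro!: square_integrable_add square_integrable_scaleR)
  show "a *\<^sub>R b *\<^sub>R x = (a * b) *\<^sub>R x"
    by transfer (auto simp: l2_rel_def intro!: square_integrable_scaleR)
  show "1 *\<^sub>R x = x"
    by transfer (auto simp: l2_rel_def)
  show "dist x y = norm (x - y)" by (rule dist_l2_def)
  show "sgn x = scaleR (inverse (norm x)) x" by (rule sgn_l2_def)
  show "(uniformity :: ('a l2 \<times> 'a l2) filter) = (INF e\<in>{0 <..}. principal {(x, y). dist x y < e})"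
    by (rule uniformity_l2_def)
  show "open U \<longleftrightarrow> (\<forall>x\<in>U. eventually (\<lambda>(x', y). x' = x \<longrightarrow> y \<in> U) uniformity)"
    for U :: "'a l2 set" by (rule open_l2_def)
  show "x \<bullet> y = y \<bullet> x"
    by transfer (simp add: inner_commute)
  show "(x + y) \<bullet> z = x \<bullet> z + y \<bullet> z"
    by transfer (simp add: l2_rel_def inner_add_left square_integrable_inner)
  show "(r *\<^sub>R x) \<bullet> y = r * (x \<bullet> y)"
    by transfer (simp add: l2_rel_def)
  show "0 \<le> x \<bullet> x"
    by transfer (simp add: l2_rel_def)
  show "x \<bullet> x = 0 \<longleftrightarrow> x = 0"
    by transfer (auto simp: l2_rel_def square_integrable_0 integral_nonneg_eq_0_iff_AE
        square_integrable_inner)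
  show "norm x = sqrt (x \<bullet> x)" by (rule norm_l2_def)
qed

end

lift_definition l2_class :: "(real \<Rightarrow> 'a::euclidean_space) \<Rightarrow> 'a l2"
  is "\<lambda>f. if square_integrable f then f else (\<lambda>_. 0)"
  by (auto simp: l2_rel_def square_integrable_0)

lemma l2_class_ex: "\<exists>f. square_integrable f \<and> x = l2_class f"
  by transfer (auto simp: l2_rel_def)

lemma l2_class_0: "l2_class (\<lambda>_. 0) = 0"
  by transfer (auto simp: l2_rel_def square_integrable_0)

lemma l2_class_add:
  "square_integrable f \<Longrightarrow> square_integrable g \<Longrightarrow> l2_class (\<lambda>x. f x + g x) = l2_class f + l2_class g"
  by transfer (auto simp: l2_rel_def square_integrable_add)

lemma l2_class_diff:
  "square_integrable f \<Longrightarrow> square_integrable g \<Longrightarrow> l2_class (\<lambda>x. f x - g x) = l2_class f - l2_class g"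
  by transfer (auto simp: l2_rel_def square_integrable_diff)

lemma l2_class_scaleR:
  "square_integrable f \<Longrightarrow> l2_class (\<lambda>x. c *\<^sub>R f x) = c *\<^sub>R l2_class f"
  by transfer (auto simp: l2_rel_def square_integrable_scaleR)

lemma l2_class_eq_iff:
  "square_integrable f \<Longrightarrow> square_integrable g \<Longrightarrow> l2_class f = l2_class g \<longleftrightarrow> (AE x in lborel. f x = g x)"
  by transfer (auto simp: l2_rel_def)

lemma norm_l2_class:
  "square_integrable f \<Longrightarrow> (norm (l2_class f))\<^sup>2 = (LBINT x. (norm (f x))\<^sup>2)"
  unfolding power2_norm_eq_inner by transfer auto

lemma norm_l2_class_nn:
  assumes "square_integrable f"
  shows "ennreal ((norm (l2_class f))\<^sup>2) = (\<integral>\<^sup>+x. ennreal ((norm (f x))\<^sup>2) \<partial>lborel)"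
  using assms unfolding norm_l2_class[OF assms]
  by (intro nn_integral_eq_integral[symmetric]) (auto simp: square_integrable_def)

subsection \<open>Completeness\<close>

lemma l2_sequence_limit:
  fixes f :: "nat \<Rightarrow> real \<Rightarrow> 'a::euclidean_space"
  assumes f: "\<And>n. square_integrable (f n)"
    and d: "\<And>n. (norm (l2_class (f (Suc n)) - l2_class (f n)))\<^sup>2 \<le> (1/8) ^ n"
  shows "\<exists>g. g \<in> borel_measurable lborel \<and> (AE x in lborel. (\<lambda>n. f n x) \<longlonglongrightarrow> g x)"
proof -
  have [measurable]: "f n \<in> borel_measurable lborel" for n
    using f by (auto simp: square_integrable_def)
  define h where "h n x = (norm (f (Suc n) x - f n x))\<^sup>2" for n x
  have [measurable]: "h n \<in> borel_measurable lborel" for n unfolding h_def by measurable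
  have h_int: "(\<integral>\<^sup>+x. ennreal (4 ^ n * h n x) \<partial>lborel) \<le> ennreal ((1/2) ^ n)" for n
  proof -
    have "(\<integral>\<^sup>+x. ennreal (4 ^ n * h n x) \<partial>lborel) = ennreal (4 ^ n) * (\<integral>\<^sup>+x. ennreal (h n x) \<partial>lborel)"
      by (subst nn_integral_cmult[symmetric]) (simp_all add: ennreal_mult' h_def)
    also have "(\<integral>\<^sup>+x. ennreal (h n x) \<partial>lborel) = ennreal ((norm (l2_class (f (Suc n)) - l2_class (f n)))\<^sup>2)"
      unfolding h_def using norm_l2_class_nn[OF square_integrable_diff[OF f f, of "Suc n" n]] f
      by (simp add: l2_class_diff)
    also have "ennreal (4 ^ n) * \<dots> \<le> ennreal (4 ^ n) * ennreal ((1/8) ^ n)"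
      by (intro mult_left_mono ennreal_leI d) auto
    also have "\<dots> = ennreal (4 ^ n * (1/8) ^ n)" by (rule ennreal_mult[symmetric]) auto
    also have "4 ^ n * (1/8) ^ n = ((1/2) ^ n :: real)" by (simp flip: power_mult_distrib)
    finally show ?thesis .
  qed
  have "(\<integral>\<^sup>+x. (\<Sum>n. ennreal (4 ^ n * h n x)) \<partial>lborel) = (\<Sum>n. \<integral>\<^sup>+x. ennreal (4 ^ n * h n x) \<partial>lborel)"
    by (intro nn_integral_suminf) measurable
  also have "\<dots> \<le> (\<Sum>n. ennreal ((1/2) ^ n))"
    by (intro suminf_le h_int) auto
  also have "\<dots> = ennreal (\<Sum>n. (1/2) ^ n)"
    by (intro suminf_ennreal2) auto
  also have "\<dots> < \<infinity>" by simp
  finally have "AE x in lborel. (\<Sum>n. ennreal (4 ^ n * h n x)) \<noteq> \<infinity>"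
    by (intro nn_integral_PInf_AE) auto
  then have ae: "AE x in lborel. convergent (\<lambda>n. f n x)"
  proof eventually_elim
    fix x assume "(\<Sum>n. ennreal (4 ^ n * h n x)) \<noteq> \<infinity>"
    then have s: "summable (\<lambda>n. 4 ^ n * h n x)"
      by (intro summable_suminf_not_top) (auto simp: h_def)
    from summable_imp_Bseq[OF s] obtain C where C: "C > 0" "\<And>n. norm (4 ^ n * h n x) \<le> C"
      by (auto simp: Bseq_def)
    have "norm (f (Suc n) x - f n x) \<le> sqrt C * (1/2) ^ n" for n
    proof -
      have pow: "((2::real) ^ n)\<^sup>2 = 4 ^ n"
        by (simp add: power2_eq_square flip: power_mult_distrib)
      have "(2 ^ n * norm (f (Suc n) x - f n x))\<^sup>2 = 4 ^ n * h n x"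
        unfolding h_def power_mult_distrib pow ..
      also have "\<dots> \<le> C" using C(2)[of n] by simp
      finally have "2 ^ n * norm (f (Suc n) x - f n x) \<le> sqrt C"
        by (rule real_le_rsqrt)
      then have "norm (f (Suc n) x - f n x) \<le> sqrt C / 2 ^ n"
        by (subst pos_le_divide_eq) (simp_all add: mult.commute)
      then show ?thesis by (simp add: power_one_over)
    qed
    moreover have "summable (\<lambda>n. sqrt C * (1/2::real) ^ n)"
      by (rule summable_mult, rule summable_geometric) simp
    ultimately have "summable (\<lambda>n. norm (f (Suc n) x - f n x))"
      by (rule_tac summable_comparison_test'[of "\<lambda>n. sqrt C * (1/2) ^ n" 0]) simp_all
    then have "summable (\<lambda>n. f (Suc n) x - f n x)" by (rule summable_norm_cancel)
    then have "convergent (\<lambda>n. f 0 x + (\<Sum>i<n. f (Suc i) x - f i x))"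
      by (intro convergent_add convergent_const) (simp only: summable_iff_convergent)
    moreover have "f 0 x + (\<Sum>i<n. f (Suc i) x - f i x) = f n x" for n
      using sum_lessThan_telescope[of "\<lambda>i. f i x" n] by simp
    ultimately show "convergent (\<lambda>n. f n x)" by simp
  qed
  show ?thesis
  proof (intro exI conjI)
    show "(\<lambda>x. lim (\<lambda>n. f n x)) \<in> borel_measurable lborel" by measurable
    show "AE x in lborel. (\<lambda>n. f n x) \<longlonglongrightarrow> lim (\<lambda>n. f n x)"
      using ae by eventually_elim (simp add: convergent_LIMSEQ_iff)
  qed
qed

lemma l2_class_LIMSEQ_dominated:
  fixes f :: "nat \<Rightarrow> real \<Rightarrow> 'a::euclidean_space"
  assumes f: "\<And>n. f n \<in> borel_measurable lborel" and g: "g \<in> borel_measurable lborel"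
    and lim: "AE x in lborel. (\<lambda>n. f n x) \<longlonglongrightarrow> g x"
    and bd: "\<And>n. AE x in lborel. norm (f n x) \<le> w x"
    and w: "integrable lborel (\<lambda>x. (w x)\<^sup>2)" "w \<in> borel_measurable lborel"
  shows "(\<lambda>n. l2_class (f n)) \<longlonglongrightarrow> l2_class g"
    and "square_integrable g" and "square_integrable (f n)"
proof -
  have sw: "square_integrable w" using w by (simp add: square_integrable_def)
  have sf: "square_integrable (f n)" for n
    by (rule square_integrable_bound[OF sw f]) (use bd[of n] in \<open>eventually_elim, auto\<close>)
  have "AE x in lborel. \<forall>n. norm (f n x) \<le> w x" using bd by (simp add: AE_all_countable)
  with lim have bg: "AE x in lborel. norm (g x) \<le> w x"
  proof eventually_elim
    fix x assume "(\<lambda>n. f n x) \<longlonglongrightarrow> g x" "\<forall>n. norm (f n x) \<le> w x"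
    then show "norm (g x) \<le> w x"
      by (intro LIMSEQ_le_const2[OF tendsto_norm]) auto
  qed
  have sg: "square_integrable g"
    by (rule square_integrable_bound[OF sw g]) (use bg in \<open>eventually_elim, auto\<close>)
  show "square_integrable g" "square_integrable (f n)" by (fact sg, fact sf)
  have "(\<lambda>n. LBINT x. (norm (f n x - g x))\<^sup>2) \<longlonglongrightarrow> (LBINT x::real. 0)"
  proof (rule integral_dominated_convergence)
    show "integrable lborel (\<lambda>x. 4 * (w x)\<^sup>2)" using w by simp
    show "AE x in lborel. (\<lambda>n. (norm (f n x - g x))\<^sup>2) \<longlonglongrightarrow> 0"
      using lim
    proof eventually_elim
      fix x assume "(\<lambda>n. f n x) \<longlonglongrightarrow> g x"
      then have "(\<lambda>n. (norm (f n x - g x))\<^sup>2) \<longlonglongrightarrow> (norm (g x - g x))\<^sup>2"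
        by (intro tendsto_intros)
      then show "(\<lambda>n. (norm (f n x - g x))\<^sup>2) \<longlonglongrightarrow> 0" by simp
    qed
    show "AE x in lborel. norm ((norm (f n x - g x))\<^sup>2) \<le> 4 * (w x)\<^sup>2" for n
      using bd[of n] bg
    proof eventually_elim
      fix x assume "norm (f n x) \<le> w x" "norm (g x) \<le> w x"
      then have "norm (f n x - g x) \<le> 2 * w x"
        using norm_triangle_ineq4[of "f n x" "g x"] by linarith
      then have "(norm (f n x - g x))\<^sup>2 \<le> (2 * w x)\<^sup>2" by (intro power_mono) auto
      then show "norm ((norm (f n x - g x))\<^sup>2) \<le> 4 * (w x)\<^sup>2" by simp
    qed
  qed (use f g in auto)
  moreover have "(LBINT x. (norm (f n x - g x))\<^sup>2) = (norm (l2_class (f n) - l2_class g))\<^sup>2" for n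
    using norm_l2_class[OF square_integrable_diff[OF sf sg]] by (simp add: l2_class_diff sf sg)
  ultimately have "(\<lambda>n. (norm (l2_class (f n) - l2_class g))\<^sup>2) \<longlonglongrightarrow> 0" by simp
  then have "(\<lambda>n. sqrt ((norm (l2_class (f n) - l2_class g))\<^sup>2)) \<longlonglongrightarrow> sqrt 0"
    by (rule tendsto_real_sqrt)
  then have "(\<lambda>n. norm (l2_class (f n) - l2_class g)) \<longlonglongrightarrow> 0" by simp
  then show "(\<lambda>n. l2_class (f n)) \<longlonglongrightarrow> l2_class g"
    by (simp add: tendsto_norm_zero_iff LIM_zero_iff)
qed

instance l2 :: (euclidean_space) banach
proof
  fix X :: "nat \<Rightarrow> 'a l2"
  assume X: "Cauchy X"
  have "\<exists>r. strict_mono r \<and> (\<forall>n. \<forall>m\<ge>r n. norm (X m - X (r n)) < (1/3) ^ n)"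
  proof -
    have ex: "\<exists>N. \<forall>m\<ge>N. \<forall>k\<ge>N. norm (X m - X k) < (1/3) ^ n" for n
      by (rule X[THEN CauchyD]) simp
    then have "\<exists>N. \<forall>n. \<forall>m\<ge>N n. \<forall>k\<ge>N n. norm (X m - X k) < (1/3) ^ n"
      by (intro choice allI)
    then obtain N where N: "\<And>n m k. m \<ge> N n \<Longrightarrow> k \<ge> N n \<Longrightarrow> norm (X m - X k) < (1/3) ^ n"
      by blast
    define r where "r n = (\<Sum>i\<le>n. N i) + n" for n
    have Nr: "N n \<le> r n" for n
    proof -
      have "N n \<le> (\<Sum>i\<le>n. N i)" by (rule member_le_sum) auto
      then show ?thesis unfolding r_def by linarith
    qed
    have "strict_mono r" by (rule strict_mono_Suc_iff[THEN iffD2]) (simp add: r_def)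
    moreover have "norm (X m - X (r n)) < (1/3) ^ n" if "m \<ge> r n" for m n
      by (rule N) (use that Nr[of n] in linarith)+
    ultimately show ?thesis by blast
  qed
  then obtain r where r: "strict_mono r" "\<And>n m. m \<ge> r n \<Longrightarrow> norm (X m - X (r n)) < (1/3) ^ n"
    by blast
  have "\<exists>f. \<forall>n. square_integrable (f n) \<and> X n = l2_class (f n)"
    by (intro choice allI l2_class_ex)
  then obtain f where f: "\<And>n. square_integrable (f n)" "\<And>n. X n = l2_class (f n)"
    by blast
  have "\<exists>g. g \<in> borel_measurable lborel \<and> (AE x in lborel. (\<lambda>n. f (r n) x) \<longlonglongrightarrow> g x)"
  proof (rule l2_sequence_limit)
    fix n
    have "norm (X (r (Suc n)) - X (r n)) < (1/3) ^ n"
      by (intro r(2)) (simp add: strict_mono_less_eq[OF r(1)])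
    then have "(norm (X (r (Suc n)) - X (r n)))\<^sup>2 \<le> ((1/3) ^ n)\<^sup>2"
      by (rule power_mono[OF less_imp_le norm_ge_zero])
    also have "((1/3) ^ n)\<^sup>2 = ((1/3)\<^sup>2 :: real) ^ n" by (simp only: power_mult[symmetric] mult.commute)
    also have "\<dots> = (1/9) ^ n" by (simp only: power_divide power_one) simp
    also have "\<dots> \<le> (1/8) ^ n" by (rule power_mono) simp_all
    finally show "(norm (l2_class (f (r (Suc n))) - l2_class (f (r n))))\<^sup>2 \<le> (1/8) ^ n"
      by (simp add: f)
  qed (rule f)
  then obtain g where g: "g \<in> borel_measurable lborel"
    and lim: "AE x in lborel. (\<lambda>n. f (r n) x) \<longlonglongrightarrow> g x" by blast
  have [measurable]: "f n \<in> borel_measurable lborel" "g \<in> borel_measurable lborel" for n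
    using f g by (auto simp: square_integrable_def)
  have fatou: "(\<integral>\<^sup>+x. ennreal ((norm (g x - f (r n) x))\<^sup>2) \<partial>lborel) \<le> ennreal (((1/3) ^ n)\<^sup>2)" for n
  proof -
    have "(\<integral>\<^sup>+x. ennreal ((norm (g x - f (r n) x))\<^sup>2) \<partial>lborel)
      = (\<integral>\<^sup>+x. liminf (\<lambda>m. ennreal ((norm (f (r m) x - f (r n) x))\<^sup>2)) \<partial>lborel)"
    proof (rule nn_integral_cong_AE, use lim in eventually_elim)
      fix x assume "(\<lambda>m. f (r m) x) \<longlonglongrightarrow> g x"
      then have "(\<lambda>m. ennreal ((norm (f (r m) x - f (r n) x))\<^sup>2)) \<longlonglongrightarrow>
                  ennreal ((norm (g x - f (r n) x))\<^sup>2)"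
        by (intro tendsto_intros)
      then show "ennreal ((norm (g x - f (r n) x))\<^sup>2)
        = liminf (\<lambda>m. ennreal ((norm (f (r m) x - f (r n) x))\<^sup>2))"
        by (intro lim_imp_Liminf[symmetric]) auto
    qed
    also have "\<dots> \<le> liminf (\<lambda>m. \<integral>\<^sup>+x. ennreal ((norm (f (r m) x - f (r n) x))\<^sup>2) \<partial>lborel)"
      by (intro nn_integral_liminf) measurable
    also have "\<dots> = liminf (\<lambda>m. ennreal ((norm (X (r m) - X (r n)))\<^sup>2))"
      using norm_l2_class_nn[OF square_integrable_diff[OF f(1) f(1)]] f
      by (simp add: l2_class_diff)
    also have "\<dots> \<le> liminf (\<lambda>m. ennreal (((1/3) ^ n)\<^sup>2))"
    proof (rule Liminf_mono, rule eventually_sequentiallyI[of n])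
      fix m assume "n \<le> m"
      then have "norm (X (r m) - X (r n)) < (1/3) ^ n"
        by (intro r(2)) (simp add: strict_mono_less_eq[OF r(1)])
      then show "ennreal ((norm (X (r m) - X (r n)))\<^sup>2) \<le> ennreal (((1/3) ^ n)\<^sup>2)"
        by (intro ennreal_leI power_mono less_imp_le norm_ge_zero)
    qed
    also have "\<dots> = ennreal (((1/3) ^ n)\<^sup>2)" by (simp add: Liminf_const)
    finally show ?thesis .
  qed
  have sd: "square_integrable (\<lambda>x. g x - f (r n) x)" for n
  proof -
    have "integrable lborel (\<lambda>x. (norm (g x - f (r n) x))\<^sup>2)"
      using le_less_trans[OF fatou[of n] ennreal_less_top] by (intro integrableI_bounded) simp_all
    then show ?thesis by (auto simp: square_integrable_def)
  qed
  have sg: "square_integrable g"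
    using square_integrable_add[OF sd[of 0] f(1)[of "r 0"]] by simp
  have bound: "norm (l2_class g - X (r n)) \<le> (1/3) ^ n" for n
  proof -
    have "ennreal ((norm (l2_class g - X (r n)))\<^sup>2) \<le> ennreal (((1/3) ^ n)\<^sup>2)"
      using norm_l2_class_nn[OF sd[of n]] fatou[of n] f sg by (simp add: l2_class_diff)
    then have "(norm (l2_class g - X (r n)))\<^sup>2 \<le> ((1/3) ^ n)\<^sup>2" by (rule ennreal_le_iff[THEN iffD1, rotated]) (rule zero_le_power2)
    then show ?thesis by (rule power2_le_imp_le) (rule zero_le_power, simp)
  qed
  have "(\<lambda>n. X (r n)) \<longlonglongrightarrow> l2_class g"
  proof (rule Lim_null_comparison[THEN LIM_zero_cancel])
    show "\<forall>\<^sub>F n in sequentially. norm (X (r n) - l2_class g) \<le> (1/3) ^ n"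
      using bound by (simp add: norm_minus_commute)
    show "(\<lambda>n. (1/3::real) ^ n) \<longlonglongrightarrow> 0" by (intro LIMSEQ_power_zero) simp
  qed
  then have "X \<longlonglongrightarrow> l2_class g"
    using X r(1) by (intro Cauchy_converges_subseq[of X r]) (auto simp: comp_def)
  then show "convergent X" by (rule convergentI)
qed

subsection \<open>Separability\<close>

lemma square_integrable_indicator:
  assumes "A \<in> sets borel"
  shows "square_integrable (\<lambda>x. indicator (A \<inter> {- of_nat n<..of_nat n}) x *\<^sub>R v)"
proof -
  have "square_integrable (\<lambda>x. indicator {- real n<..real n} x *\<^sub>R v)"
  proof -
    have "(norm (indicator {- real n<..real n} x *\<^sub>R v))\<^sup>2
        = indicator {- real n<..real n} x * (norm v)\<^sup>2" for x
      by (simp add: indicator_def)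
    then show ?thesis
      by (simp add: square_integrable_def)
  qed
  then show ?thesis
    by (rule square_integrable_bound) (use assms in \<open>auto simp: indicator_def\<close>)
qed

definition l2_step :: "real \<times> real \<times> real \<times> 'a::euclidean_space \<Rightarrow> 'a l2" where
  "l2_step = (\<lambda>(q, a, b, e). l2_class (\<lambda>x. indicator {a<..b} x *\<^sub>R q *\<^sub>R e))"

definition l2_dense :: "'a::euclidean_space l2 set" where
  "l2_dense = (\<lambda>ps. sum_list (map l2_step ps)) ` lists (\<rat> \<times> \<rat> \<times> \<rat> \<times> Basis)"

lemma countable_l2_dense: "countable l2_dense"
  unfolding l2_dense_def
  by (intro countable_image countable_lists countable_SIGMA countable_rat)
     (auto intro: countable_finite)

lemma closure_l2_dense_LIMSEQ:
  "X \<longlonglongrightarrow> x \<Longrightarrow> (\<And>n. X n \<in> closure l2_dense) \<Longrightarrow> x \<in> closure l2_dense"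
  by (rule closed_sequentially[OF closed_closure])

lemma closure_l2_dense_0: "0 \<in> closure l2_dense"
proof -
  have "0 \<in> l2_dense" unfolding l2_dense_def by (rule image_eqI[of _ _ "[]"]) auto
  then show ?thesis using closure_subset by blast
qed

lemma closure_l2_dense_add:
  assumes "x \<in> closure l2_dense" "y \<in> closure l2_dense"
  shows "x + y \<in> closure l2_dense"
proof -
  have add: "u + v \<in> l2_dense" if "u \<in> l2_dense" "v \<in> l2_dense" for u v :: "'a l2"
  proof -
    from that obtain ps qs where
      "ps \<in> lists (\<rat> \<times> \<rat> \<times> \<rat> \<times> Basis)" "u = sum_list (map l2_step ps)"
      "qs \<in> lists (\<rat> \<times> \<rat> \<times> \<rat> \<times> Basis)" "v = sum_list (map l2_step qs)"
      unfolding l2_dense_def by blast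
    then show ?thesis
      unfolding l2_dense_def by (intro image_eqI[of _ _ "ps @ qs"]) auto
  qed
  from assms obtain u v where "\<And>n. u n \<in> l2_dense" "u \<longlonglongrightarrow> x" "\<And>n. v n \<in> l2_dense" "v \<longlonglongrightarrow> y"
    unfolding closure_sequential by blast
  then show ?thesis
    unfolding closure_sequential
    by (intro exI[of _ "\<lambda>n. u n + v n"]) (auto intro: add tendsto_add)
qed

lemma closure_l2_dense_sum:
  assumes "\<And>i. i \<in> I \<Longrightarrow> f i \<in> closure l2_dense"
  shows "(\<Sum>i\<in>I. f i) \<in> closure l2_dense"
  using assms
  by (induction I rule: infinite_finite_induct) (auto intro: closure_l2_dense_0 closure_l2_dense_add)

lemma l2_class_sum:
  assumes "finite I" "\<And>i. i \<in> I \<Longrightarrow> square_integrable (f i)"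
  shows "l2_class (\<lambda>x. \<Sum>i\<in>I. f i x) = (\<Sum>i\<in>I. l2_class (f i))"
    "square_integrable (\<lambda>x. \<Sum>i\<in>I. f i x)"
proof -
  have "l2_class (\<lambda>x. \<Sum>i\<in>I. f i x) = (\<Sum>i\<in>I. l2_class (f i)) \<and> square_integrable (\<lambda>x. \<Sum>i\<in>I. f i x)"
    using assms
  proof (induction I rule: finite_induct)
    case empty
    then show ?case by (simp add: l2_class_0 square_integrable_0)
  next
    case (insert i I)
    then show ?case by (simp add: l2_class_add square_integrable_add)
  qed
  then show "l2_class (\<lambda>x. \<Sum>i\<in>I. f i x) = (\<Sum>i\<in>I. l2_class (f i))"
    "square_integrable (\<lambda>x. \<Sum>i\<in>I. f i x)" by blast+
qed

lemma rat_sequence: "\<exists>q. (\<forall>n::nat. q n \<in> \<rat>) \<and> q \<longlonglongrightarrow> (a::real)"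
proof -
  have "\<exists>q. q \<in> \<rat> \<and> a < q \<and> q < a + 1 / Suc n" for n :: nat
    using Rats_dense_in_real[of a "a + 1 / Suc n"] by auto
  then have "\<exists>q. \<forall>n. q n \<in> \<rat> \<and> a < q n \<and> q n < a + 1 / Suc n" by (intro choice allI)
  then obtain q where q: "\<And>n. q n \<in> \<rat>" "\<And>n. a < q n" "\<And>n. q n < a + 1 / Suc n" by blast
  have "q \<longlonglongrightarrow> a"
  proof (rule tendsto_sandwich)
    show "(\<lambda>n. a) \<longlonglongrightarrow> a" by simp
    show "(\<lambda>n. a + 1 / Suc n) \<longlonglongrightarrow> a"
      using tendsto_add[OF tendsto_const[of a] LIMSEQ_inverse_real_of_nat] by (simp add: inverse_eq_divide)
    show "\<forall>\<^sub>F n in sequentially. a \<le> q n" using q(2) by (intro always_eventually) (auto intro: less_imp_le)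
    show "\<forall>\<^sub>F n in sequentially. q n \<le> a + 1 / Suc n" using q(3) by (intro always_eventually) (auto intro: less_imp_le)
  qed
  then show ?thesis using q(1) by blast
qed

lemma l2_interval_mem:
  fixes e :: "'a::euclidean_space"
  assumes e: "e \<in> Basis"
  shows "l2_class (\<lambda>x. indicator {a<..b} x *\<^sub>R c *\<^sub>R e) \<in> closure l2_dense"
proof -
  obtain qa qb qc where q: "\<And>n::nat. qa n \<in> \<rat>" "qa \<longlonglongrightarrow> a" "\<And>n::nat. qb n \<in> \<rat>" "qb \<longlonglongrightarrow> b"
    "\<And>n::nat. qc n \<in> \<rat>" "qc \<longlonglongrightarrow> c"
    using rat_sequence[of a] rat_sequence[of b] rat_sequence[of c] by blast
  have "Bseq qa" "Bseq qb" "Bseq qc"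
    using q by (auto intro!: convergent_imp_Bseq convergentI)
  then obtain Ka Kb Kc where K: "Ka > 0" "\<And>n. norm (qa n) \<le> Ka" "Kb > 0" "\<And>n. norm (qb n) \<le> Kb"
    "Kc > 0" "\<And>n. norm (qc n) \<le> Kc"
    unfolding Bseq_def by blast
  define w where "w x = indicator {-Ka..Kb} x *\<^sub>R Kc" for x
  have "(\<lambda>n. l2_class (\<lambda>x. indicator {qa n<..qb n} x *\<^sub>R qc n *\<^sub>R e)) \<longlonglongrightarrow>
         l2_class (\<lambda>x. indicator {a<..b} x *\<^sub>R c *\<^sub>R e)"
  proof (rule l2_class_LIMSEQ_dominated(1))
    have "AE x in lborel. x \<noteq> a \<and> x \<noteq> b" by (intro AE_conjI AE_lborel_singleton)
    then show "AE x in lborel. (\<lambda>n. indicator {qa n<..qb n} x *\<^sub>R qc n *\<^sub>R e) \<longlonglongrightarrow> indicator {a<..b} x *\<^sub>R c *\<^sub>R e"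
    proof eventually_elim
      fix x assume x: "x \<noteq> a \<and> x \<noteq> b"
      have "\<forall>\<^sub>F n in sequentially. indicator {qa n<..qb n} x = (indicator {a<..b} x :: real)"
      proof -
        have 1: "\<forall>\<^sub>F n in sequentially. (qa n < x) = (a < x)"
        proof (cases "a < x")
          case True
          with order_tendstoD(2)[OF q(2), of x] show ?thesis by (auto elim: eventually_mono)
        next
          case False
          with x have "x < a" by auto
          from order_tendstoD(1)[OF q(2) this] False show ?thesis by (auto elim: eventually_mono)
        qed
        have 2: "\<forall>\<^sub>F n in sequentially. (x \<le> qb n) = (x \<le> b)"
        proof (cases "x \<le> b")
          case True
          with x have "x < b" by auto
          from order_tendstoD(1)[OF q(4) this] True show ?thesis by (auto elim: eventually_mono)
        next
          case False
          then have "b < x" by auto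
          from order_tendstoD(2)[OF q(4) this] False show ?thesis by (auto elim: eventually_mono)
        qed
        from 1 2 show ?thesis by eventually_elim (auto simp: indicator_def)
      qed
      then have "(\<lambda>n. indicator {qa n<..qb n} x :: real) \<longlonglongrightarrow> indicator {a<..b} x"
        by (rule tendsto_eventually)
      then show "(\<lambda>n. indicator {qa n<..qb n} x *\<^sub>R qc n *\<^sub>R e) \<longlonglongrightarrow> indicator {a<..b} x *\<^sub>R c *\<^sub>R e"
        by (intro tendsto_scaleR q tendsto_const)
    qed
    have "(w x)\<^sup>2 = indicator {-Ka..Kb} x * Kc\<^sup>2" for x by (simp add: w_def indicator_def)
    moreover have "integrable lborel (indicator {-Ka..Kb} :: real \<Rightarrow> real)"
      by (rule integrable_real_indicator) (simp_all add: emeasure_lborel_Icc_eq)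
    ultimately show "integrable lborel (\<lambda>x. (w x)\<^sup>2)" by simp
    show "w \<in> borel_measurable lborel" unfolding w_def by measurable
    show "AE x in lborel. norm (indicator {qa n<..qb n} x *\<^sub>R qc n *\<^sub>R e) \<le> w x" for n
    proof (intro AE_I2)
      fix x
      show "norm (indicator {qa n<..qb n} x *\<^sub>R qc n *\<^sub>R e) \<le> w x"
        using K(2,4,6)[of n] K(5) e by (auto simp: w_def indicator_def)
    qed
  qed measurable
  moreover have "l2_class (\<lambda>x. indicator {qa n<..qb n} x *\<^sub>R qc n *\<^sub>R e) \<in> closure l2_dense" for n
  proof -
    have "l2_class (\<lambda>x. indicator {qa n<..qb n} x *\<^sub>R qc n *\<^sub>R e) \<in> l2_dense"
      unfolding l2_dense_def using q e
      by (intro image_eqI[of _ _ "[(qc n, qa n, qb n, e)]"]) (auto simp: l2_step_def)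
    then show ?thesis using closure_subset by blast
  qed
  ultimately show ?thesis
    by (rule closure_l2_dense_LIMSEQ)
qed

lemma l2_indicator_mem:
  fixes e :: "'a::euclidean_space"
  assumes A: "A \<in> sets borel" and e: "e \<in> Basis"
  shows "l2_class (\<lambda>x. indicator (A \<inter> {- real n<..real n}) x *\<^sub>R c *\<^sub>R e) \<in> closure l2_dense"
proof -
  let ?W = "{- real n<..real n}"
  define P where "P A \<longleftrightarrow> (\<forall>c. l2_class (\<lambda>x. indicator (A \<inter> ?W) x *\<^sub>R c *\<^sub>R e) \<in> closure l2_dense)" for A
  have W: "P UNIV" unfolding P_def using l2_interval_mem[OF e] by simp
  have "Int_stable (range (\<lambda>a::real. {..a}))" by (auto simp: Int_stable_def)
  moreover have "range (\<lambda>a::real. {..a}) \<subseteq> Pow UNIV" by simp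
  moreover have "A \<in> sigma_sets UNIV (range (\<lambda>a::real. {..a}))"
    using A unfolding borel_eq_atMost by simp
  ultimately have "P A"
  proof (induction rule: sigma_sets_induct_disjoint)
    case (basic A)
    then obtain a where "A = {..a}" by blast
    then have "A \<inter> ?W = {- real n<..min a (real n)}" by auto
    then show ?case unfolding P_def using l2_interval_mem[OF e] by simp
  next
    case empty
    then show ?case unfolding P_def by (simp add: l2_class_0 closure_l2_dense_0)
  next
    case (compl A)
    have A: "A \<in> sets borel" using compl(1) unfolding borel_eq_atMost by simp
    have U: "(UNIV :: real set) \<in> sets borel" by simp
    show ?case unfolding P_def
    proof
      fix c
      have "(\<lambda>x. indicator ((UNIV - A) \<inter> ?W) x *\<^sub>R c *\<^sub>R e)
        = (\<lambda>x. indicator (UNIV \<inter> ?W) x *\<^sub>R c *\<^sub>R e + indicator (A \<inter> ?W) x *\<^sub>R (- c) *\<^sub>R e)"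
        by (auto simp: indicator_def)
      then have "l2_class (\<lambda>x. indicator ((UNIV - A) \<inter> ?W) x *\<^sub>R c *\<^sub>R e)
        = l2_class (\<lambda>x. indicator (UNIV \<inter> ?W) x *\<^sub>R c *\<^sub>R e)
          + l2_class (\<lambda>x. indicator (A \<inter> ?W) x *\<^sub>R (- c) *\<^sub>R e)"
        by (simp only: l2_class_add[OF square_integrable_indicator square_integrable_indicator] A U)
      then show "l2_class (\<lambda>x. indicator ((UNIV - A) \<inter> ?W) x *\<^sub>R c *\<^sub>R e) \<in> closure l2_dense"
        using closure_l2_dense_add W compl(2) unfolding P_def by metis
    qed
  next
    case (union A)
    have A: "A i \<in> sets borel" for i using union(2) unfolding borel_eq_atMost by auto
    show ?case unfolding P_def
    proof
      fix c
      let ?f = "\<lambda>k x. \<Sum>i<k. indicator (A i \<inter> ?W) x *\<^sub>R c *\<^sub>R e"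
      have eq: "?f k x = indicator ((\<Union>i<k. A i) \<inter> ?W) x *\<^sub>R c *\<^sub>R e" for k x
      proof -
        have "disjoint_family_on (\<lambda>i. A i \<inter> ?W) {..<k}"
          using union(1) by (auto simp: disjoint_family_on_def)
        then have "indicator (\<Union>i<k. A i \<inter> ?W) x = (\<Sum>i<k. indicator (A i \<inter> ?W) x :: real)"
          by (intro indicator_UN_disjoint) auto
        then show ?thesis by (simp only: scaleR_sum_left[symmetric] UN_extend_simps)
      qed
      have "(\<lambda>k. l2_class (?f k)) \<longlonglongrightarrow> l2_class (\<lambda>x. indicator ((\<Union>i. A i) \<inter> ?W) x *\<^sub>R c *\<^sub>R e)"
      proof (rule l2_class_LIMSEQ_dominated(1))
        show "?f k \<in> borel_measurable lborel" for k using A by measurable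
        show "(\<lambda>x. indicator ((\<Union>i. A i) \<inter> ?W) x *\<^sub>R c *\<^sub>R e) \<in> borel_measurable lborel"
          using A by measurable
        show "AE x in lborel. (\<lambda>k. ?f k x) \<longlonglongrightarrow> indicator ((\<Union>i. A i) \<inter> ?W) x *\<^sub>R c *\<^sub>R e"
        proof (intro AE_I2)
          fix x
          have "(\<lambda>k. indicator ((\<Union>i<k. A i)) x :: real) \<longlonglongrightarrow> indicator (\<Union>i. A i) x"
            by (rule LIMSEQ_indicator_UN)
          then have "(\<lambda>k. (indicator ((\<Union>i<k. A i)) x * indicator ?W x) *\<^sub>R c *\<^sub>R e) \<longlonglongrightarrow>
            (indicator (\<Union>i. A i) x * indicator ?W x) *\<^sub>R c *\<^sub>R e"
            by (intro tendsto_intros)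
          then show "(\<lambda>k. ?f k x) \<longlonglongrightarrow> indicator ((\<Union>i. A i) \<inter> ?W) x *\<^sub>R c *\<^sub>R e"
            unfolding eq by (simp only: indicator_inter_arith)
        qed
        show "AE x in lborel. norm (?f k x) \<le> indicator ?W x * \<bar>c\<bar>" for k
          unfolding eq using e by (intro AE_I2) (auto simp: indicator_def)
        have "(indicator ?W x * \<bar>c\<bar>)\<^sup>2 = indicator ?W x * c\<^sup>2" for x :: real
          by (simp add: indicator_def)
        then show "integrable lborel (\<lambda>x. (indicator ?W x * \<bar>c\<bar>)\<^sup>2)" by simp
        show "(\<lambda>x. indicator ?W x * \<bar>c\<bar>) \<in> borel_measurable lborel" by measurable
      qed
      moreover have "l2_class (?f k) \<in> closure l2_dense" for k
      proof -
        have "l2_class (?f k) = (\<Sum>i<k. l2_class (\<lambda>x. indicator (A i \<inter> ?W) x *\<^sub>R c *\<^sub>R e))"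
          by (rule l2_class_sum(1)[OF finite_lessThan square_integrable_indicator[OF A]])
        also have "\<dots> \<in> closure l2_dense"
          using union(3) unfolding P_def by (intro closure_l2_dense_sum) blast
        finally show ?thesis .
      qed
      ultimately show "l2_class (\<lambda>x. indicator ((\<Union>i. A i) \<inter> ?W) x *\<^sub>R c *\<^sub>R e) \<in> closure l2_dense"
        by (rule closure_l2_dense_LIMSEQ)
    qed
  qed
  then show ?thesis unfolding P_def by blast
qed

lemma closure_l2_dense: "closure l2_dense = (UNIV :: 'a::euclidean_space l2 set)"
proof (intro set_eqI iffI UNIV_I)
  fix u :: "'a l2"
  obtain f where f: "square_integrable f" "u = l2_class f" using l2_class_ex by blast
  have fm[measurable]: "f \<in> borel_measurable lborel" using f by (simp add: square_integrable_def)
  obtain s where "\<forall>i. simple_function lborel (s i)" "\<forall>x\<in>space lborel. (\<lambda>i. s i x) \<longlonglongrightarrow> f x"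
    "\<forall>i. \<forall>x\<in>space lborel. dist (s i x) 0 \<le> 2 * dist (f x) 0"
    using borel_measurable_implies_sequence_metric[OF fm, of 0] by blast
  then have s: "\<And>i. simple_function lborel (s i)" "\<And>x. (\<lambda>i. s i x) \<longlonglongrightarrow> f x"
    "\<And>i x. norm (s i x) \<le> 2 * norm (f x)"
    by simp_all
  have [measurable]: "s i \<in> borel_measurable lborel" for i
    using s(1) by (rule borel_measurable_simple_function)
  let ?W = "\<lambda>n. {- real n<..real n}"
  have lim: "(\<lambda>n. l2_class (\<lambda>x. indicator (?W n) x *\<^sub>R s n x)) \<longlonglongrightarrow> l2_class f"
  proof (rule l2_class_LIMSEQ_dominated(1))
    show "AE x in lborel. (\<lambda>n. indicator (?W n) x *\<^sub>R s n x) \<longlonglongrightarrow> f x"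
    proof (intro AE_I2)
      fix x
      obtain N where N: "\<bar>x\<bar> < real N" using reals_Archimedean2 by blast
      have "\<forall>\<^sub>F n in sequentially. s n x = indicator (?W n) x *\<^sub>R s n x"
        using N by (intro eventually_sequentiallyI[of N]) (auto simp: indicator_def)
      with s(2) show "(\<lambda>n. indicator (?W n) x *\<^sub>R s n x) \<longlonglongrightarrow> f x"
        by (rule Lim_transform_eventually)
    qed
    show "AE x in lborel. norm (indicator (?W n) x *\<^sub>R s n x) \<le> 2 * norm (f x)" for n
      using s(3)[of n] by (intro AE_I2) (auto simp: indicator_def)
    show "integrable lborel (\<lambda>x. (2 * norm (f x))\<^sup>2)"
      using f by (simp add: power_mult_distrib square_integrable_def)
  qed measurable
  have "l2_class (\<lambda>x. indicator (?W n) x *\<^sub>R s n x) \<in> closure l2_dense" for n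
  proof -
    let ?I = "range (s n) \<times> (Basis :: 'a set)"
    let ?g = "\<lambda>(y, e) x. indicator ((s n -` {y}) \<inter> ?W n) x *\<^sub>R (y \<bullet> e) *\<^sub>R e"
    have fin: "finite (range (s n))" using s(1)[of n] by (simp add: simple_function_def)
    have meas: "s n -` {y} \<in> sets borel" for y
      using measurable_sets[of "s n" lborel borel "{y}"] by simp
    have "indicator (?W n) x *\<^sub>R s n x = (\<Sum>p\<in>?I. ?g p x)" for x
    proof -
      have "(\<Sum>p\<in>?I. ?g p x) = (\<Sum>y\<in>range (s n). \<Sum>e\<in>Basis. ?g (y, e) x)"
        by (subst sum.cartesian_product) (simp add: case_prod_beta)
      also have "\<dots> = (\<Sum>y\<in>range (s n). indicator ((s n -` {y}) \<inter> ?W n) x *\<^sub>R y)"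
        by (simp only: prod.case scaleR_sum_right[symmetric] euclidean_representation)
      also have "\<dots> = (\<Sum>y\<in>{s n x}. indicator ((s n -` {y}) \<inter> ?W n) x *\<^sub>R y)"
        by (rule sum.mono_neutral_right[OF fin]) (auto simp: indicator_def)
      also have "\<dots> = indicator (?W n) x *\<^sub>R s n x" by (auto simp: indicator_def)
      finally show ?thesis ..
    qed
    then have "l2_class (\<lambda>x. indicator (?W n) x *\<^sub>R s n x) = l2_class (\<lambda>x. \<Sum>p\<in>?I. ?g p x)"
      by simp
    also have "\<dots> = (\<Sum>p\<in>?I. l2_class (?g p))"
      by (rule l2_class_sum(1)) (use fin in \<open>auto simp del: scaleR_scaleR intro: square_integrable_indicator meas\<close>)
    also have "\<dots> \<in> closure l2_dense"
    proof (rule closure_l2_dense_sum)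
      fix p assume "p \<in> ?I"
      then obtain y e where p: "p = (y, e)" "e \<in> Basis" by blast
      show "l2_class (?g p) \<in> closure l2_dense"
        unfolding p(1) prod.case by (rule l2_indicator_mem[OF meas p(2)])
    qed
    finally show ?thesis .
  qed
  with lim show "u \<in> closure l2_dense"
    unfolding f(2) by (rule closure_l2_dense_LIMSEQ)
qed

instance l2 :: (euclidean_space) second_countable_topology
proof
  define B :: "'a l2 set set" where "B = (\<lambda>(x, r). ball x r) ` (l2_dense \<times> \<rat>)"
  have "countable B" unfolding B_def
    by (intro countable_image countable_SIGMA countable_l2_dense countable_rat)
  moreover have "topological_basis B"
  proof (rule topological_basisI)
    show "open b" if "b \<in> B" for b using that by (auto simp: B_def)
    fix U :: "'a l2 set" and x assume U: "open U" "x \<in> U"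
    then obtain e where e: "e > 0" "ball x e \<subseteq> U" by (auto simp: open_contains_ball)
    obtain q where q: "q \<in> \<rat>" "0 < q" "q < e / 2" using Rats_dense_in_real[of 0 "e / 2"] e by auto
    have "x \<in> closure l2_dense" by (simp add: closure_l2_dense)
    then obtain y where y: "y \<in> l2_dense" "dist y x < q" using q by (auto simp: closure_approachable)
    have "ball y q \<subseteq> U"
    proof
      fix z assume "z \<in> ball y q"
      then have "dist y z < q" by simp
      then have "dist x z < e"
        using dist_triangle[of x z y] y(2) q(3) by (simp add: dist_commute)
      then show "z \<in> U" using e(2) by auto
    qed
    moreover have "x \<in> ball y q" using y(2) by simp
    moreover have "ball y q \<in> B" unfolding B_def using y q by (intro image_eqI[of _ _ "(y, q)"]) auto
    ultimately show "\<exists>b\<in>B. x \<in> b \<and> b \<subseteq> U" by blast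
  qed
  ultimately show "\<exists>B::'a l2 set set. countable B \<and> open = generate_topology B"
    by (blast intro: topological_basis_imp_subbasis)
qed


section \<open>The space $H$\<close>

text \<open>
  Since a type cannot depend on the real number \<open>T\<close>, \<open>L\<^sup>2(0,T)\<close> is identified, by extension by
  zero, with the closed subspace of all elements of \<open>L\<^sup>2(\<real>)\<close> that vanish almost everywhere outside
  \<open>{0..T}\<close>. The class of a function on \<open>{0..T}\<close> is \<open>hclass T f\<close>; values of \<open>f\<close> outside \<open>{0..T}\<close> are
  irrelevant, and \<open>hclass T f = 0\<close> by convention if \<open>f\<close> is not square-integrable on \<open>{0..T}\<close>.
\<close>

definition square_integrable_on :: "real \<Rightarrow> (real \<Rightarrow> 'a::euclidean_space) \<Rightarrow> bool" where
  "square_integrable_on T f \<longleftrightarrow> square_integrable (\<lambda>\<xi>. indicator {0..T} \<xi> *\<^sub>R f \<xi>)"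

definition hclass :: "real \<Rightarrow> (real \<Rightarrow> 'a::euclidean_space) \<Rightarrow> 'a l2" where
  "hclass T f = l2_class (\<lambda>\<xi>. indicator {0..T} \<xi> *\<^sub>R f \<xi>)"


section \<open>Filtered probability spaces and Brownian motion\<close>

locale usual_filtered_prob_space = prob_space M + complete_measure M for M :: "'w measure" +
  fixes F :: "real \<Rightarrow> 'w measure" and T :: real
  assumes subalgebra_F: "t \<in> {0..T} \<Longrightarrow> subalgebra M (F t)"
    and F_mono: "0 \<le> s \<Longrightarrow> s \<le> t \<Longrightarrow> t \<le> T \<Longrightarrow> subalgebra (F t) (F s)"
    and F_right_continuous: "t \<in> {0..<T} \<Longrightarrow> sets (F t) = (\<Inter>u\<in>{t<..T}. sets (F u))"
    and F_null_sets: "null_sets M \<subseteq> sets (F 0)"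

text \<open>
  Only the restriction of the Brownian motion to the index set \<open>{0..T}\<close> of the filtration is used.
\<close>

locale brownian_motion = usual_filtered_prob_space M F T
  for M :: "'w measure" and F :: "real \<Rightarrow> 'w measure" and T :: real +
  fixes W :: "real \<Rightarrow> 'w \<Rightarrow> real ^ 'd"
  assumes W_adapted: "t \<in> {0..T} \<Longrightarrow> W t \<in> borel_measurable (F t)"
    and W_0: "AE \<omega> in M. W 0 \<omega> = 0"
    and W_continuous: "AE \<omega> in M. continuous_on {0..T} (\<lambda>t. W t \<omega>)"
    and W_indep_past: "0 \<le> s \<Longrightarrow> s < t \<Longrightarrow> t \<le> T \<Longrightarrow>
      indep_set (sets (F s)) (sets (vimage_algebra (space M) (\<lambda>\<omega>. W t \<omega> - W s \<omega>) borel))"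
    and W_indep_components: "0 \<le> s \<Longrightarrow> s < t \<Longrightarrow> t \<le> T \<Longrightarrow>
      indep_vars (\<lambda>_. borel) (\<lambda>i \<omega>. (W t \<omega> - W s \<omega>) $ i) UNIV"
    and W_normal: "0 \<le> s \<Longrightarrow> s < t \<Longrightarrow> t \<le> T \<Longrightarrow>
      distributed M lborel (\<lambda>\<omega>. (W t \<omega> - W s \<omega>) $ i) (normal_density 0 (sqrt (t - s)))"


section \<open>The stochastic integral\<close>

text \<open>
  The Ito integral of an operator-valued integrand, with values in a separable Hilbert space, is the
  \<open>L\<^sup>2\<close>-limit of the integrals of elementary integrands
  \<open>\<Sum>i<n. indicator {\<tau> i<..\<tau> (Suc i)} s *\<^sub>R \<phi> i \<omega>\<close>. Measurability of operator-valued maps is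
  understood pointwise (strongly).
\<close>

definition elementary_integrand ::
  "(real \<Rightarrow> 'w measure) \<Rightarrow> real \<Rightarrow> nat \<Rightarrow> (nat \<Rightarrow> real) \<Rightarrow>
    (nat \<Rightarrow> 'w \<Rightarrow> ('u::euclidean_space \<Rightarrow>\<^sub>L 'h::{real_inner, banach, second_countable_topology})) \<Rightarrow> bool"
  where
  "elementary_integrand F t n \<tau> \<phi> \<longleftrightarrow>
     0 \<le> \<tau> 0 \<and> (\<forall>i<n. \<tau> i \<le> \<tau> (Suc i)) \<and> \<tau> n \<le> t \<and>
     (\<forall>i<n. (\<forall>x. (\<lambda>\<omega>. blinfun_apply (\<phi> i \<omega>) x) \<in> borel_measurable (F (\<tau> i))) \<and>
            (\<exists>C. \<forall>\<omega>\<in>space (F (\<tau> i)). norm (\<phi> i \<omega>) \<le> C))"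

definition elementary_process ::
  "nat \<Rightarrow> (nat \<Rightarrow> real) \<Rightarrow> (nat \<Rightarrow> 'w \<Rightarrow> ('u::euclidean_space \<Rightarrow>\<^sub>L 'h::real_normed_vector)) \<Rightarrow>
    real \<Rightarrow> 'w \<Rightarrow> ('u \<Rightarrow>\<^sub>L 'h)" where
  "elementary_process n \<tau> \<phi> s \<omega> = (\<Sum>i<n. indicator {\<tau> i<..\<tau> (Suc i)} s *\<^sub>R \<phi> i \<omega>)"

definition elementary_integral ::
  "(real \<Rightarrow> 'w \<Rightarrow> 'u::euclidean_space) \<Rightarrow> nat \<Rightarrow> (nat \<Rightarrow> real) \<Rightarrow>
    (nat \<Rightarrow> 'w \<Rightarrow> ('u \<Rightarrow>\<^sub>L 'h::real_normed_vector)) \<Rightarrow> 'w \<Rightarrow> 'h" where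
  "elementary_integral W n \<tau> \<phi> \<omega> = (\<Sum>i<n. blinfun_apply (\<phi> i \<omega>) (W (\<tau> (Suc i)) \<omega> - W (\<tau> i) \<omega>))"

definition hilbert_schmidt_norm :: "('u::euclidean_space \<Rightarrow>\<^sub>L 'h::real_normed_vector) \<Rightarrow> real" where
  "hilbert_schmidt_norm A = sqrt (\<Sum>e\<in>Basis. (norm (blinfun_apply A e))\<^sup>2)"

text \<open>
  \<open>has_ito_integral M F W t \<Phi> I\<close>: the random variable \<open>I\<close> is a version of the stochastic integral
  of \<open>\<Phi>\<close> with respect to \<open>W\<close> over \<open>{0..t}\<close>.
\<close>

definition has_ito_integral ::
  "'w measure \<Rightarrow> (real \<Rightarrow> 'w measure) \<Rightarrow> (real \<Rightarrow> 'w \<Rightarrow> 'u::euclidean_space) \<Rightarrow> real \<Rightarrow>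
    (real \<Rightarrow> 'w \<Rightarrow> ('u \<Rightarrow>\<^sub>L 'h::{real_inner, banach, second_countable_topology})) \<Rightarrow> ('w \<Rightarrow> 'h) \<Rightarrow> bool"
  where
  "has_ito_integral M F W t \<Phi> I \<longleftrightarrow>
     I \<in> borel_measurable M \<and>
     (\<forall>x. (\<lambda>(s, \<omega>). blinfun_apply (\<Phi> s \<omega>) x)
             \<in> borel_measurable (restrict_space lborel {0..t} \<Otimes>\<^sub>M M)) \<and>
     (\<exists>n \<tau> \<phi>.
        (\<forall>m::nat. elementary_integrand F t (n m) (\<tau> m) (\<phi> m)) \<and>
        (\<lambda>m. \<integral>\<^sup>+(s, \<omega>). ennreal ((hilbert_schmidt_norm
                 (\<Phi> s \<omega> - elementary_process (n m) (\<tau> m) (\<phi> m) s \<omega>))\<^sup>2)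
               \<partial>(restrict_space lborel {0..t} \<Otimes>\<^sub>M M)) \<longlonglongrightarrow> 0 \<and>
        (\<lambda>m. \<integral>\<^sup>+\<omega>. ennreal ((norm (I \<omega> - elementary_integral W (n m) (\<tau> m) (\<phi> m) \<omega>))\<^sup>2) \<partial>M)
          \<longlonglongrightarrow> 0)"


section \<open>The stochastic Volterra equation and its lift\<close>

definition fractional_kernel :: "real \<Rightarrow> real \<Rightarrow> real" where
  "fractional_kernel \<alpha> t = t powr (\<alpha> - 1) / Gamma \<alpha>"

locale volterra_coefficients =
  fixes T \<alpha> :: real and k1 :: "real \<Rightarrow> real" and b :: "real \<Rightarrow> real ^ 'd \<Rightarrow> real ^ 'd"
  assumes T_pos: "T > 0"
    and alpha: "1 / 2 < \<alpha>" "\<alpha> < 1"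
    and k1_continuous: "continuous_on {0<..} k1"
    and k1_square_integrable: "R > 0 \<Longrightarrow> set_integrable lborel {0<..R} (\<lambda>t. (k1 t)\<^sup>2)"
    and b_measurable: "(\<lambda>(t, x). b t x) \<in> borel_measurable (restrict_space borel {0..T} \<Otimes>\<^sub>M borel)"
    and b_linear_growth_Lipschitz: "\<exists>L>0. \<forall>t\<in>{0..T}. \<forall>x y.
      norm (b t x) \<le> L * (1 + norm x) \<and> norm (b t x - b t y) \<le> L * norm (x - y)"

definition volterra_solution ::
  "'w measure \<Rightarrow> (real \<Rightarrow> 'w measure) \<Rightarrow> real \<Rightarrow> (real \<Rightarrow> 'w \<Rightarrow> real ^ 'd) \<Rightarrow> real \<Rightarrow> (real \<Rightarrow> real) \<Rightarrow>
    (real \<Rightarrow> real ^ 'd \<Rightarrow> real ^ 'd) \<Rightarrow> real ^ 'd \<Rightarrow> (real \<Rightarrow> 'w \<Rightarrow> real ^ 'd) \<Rightarrow> bool" where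
  "volterra_solution M F T W \<alpha> k1 b x0 X \<longleftrightarrow>
     (\<forall>\<omega>\<in>space M. continuous_on {0..T} (\<lambda>t. X t \<omega>)) \<and>
     (\<forall>t\<in>{0..T}. X t \<in> borel_measurable (F t)) \<and>
     (\<forall>t\<in>{0..T}. \<exists>I.
        has_ito_integral M F W t (\<lambda>s \<omega>. fractional_kernel \<alpha> (t - s) *\<^sub>R id_blinfun) I \<and>
        (AE \<omega> in M. X t \<omega> = x0 + (LINT s:{0..t}|lborel. k1 (t - s) *\<^sub>R b s (X s \<omega>)) + I \<omega>))"

text \<open>
  \<open>J t \<xi>\<close> stands for a version of \<open>\<integral>\<^sub>0\<^sup>t k\<^sub>2(\<xi> - s) dW\<^sub>s\<close>.
\<close>

definition continuous_kernel_integral ::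
  "'w measure \<Rightarrow> (real \<Rightarrow> 'w measure) \<Rightarrow> real \<Rightarrow> (real \<Rightarrow> 'w \<Rightarrow> real ^ 'd) \<Rightarrow> real \<Rightarrow>
    (real \<Rightarrow> real \<Rightarrow> 'w \<Rightarrow> real ^ 'd) \<Rightarrow> bool" where
  "continuous_kernel_integral M F T W \<alpha> J \<longleftrightarrow>
     (\<forall>t\<in>{0..T}.
        (\<forall>\<xi>\<in>{t..T}. has_ito_integral M F W t
           (\<lambda>s \<omega>. fractional_kernel \<alpha> (\<xi> - s) *\<^sub>R id_blinfun) (J t \<xi>)) \<and>
        (\<forall>\<omega>\<in>space M. continuous_on {t..T} (\<lambda>\<xi>. J t \<xi> \<omega>)))"

definition forward_process ::
  "(real \<Rightarrow> real) \<Rightarrow> (real \<Rightarrow> real ^ 'd \<Rightarrow> real ^ 'd) \<Rightarrow> real ^ 'd \<Rightarrow> (real \<Rightarrow> 'w \<Rightarrow> real ^ 'd) \<Rightarrow>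
    (real \<Rightarrow> real \<Rightarrow> 'w \<Rightarrow> real ^ 'd) \<Rightarrow> real \<Rightarrow> real \<Rightarrow> 'w \<Rightarrow> real ^ 'd" where
  "forward_process k1 b x0 X J t \<xi> \<omega> =
     x0 + (LINT s:{0..t}|lborel. k1 (\<xi> - s) *\<^sub>R b s (X s \<omega>)) + J t \<xi> \<omega>"

definition lifted_process ::
  "(real \<Rightarrow> 'w \<Rightarrow> real ^ 'd) \<Rightarrow> (real \<Rightarrow> real \<Rightarrow> 'w \<Rightarrow> real ^ 'd) \<Rightarrow> real \<Rightarrow> 'w \<Rightarrow> real \<Rightarrow> real ^ 'd" where
  "lifted_process X \<theta> t \<omega> \<xi> = (if \<xi> \<le> t then X \<xi> \<omega> else \<theta> t \<xi> \<omega>)"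

text \<open>
  Elements of \<open>\<Lambda> = C([0,T])\<close> are functions on the real line that are continuous on \<open>{0..T}\<close>.
\<close>

definition B_lift ::
  "real \<Rightarrow> (real \<Rightarrow> real) \<Rightarrow> (real \<Rightarrow> real ^ 'd \<Rightarrow> real ^ 'd) \<Rightarrow> real \<Rightarrow> (real \<Rightarrow> real ^ 'd) \<Rightarrow> (real ^ 'd) l2"
  where
  "B_lift T k1 b t u = hclass T (\<lambda>\<xi>. (k1 (\<xi> - t) * indicator {t<..} \<xi>) *\<^sub>R b t (u t))"

definition sigma_lift :: "real \<Rightarrow> real \<Rightarrow> real \<Rightarrow> ((real ^ 'd) \<Rightarrow>\<^sub>L (real ^ 'd) l2)" where
  "sigma_lift T \<alpha> t =
     Blinfun (\<lambda>x. hclass T (\<lambda>\<xi>. (fractional_kernel \<alpha> (\<xi> - t) * indicator {t<..} \<xi>) *\<^sub>R x))"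

lemma square_integrable_on_fractional_kernel:
  fixes x :: "real ^ 'd"
  assumes "\<alpha> > 1 / 2" "t \<ge> 0"
  shows "square_integrable_on T (\<lambda>\<xi>. (fractional_kernel \<alpha> (\<xi> - t) * indicator {t<..} \<xi>) *\<^sub>R x)"
proof -
  let ?g = "\<lambda>u::real. indicator {0..T} u *\<^sub>R (u powr (2 * \<alpha> - 2))"
  have "set_integrable lborel {0..T} (\<lambda>u. u powr (2 * \<alpha> - 2))"
  proof (cases "T \<ge> 0")
    case True
    have "(\<lambda>u. u powr (2 * \<alpha> - 2)) absolutely_integrable_on {0..T}"
      using has_integral_powr_from_0[of "2 * \<alpha> - 2" T] True assms
      by (intro nonnegative_absolutely_integrable_1) (auto simp: integrable_on_def)
    then show ?thesis
      unfolding set_integrable_def by (simp add: integrable_completion)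
  qed (simp add: set_integrable_def)
  then have "integrable lborel ?g" by (simp add: set_integrable_def)
  then have "integrable lborel (\<lambda>\<xi>. ?g (- t + 1 * \<xi>))"
    by (intro lborel_integrable_real_affine) auto
  then have g: "integrable lborel (\<lambda>\<xi>. ?g (- t + 1 * \<xi>) * ((norm x)\<^sup>2 / (Gamma \<alpha>)\<^sup>2))"
    by (rule integrable_mult_left)
  have sq: "(u powr (\<alpha> - 1))\<^sup>2 = u powr (2 * \<alpha> - 2)" for u :: real
    by (simp add: power2_eq_square powr_add[symmetric])
  let ?f = "\<lambda>\<xi>. indicator {0..T} \<xi> *\<^sub>R (fractional_kernel \<alpha> (\<xi> - t) * indicator {t<..} \<xi>) *\<^sub>R x"
  have "?f \<in> borel_measurable lborel" unfolding fractional_kernel_def by measurable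
  moreover have "integrable lborel (\<lambda>\<xi>. (norm (?f \<xi>))\<^sup>2)"
  proof (rule Bochner_Integration.integrable_bound[OF g])
    show "AE \<xi> in lborel. norm ((norm (?f \<xi>))\<^sup>2) \<le> norm (?g (- t + 1 * \<xi>) * ((norm x)\<^sup>2 / (Gamma \<alpha>)\<^sup>2))"
      using assms by (intro AE_I2)
        (simp add: indicator_def fractional_kernel_def power_mult_distrib power_divide sq)
  qed (unfold fractional_kernel_def, measurable)
  ultimately show ?thesis by (simp add: square_integrable_on_def square_integrable_def)
qed

lemma blinfun_apply_sigma_lift:
  fixes x :: "real ^ 'd"
  assumes "\<alpha> > 1 / 2" "t \<ge> 0"
  shows "blinfun_apply (sigma_lift T \<alpha> t) x =
    hclass T (\<lambda>\<xi>. (fractional_kernel \<alpha> (\<xi> - t) * indicator {t<..} \<xi>) *\<^sub>R x)"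
proof -
  let ?h = "\<lambda>x::real ^ 'd. hclass T (\<lambda>\<xi>. (fractional_kernel \<alpha> (\<xi> - t) * indicator {t<..} \<xi>) *\<^sub>R x)"
  note sq = square_integrable_on_fractional_kernel[OF assms, unfolded square_integrable_on_def]
  have "linear ?h"
  proof (rule linearI)
    show "?h (x + y) = ?h x + ?h y" for x y
      unfolding hclass_def l2_class_add[OF sq sq, symmetric] by (simp only: scaleR_add_right)
    show "?h (r *\<^sub>R x) = r *\<^sub>R ?h x" for r x
      unfolding hclass_def l2_class_scaleR[OF sq, symmetric] by (simp add: mult_ac)
  qed
  then have "bounded_linear ?h" by (rule linear_conv_bounded_linear[THEN iffD1])
  then show ?thesis unfolding sigma_lift_def by (simp add: bounded_linear_Blinfun_apply)
qed

text \<open>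
  The process \<open>w\<close> is given by its pointwise representatives. Each \<open>w t \<omega>\<close> is an element of \<open>H\<close>, and
  almost surely of \<open>\<Lambda>\<close>, so that \<open>B\<close> can be applied to it.
\<close>

definition lifted_solution ::
  "'w measure \<Rightarrow> (real \<Rightarrow> 'w measure) \<Rightarrow> real \<Rightarrow> (real \<Rightarrow> 'w \<Rightarrow> real ^ 'd) \<Rightarrow> real \<Rightarrow> (real \<Rightarrow> real) \<Rightarrow>
    (real \<Rightarrow> real ^ 'd \<Rightarrow> real ^ 'd) \<Rightarrow> (real ^ 'd) l2 \<Rightarrow> (real \<Rightarrow> 'w \<Rightarrow> real \<Rightarrow> real ^ 'd) \<Rightarrow> bool" where
  "lifted_solution M F T W \<alpha> k1 b \<phi> w \<longleftrightarrow>
     (\<forall>t\<in>{0..T}.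
        (\<forall>\<omega>\<in>space M. square_integrable_on T (w t \<omega>)) \<and>
        (AE \<omega> in M. continuous_on {0..T} (w t \<omega>)) \<and>
        (\<lambda>\<omega>. hclass T (w t \<omega>)) \<in> borel_measurable (F t) \<and>
        (AE \<omega> in M. set_integrable lborel {0..t} (\<lambda>s. B_lift T k1 b s (w s \<omega>))) \<and>
        (\<exists>I. has_ito_integral M F W t (\<lambda>s \<omega>. sigma_lift T \<alpha> s) I \<and>
          (AE \<omega> in M. hclass T (w t \<omega>) =
             \<phi> + (LINT s:{0..t}|lborel. B_lift T k1 b s (w s \<omega>)) + I \<omega>)))"

end

theory Submission
  imports Defs
begin

text \<open>
  For fixed \<open>t\<close>, subtracting \<open>\<phi>\<close> and the Bochner integral of \<open>B\<close> from \<open>w t\<close> leaves the class of the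
  function \<open>\<xi> \<mapsto> Z \<xi>\<close> that at each single \<open>\<xi>\<close> is almost surely the \<open>\<real>\<^sup>d\<close>-valued stochastic integral
  of \<open>s \<mapsto> k\<^sub>2 (\<xi> - s) 1\<^bsub>s < \<xi>\<^esub>\<close> over \<open>{0..t}\<close>: the equation for \<open>X\<close> gives this for \<open>\<xi> \<le> t\<close>, the
  definition of \<open>\<theta>\<close> for \<open>\<xi> > t\<close>. Freezing \<open>\<sigma>\<close> at the left endpoints of an equidistant partition yields
  elementary integrands of \<open>\<sigma>\<close> whose values at \<open>\<xi>\<close> are elementary integrands of the scalar problem. By
  the Ito isometry at each \<open>\<xi>\<close> and Fubini, both errors in the definition of the \<open>H\<close>-valued integral are
  bounded by a constant times the squared \<open>L\<^sup>2\<close> distance of \<open>\<sigma>\<close> from its step approximation, which tends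
  to zero because \<open>s \<mapsto> \<sigma> s\<close> is continuous. The isometry also gives uniqueness of the stochastic
  integral, hence \<open>X t = \<theta> t t\<close> almost surely and the continuity of \<open>w t\<close>.
\<close>

section \<open>The Ito isometry\<close>

text \<open>The identity at a fixed \<xi> holds outside a null set depending on \<xi>, and the
  versions of the integral at different \<xi> are unrelated. So only second moments are compared:
  with joint measurability in (\<omega>, \<xi>) the error in H is a double integral, and at each
  \<xi> the exceptional set drops out. No integral in H is constructed: the remainder of the lift is
  itself the candidate, and only its distance from elementary integrals is estimated. Since
  \<open>has_ito_integral\<close> provides merely some approximating sequence, the isometry for
  elementary integrands is first turned into a bound on the distance of an integral from an
  arbitrary elementary integral. Both kernels may be singular at 0. For k2, square integrability
  (\<alpha> > 1/2) and monotonicity (\<alpha> < 1) give an explicit modulus of continuity of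
  \<sigma>. For k1 neither monotonicity nor a bound near 0 is available, so continuity of \<theta>
  in \<xi> comes from Scheffe's lemma instead of domination; the drift is bounded along each path
  because X is continuous on a compact interval.\<close>

lemma Basis_vec_cases:
  fixes u :: "real ^ 'd"
  assumes "u \<in> Basis"
  obtains i where "\<And>x :: real ^ 'd. x \<bullet> u = x $ i"
  using assms by (auto simp: Basis_vec_def inner_axis)

section \<open>Independence and moments of Brownian increments\<close>

context brownian_motion
begin

lemma space_F: "t \<in> {0..T} \<Longrightarrow> space (F t) = space M"
  using subalgebra_F by (simp add: subalgebra_def)

lemma F_measurable_M: "t \<in> {0..T} \<Longrightarrow> f \<in> borel_measurable (F t) \<Longrightarrow> f \<in> borel_measurable M"
  by (rule measurable_from_subalg[OF subalgebra_F])

lemma F_measurable_mono: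
  "0 \<le> s \<Longrightarrow> s \<le> t \<Longrightarrow> t \<le> T \<Longrightarrow> f \<in> borel_measurable (F s) \<Longrightarrow> f \<in> borel_measurable (F t)"
  by (rule measurable_from_subalg[OF F_mono])

lemma W_measurable: "t \<in> {0..T} \<Longrightarrow> W t \<in> borel_measurable M"
  by (rule F_measurable_M[OF _ W_adapted])

lemma increment_adapted:
  assumes "0 \<le> s" "s \<le> t" "t \<le> r" "r \<le> T"
  shows "(\<lambda>\<omega>. W t \<omega> - W s \<omega>) \<in> borel_measurable (F r)"
proof (rule borel_measurable_diff)
  show "W t \<in> borel_measurable (F r)"
    by (rule F_measurable_mono[OF _ _ _ W_adapted]) (use assms in auto)
  show "W s \<in> borel_measurable (F r)"
    by (rule F_measurable_mono[OF _ _ _ W_adapted]) (use assms in auto)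
qed

lemma increment_independent:
  fixes Y :: "'w \<Rightarrow> real" and \<psi> :: "real ^ 'd \<Rightarrow> real"
  assumes st: "0 \<le> s" "s < t" "t \<le> T"
    and Y: "Y \<in> borel_measurable (F s)" "integrable M Y"
    and \<psi>: "\<psi> \<in> borel_measurable borel" "integrable M (\<lambda>\<omega>. \<psi> (W t \<omega> - W s \<omega>))"
  shows "integrable M (\<lambda>\<omega>. Y \<omega> * \<psi> (W t \<omega> - W s \<omega>))"
    and "expectation (\<lambda>\<omega>. Y \<omega> * \<psi> (W t \<omega> - W s \<omega>)) =
      expectation Y * expectation (\<lambda>\<omega>. \<psi> (W t \<omega> - W s \<omega>))"
proof -
  let ?D = "\<lambda>\<omega>. W t \<omega> - W s \<omega>"
  let ?V = "vimage_algebra (space M) ?D borel"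
  have mV: "(\<lambda>\<omega>. \<psi> (?D \<omega>)) \<in> borel_measurable ?V"
    by (rule measurable_compose[OF measurable_vimage_algebra1 \<psi>(1)]) simp
  have iv: "indep_var borel Y borel (\<lambda>\<omega>. \<psi> (?D \<omega>))"
    unfolding indep_var_eq
  proof (intro conjI)
    show "random_variable borel Y" "random_variable borel (\<lambda>\<omega>. \<psi> (?D \<omega>))"
      using Y(2) \<psi>(2) by (auto dest: borel_measurable_integrable)
    \<comment> \<open>The sigma-algebras generated by \<open>Y\<close> and by the transformed
      increment lie inside the two that \<open>W_indep_past\<close> makes independent, and
      independence passes to smaller families.\<close>
    have a: "sigma_sets (space M) {Y -` A \<inter> space M |A. A \<in> sets borel} \<subseteq> sets (F s)"
      using measurable_sets[OF Y(1)] sets.sigma_sets_subset[of "{Y -` A \<inter> space M |A. A \<in> sets borel}"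
          "F s"] space_F[of s] st
      by auto
    have b: "sigma_sets (space M) {(\<lambda>\<omega>. \<psi> (?D \<omega>)) -` A \<inter> space M |A. A \<in> sets borel} \<subseteq> sets ?V"
      using measurable_sets[OF mV] sets.sigma_sets_subset[of
          "{(\<lambda>\<omega>. \<psi> (?D \<omega>)) -` A \<inter> space M |A. A \<in> sets borel}" ?V]
      by auto
    show "indep_set (sigma_sets (space M) {Y -` A \<inter> space M |A. A \<in> sets borel})
       (sigma_sets (space M) {(\<lambda>\<omega>. \<psi> (?D \<omega>)) -` A \<inter> space M |A. A \<in> sets borel})"
      using W_indep_past[OF st] unfolding indep_set_def
      by (rule indep_sets_mono_sets) (use a b in \<open>auto split: bool.split\<close>)
  qed
  show "integrable M (\<lambda>\<omega>. Y \<omega> * \<psi> (?D \<omega>))"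
    by (rule indep_var_integrable[OF iv Y(2) \<psi>(2)])
  show "expectation (\<lambda>\<omega>. Y \<omega> * \<psi> (?D \<omega>)) = expectation Y * expectation (\<lambda>\<omega>. \<psi> (?D \<omega>))"
    by (rule indep_var_lebesgue_integral[OF iv Y(2) \<psi>(2)])
qed

lemma increment_moments:
  assumes st: "0 \<le> s" "s < t" "t \<le> T" and u: "u \<in> Basis"
  shows "integrable M (\<lambda>\<omega>. (W t \<omega> - W s \<omega>) \<bullet> u)"
    and "expectation (\<lambda>\<omega>. (W t \<omega> - W s \<omega>) \<bullet> u) = 0"
    and "integrable M (\<lambda>\<omega>. ((W t \<omega> - W s \<omega>) \<bullet> u)\<^sup>2)"
    and "expectation (\<lambda>\<omega>. ((W t \<omega> - W s \<omega>) \<bullet> u)\<^sup>2) = t - s"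
proof -
  obtain i where i: "\<And>x :: real ^ 'd. x \<bullet> u = x $ i" using Basis_vec_cases[OF u] by blast
  have pos: "0 < sqrt (t - s)" using st by simp
  note D = W_normal[OF st, of i]
  show int1: "integrable M (\<lambda>\<omega>. (W t \<omega> - W s \<omega>) \<bullet> u)"
    unfolding i using integrable_normal_moment[OF pos, of 0 1]
    by (subst distributed_integrable[OF D, of "\<lambda>x. x", symmetric]) auto
  show e1: "expectation (\<lambda>\<omega>. (W t \<omega> - W s \<omega>) \<bullet> u) = 0"
    unfolding i by (rule normal_distributed_expectation[OF pos D])
  show "integrable M (\<lambda>\<omega>. ((W t \<omega> - W s \<omega>) \<bullet> u)\<^sup>2)"
    unfolding i using integrable_normal_moment[OF pos, of 0 2]
    by (subst distributed_integrable[OF D, of "\<lambda>x. x\<^sup>2", symmetric]) auto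
  show "expectation (\<lambda>\<omega>. ((W t \<omega> - W s \<omega>) \<bullet> u)\<^sup>2) = t - s"
    using normal_distributed_variance[OF pos D] e1 st unfolding i by simp
qed

lemma increment_covariance:
  assumes st: "0 \<le> s" "s < t" "t \<le> T" and u: "u \<in> Basis" "v \<in> Basis"
  shows "integrable M (\<lambda>\<omega>. ((W t \<omega> - W s \<omega>) \<bullet> u) * ((W t \<omega> - W s \<omega>) \<bullet> v))"
    and "expectation (\<lambda>\<omega>. ((W t \<omega> - W s \<omega>) \<bullet> u) * ((W t \<omega> - W s \<omega>) \<bullet> v)) = (if u = v then t - s else 0)"
proof -
  have "integrable M (\<lambda>\<omega>. ((W t \<omega> - W s \<omega>) \<bullet> u) * ((W t \<omega> - W s \<omega>) \<bullet> v)) \<and>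
    expectation (\<lambda>\<omega>. ((W t \<omega> - W s \<omega>) \<bullet> u) * ((W t \<omega> - W s \<omega>) \<bullet> v)) = (if u = v then t - s else 0)"
  proof (cases "u = v")
    case True
    then show ?thesis
      using increment_moments(3,4)[OF st u(1)] by (simp add: power2_eq_square)
  next
    case False
    obtain i where i: "\<And>x :: real ^ 'd. x \<bullet> u = x $ i" using Basis_vec_cases[OF u(1)] by blast
    obtain j where j: "\<And>x :: real ^ 'd. x \<bullet> v = x $ j" using Basis_vec_cases[OF u(2)] by blast
    \<comment> \<open>Independence over \<open>{i, j}\<close> yields a product of two factors only
      for distinct indices; equal indices would give \<open>u\<close> and \<open>v\<close> the same
      inner product with every vector.\<close>
    have "i \<noteq> j"
    proof
      assume "i = j"
      then have "x \<bullet> u = x \<bullet> v" for x :: "real ^ 'd" using i j by simp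
      then show False using False by (metis vector_eq_ldot)
    qed
    have "indep_vars (\<lambda>_. borel) (\<lambda>i \<omega>. (W t \<omega> - W s \<omega>) $ i) {i, j}"
      by (rule indep_vars_subset[OF W_indep_components[OF st]]) auto
    then have iv: "indep_vars (\<lambda>_. borel) (\<lambda>i \<omega>. (W t \<omega> - W s \<omega>) $ i) {i, j}" .
    have int: "integrable M (\<lambda>\<omega>. (W t \<omega> - W s \<omega>) $ k)" if "k \<in> {i, j}" for k
      using increment_moments(1)[OF st u(1)] increment_moments(1)[OF st u(2)] that unfolding i j by auto
    show ?thesis
      using indep_vars_integrable[OF _ iv int] indep_vars_lebesgue_integral[OF _ iv int]
        increment_moments(2)[OF st u(1)] False \<open>i \<noteq> j\<close>
      unfolding i j by simp
  qed
  then show "integrable M (\<lambda>\<omega>. ((W t \<omega> - W s \<omega>) \<bullet> u) * ((W t \<omega> - W s \<omega>) \<bullet> v))"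
    and "expectation (\<lambda>\<omega>. ((W t \<omega> - W s \<omega>) \<bullet> u) * ((W t \<omega> - W s \<omega>) \<bullet> v)) = (if u = v then t - s else 0)"
    by auto
qed


text \<open>The weight and the earlier increment are both known at time \<open>c\<close>, so the
  later increment is independent of their product and contributes its mean zero. Boundedness of the
  weight keeps that product integrable. Empty intervals are treated apart because independence and
  normality are assumed for \<open>s < t\<close> only.\<close>

lemma weighted_increments_disjoint:
  fixes h :: "'w \<Rightarrow> real"
  assumes t: "0 \<le> a" "a \<le> b" "b \<le> c" "c \<le> d" "d \<le> T" and u: "u \<in> Basis" "v \<in> Basis"
    and h: "h \<in> borel_measurable (F c)" "\<And>\<omega>. \<omega> \<in> space M \<Longrightarrow> \<bar>h \<omega>\<bar> \<le> C"
  shows "has_bochner_integral M (\<lambda>\<omega>. h \<omega> * ((W b \<omega> - W a \<omega>) \<bullet> u) * ((W d \<omega> - W c \<omega>) \<bullet> v)) 0"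
proof (cases "a < b \<and> c < d")
  case True
  let ?Y = "\<lambda>\<omega>. h \<omega> * ((W b \<omega> - W a \<omega>) \<bullet> u)"
  have hM: "h \<in> borel_measurable M" by (rule F_measurable_M[OF _ h(1)]) (use t in auto)
  have mom: "integrable M (\<lambda>\<omega>. (W b \<omega> - W a \<omega>) \<bullet> u)"
    by (rule increment_moments(1)) (use t u True in auto)
  have "integrable M ?Y"
  proof (rule Bochner_Integration.integrable_bound)
    show "integrable M (\<lambda>\<omega>. C * ((W b \<omega> - W a \<omega>) \<bullet> u))" using mom by simp
    show "?Y \<in> borel_measurable M" using hM borel_measurable_integrable[OF mom] by measurable
    show "AE \<omega> in M. norm (?Y \<omega>) \<le> norm (C * ((W b \<omega> - W a \<omega>) \<bullet> u))"
    proof (rule AE_I2)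
      fix \<omega> assume "\<omega> \<in> space M"
      from h(2)[OF this] show "norm (?Y \<omega>) \<le> norm (C * ((W b \<omega> - W a \<omega>) \<bullet> u))"
        by (auto simp: abs_mult intro!: mult_right_mono)
    qed
  qed
  moreover have "?Y \<in> borel_measurable (F c)"
    using increment_adapted[of a b c] t h(1) by simp
  moreover have "integrable M (\<lambda>\<omega>. (W d \<omega> - W c \<omega>) \<bullet> v)" "expectation (\<lambda>\<omega>. (W d \<omega> - W c \<omega>) \<bullet> v) = 0"
    by (rule increment_moments; use t u True in auto)+
  ultimately show ?thesis
    using increment_independent[of c d ?Y "\<lambda>x. x \<bullet> v"] t True
    by (simp add: has_bochner_integral_iff)
next
  case False
  then have "a = b \<or> c = d" using t by auto
  then show ?thesis by (auto simp: has_bochner_integral_zero)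
qed

text \<open>The weight is known at the left endpoint, hence independent of the increment, and
  factors out; what remains is the covariance of two coordinates.\<close>

lemma weighted_increments_same:
  fixes h :: "'w \<Rightarrow> real"
  assumes t: "0 \<le> a" "a \<le> b" "b \<le> T" and u: "u \<in> Basis" "v \<in> Basis"
    and h: "h \<in> borel_measurable (F a)" "\<And>\<omega>. \<omega> \<in> space M \<Longrightarrow> \<bar>h \<omega>\<bar> \<le> C"
  shows "has_bochner_integral M (\<lambda>\<omega>. h \<omega> * ((W b \<omega> - W a \<omega>) \<bullet> u) * ((W b \<omega> - W a \<omega>) \<bullet> v))
    (if u = v then (b - a) * expectation h else 0)"
proof (cases "a < b")
  case True
  have hM: "h \<in> borel_measurable M" by (rule F_measurable_M[OF _ h(1)]) (use t in auto)
  have int: "integrable M h"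
    using hM h(2) by (intro integrable_const_bound[of _ C]) auto
  note cov = increment_covariance[OF t(1) True t(3) u]
  show ?thesis
    using increment_independent[of a b h "\<lambda>x. (x \<bullet> u) * (x \<bullet> v)", OF t(1) True t(3) h(1) int _ cov(1)] cov(2)
    by (simp add: has_bochner_integral_iff mult.assoc mult.commute[of "b - a"])
next
  case False
  then show ?thesis using t by (auto simp: has_bochner_integral_zero)
qed

end

text \<open>The condition that \<open>elementary_integrand\<close> puts on each coefficient,
  isolated so that it can be carried to later sigma-algebras and to families with an arbitrary index
  set.\<close>

definition bounded_operator_rv ::
  "'w measure \<Rightarrow> ('w \<Rightarrow> ('u::euclidean_space \<Rightarrow>\<^sub>L 'h::real_normed_vector)) \<Rightarrow> bool" where
  "bounded_operator_rv G \<phi> \<longleftrightarrow>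
    (\<forall>x. (\<lambda>\<omega>. blinfun_apply (\<phi> \<omega>) x) \<in> borel_measurable G) \<and> (\<exists>C. \<forall>\<omega>\<in>space G. norm (\<phi> \<omega>) \<le> C)"

lemma bounded_operator_rv_mono:
  "subalgebra N G \<Longrightarrow> bounded_operator_rv G \<phi> \<Longrightarrow> bounded_operator_rv N \<phi>"
  unfolding bounded_operator_rv_def
  by (auto simp: subalgebra_def intro: measurable_from_subalg[of N G])

lemma bounded_operator_rv_uminus:
  fixes \<phi> :: "'w \<Rightarrow> ('u::euclidean_space \<Rightarrow>\<^sub>L 'h::{real_normed_vector, second_countable_topology})"
  shows
  "bounded_operator_rv G \<phi> \<Longrightarrow> bounded_operator_rv G (\<lambda>\<omega>. - \<phi> \<omega>)"
  unfolding bounded_operator_rv_def by (auto simp: blinfun.minus_left intro!: borel_measurable_uminus)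

lemma bounded_operator_rv_inner:
  fixes \<phi> \<psi> :: "'w \<Rightarrow> ('u::euclidean_space \<Rightarrow>\<^sub>L 'h::{real_inner, second_countable_topology})"
  assumes "bounded_operator_rv G \<phi>" "bounded_operator_rv G \<psi>"
  shows "(\<lambda>\<omega>. blinfun_apply (\<phi> \<omega>) u \<bullet> blinfun_apply (\<psi> \<omega>) v) \<in> borel_measurable G"
    and "\<exists>C. \<forall>\<omega>\<in>space G. \<bar>blinfun_apply (\<phi> \<omega>) u \<bullet> blinfun_apply (\<psi> \<omega>) v\<bar> \<le> C"
proof -
  show "(\<lambda>\<omega>. blinfun_apply (\<phi> \<omega>) u \<bullet> blinfun_apply (\<psi> \<omega>) v) \<in> borel_measurable G"
    using assms unfolding bounded_operator_rv_def by (intro borel_measurable_inner) blast+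
  obtain C D where CD: "\<And>\<omega>. \<omega> \<in> space G \<Longrightarrow> norm (\<phi> \<omega>) \<le> C" "\<And>\<omega>. \<omega> \<in> space G \<Longrightarrow> norm (\<psi> \<omega>) \<le> D"
    using assms unfolding bounded_operator_rv_def by blast
  have "\<bar>blinfun_apply (\<phi> \<omega>) u \<bullet> blinfun_apply (\<psi> \<omega>) v\<bar> \<le> (C * norm u) * (D * norm v)" if "\<omega> \<in> space G" for \<omega>
  proof -
    have "norm (blinfun_apply (\<phi> \<omega>) u) \<le> C * norm u" "norm (blinfun_apply (\<psi> \<omega>) v) \<le> D * norm v"
      using CD[OF that] norm_blinfun[of "\<phi> \<omega>" u] norm_blinfun[of "\<psi> \<omega>" v]
      by (meson mult_right_mono norm_ge_zero order_trans)+
    then show ?thesis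
      by (intro order_trans[OF Cauchy_Schwarz_ineq2] mult_mono) (auto intro: order_trans[OF norm_ge_zero])
  qed
  then show "\<exists>C. \<forall>\<omega>\<in>space G. \<bar>blinfun_apply (\<phi> \<omega>) u \<bullet> blinfun_apply (\<psi> \<omega>) v\<bar> \<le> C" by blast
qed

text \<open>Separates the random operators from the vectors they act on: the pairing becomes a sum
  of scalar weights times products of coordinates, the form in which the weighted increments are
  computed.\<close>

lemma blinfun_inner_Basis:
  fixes A B :: "'u::euclidean_space \<Rightarrow>\<^sub>L 'h::real_inner"
  shows "blinfun_apply A x \<bullet> blinfun_apply B y =
    (\<Sum>u\<in>Basis. \<Sum>v\<in>Basis. (blinfun_apply A u \<bullet> blinfun_apply B v) * (x \<bullet> u) * (y \<bullet> v))"
proof -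
  have e: "blinfun_apply A x = (\<Sum>u\<in>Basis. (x \<bullet> u) *\<^sub>R blinfun_apply A u)" for A :: "'u \<Rightarrow>\<^sub>L 'h" and x
  proof -
    have "blinfun_apply A x = blinfun_apply A (\<Sum>u\<in>Basis. (x \<bullet> u) *\<^sub>R u)"
      by (simp add: euclidean_representation)
    also have "\<dots> = (\<Sum>u\<in>Basis. (x \<bullet> u) *\<^sub>R blinfun_apply A u)"
      by (simp add: blinfun.sum_right blinfun.scaleR_right)
    finally show ?thesis .
  qed
  show ?thesis
    unfolding e[of A x] e[of B y]
    by (simp only: inner_sum_left inner_sum_right inner_scaleR_left inner_scaleR_right sum_distrib_left)
      (subst sum.swap, simp add: mult_ac)
qed

section \<open>Covariances of random operators applied to increments\<close>

context brownian_motion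
begin

text \<open>The expected Hilbert-Schmidt inner product of two random operators.\<close>

abbreviation operator_pairing ::
  "('w \<Rightarrow> ((real ^ 'd) \<Rightarrow>\<^sub>L 'h::{real_inner, second_countable_topology})) \<Rightarrow>
      ('w \<Rightarrow> ((real ^ 'd) \<Rightarrow>\<^sub>L 'h)) \<Rightarrow> real" where
  "operator_pairing \<phi> \<psi> \<equiv> expectation (\<lambda>\<omega>. \<Sum>u\<in>Basis. blinfun_apply (\<phi> \<omega>) u \<bullet> blinfun_apply (\<psi> \<omega>) u)"

lemma integrable_operator_pairing:
  fixes \<phi> \<psi> :: "'w \<Rightarrow> ((real ^ 'd) \<Rightarrow>\<^sub>L 'h::{real_inner, second_countable_topology})"
  assumes "t \<in> {0..T}" "bounded_operator_rv (F t) \<phi>" "bounded_operator_rv (F t) \<psi>"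
  shows "integrable M (\<lambda>\<omega>. blinfun_apply (\<phi> \<omega>) u \<bullet> blinfun_apply (\<psi> \<omega>) v)"
proof -
  obtain C where "\<forall>\<omega>\<in>space (F t). \<bar>blinfun_apply (\<phi> \<omega>) u \<bullet> blinfun_apply (\<psi> \<omega>) v\<bar> \<le> C"
    using bounded_operator_rv_inner(2)[OF assms(2,3)] by blast
  then show ?thesis
    using F_measurable_M[OF assms(1) bounded_operator_rv_inner(1)[OF assms(2,3)]] space_F[OF assms(1)]
    by (intro integrable_const_bound[of _ C]) auto
qed

lemma increment_pairing_disjoint:
  fixes \<phi> \<psi> :: "'w \<Rightarrow> ((real ^ 'd) \<Rightarrow>\<^sub>L 'h::{real_inner, second_countable_topology})"
  assumes t: "0 \<le> a" "a \<le> b" "b \<le> c" "c \<le> d" "d \<le> T"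
    and \<phi>: "bounded_operator_rv (F c) \<phi>" "bounded_operator_rv (F c) \<psi>"
  shows "has_bochner_integral M
    (\<lambda>\<omega>. blinfun_apply (\<phi> \<omega>) (W b \<omega> - W a \<omega>) \<bullet> blinfun_apply (\<psi> \<omega>) (W d \<omega> - W c \<omega>)) 0"
proof -
  have "has_bochner_integral M (\<lambda>\<omega>. \<Sum>u\<in>Basis. \<Sum>v\<in>Basis. (blinfun_apply (\<phi> \<omega>) u \<bullet> blinfun_apply (\<psi> \<omega>) v) *
      ((W b \<omega> - W a \<omega>) \<bullet> u) * ((W d \<omega> - W c \<omega>) \<bullet> v))
          (\<Sum>u\<in>(Basis :: (real ^ 'd) set). \<Sum>v\<in>(Basis :: (real ^ 'd) set). 0)"
  proof (intro has_bochner_integral_sum)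
    fix u v :: "real ^ 'd" assume u: "u \<in> Basis" "v \<in> Basis"
    obtain C where "\<forall>\<omega>\<in>space (F c). \<bar>blinfun_apply (\<phi> \<omega>) u \<bullet> blinfun_apply (\<psi> \<omega>) v\<bar> \<le> C"
      using bounded_operator_rv_inner(2)[OF \<phi>] by blast
    then show "has_bochner_integral M (\<lambda>\<omega>. (blinfun_apply (\<phi> \<omega>) u \<bullet> blinfun_apply (\<psi> \<omega>) v) *
      ((W b \<omega> - W a \<omega>) \<bullet> u) * ((W d \<omega> - W c \<omega>) \<bullet> v)) 0"
      using bounded_operator_rv_inner(1)[OF \<phi>] space_F[of c] t u
      by (intro weighted_increments_disjoint[where C = C]) auto
  qed
  then show ?thesis by (simp add: blinfun_inner_Basis[where x = "W b _ - W a _"])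
qed

lemma increment_pairing_same:
  fixes \<phi> \<psi> :: "'w \<Rightarrow> ((real ^ 'd) \<Rightarrow>\<^sub>L 'h::{real_inner, second_countable_topology})"
  assumes t: "0 \<le> a" "a \<le> b" "b \<le> T"
    and \<phi>: "bounded_operator_rv (F a) \<phi>" "bounded_operator_rv (F a) \<psi>"
  shows "has_bochner_integral M
    (\<lambda>\<omega>. blinfun_apply (\<phi> \<omega>) (W b \<omega> - W a \<omega>) \<bullet> blinfun_apply (\<psi> \<omega>) (W b \<omega> - W a \<omega>))
    ((b - a) * operator_pairing \<phi> \<psi>)"
proof -
  let ?q = "\<lambda>u v \<omega>. blinfun_apply (\<phi> \<omega>) u \<bullet> blinfun_apply (\<psi> \<omega>) v"
  have "has_bochner_integral M (\<lambda>\<omega>. \<Sum>u\<in>Basis. \<Sum>v\<in>Basis. ?q u v \<omega> *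
      ((W b \<omega> - W a \<omega>) \<bullet> u) * ((W b \<omega> - W a \<omega>) \<bullet> v))
      (\<Sum>u\<in>(Basis :: (real ^ 'd) set). \<Sum>v\<in>Basis. if u = v then (b - a) * expectation (?q u v) else 0)"
  proof (intro has_bochner_integral_sum)
    fix u v :: "real ^ 'd" assume u: "u \<in> Basis" "v \<in> Basis"
    obtain C where "\<forall>\<omega>\<in>space (F a). \<bar>?q u v \<omega>\<bar> \<le> C"
      using bounded_operator_rv_inner(2)[OF \<phi>] by blast
    then show "has_bochner_integral M (\<lambda>\<omega>. ?q u v \<omega> * ((W b \<omega> - W a \<omega>) \<bullet> u) * ((W b \<omega> - W a \<omega>) \<bullet> v))
        (if u = v then (b - a) * expectation (?q u v) else 0)"
      using bounded_operator_rv_inner(1)[OF \<phi>] space_F[of a] t u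
      by (intro weighted_increments_same[where C = C]) auto
  qed
  moreover have "(\<Sum>u\<in>(Basis :: (real ^ 'd) set). \<Sum>v\<in>Basis. if u = v then (b - a) * expectation
      (?q u v) else 0)
      = (b - a) * operator_pairing \<phi> \<psi>"
    using integrable_operator_pairing[OF _ \<phi>] t
    by (simp add: sum.delta' sum_distrib_left)
  ultimately show ?thesis by (simp add: blinfun_inner_Basis[where x = "W b _ - W a _"])
qed

text \<open>The two intervals come from unrelated partitions and may overlap in any way. Cutting at
  \<open>c\<close> and at the end of the overlap leaves five pairs of pieces. The pair of equal
  pieces contributes the length of the overlap; the separated pairs have mean zero, since both
  operators are known when the later piece begins.\<close>

lemma increment_pairing_ordered:
  fixes \<phi> \<psi> :: "'w \<Rightarrow> ((real ^ 'd) \<Rightarrow>\<^sub>L 'h::{real_inner, second_countable_topology})"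
  assumes t: "0 \<le> a" "a \<le> b" "b \<le> T" "a \<le> c" "c \<le> d" "d \<le> T"
    and \<phi>: "bounded_operator_rv (F a) \<phi>" "bounded_operator_rv (F c) \<psi>"
  shows "has_bochner_integral M
    (\<lambda>\<omega>. blinfun_apply (\<phi> \<omega>) (W b \<omega> - W a \<omega>) \<bullet> blinfun_apply (\<psi> \<omega>) (W d \<omega> - W c \<omega>))
    (measure lborel ({a<..b} \<inter> {c<..d}) * operator_pairing \<phi> \<psi>)"
proof -
  have int: "{a<..b} \<inter> {c<..d} = {c<..min b d}" using t by auto
  have rv: "bounded_operator_rv (F r) \<phi>" if "a \<le> r" "r \<le> T" for r
    by (rule bounded_operator_rv_mono[OF F_mono \<phi>(1)]) (use that t in auto)
  have rv': "bounded_operator_rv (F r) \<psi>" if "c \<le> r" "r \<le> T" for r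
    by (rule bounded_operator_rv_mono[OF F_mono \<phi>(2)]) (use that t in auto)
  show ?thesis
  proof (cases "b \<le> c")
    case True
    then have "{c<..min b d} = {}" by auto
    then show ?thesis
      using increment_pairing_disjoint[of a b c d \<phi> \<psi>] True rv[of c] \<phi>(2) t by (simp add: int)
  next
    case False
    define m where "m = min b d"
    have m: "c \<le> m" "m \<le> b" "m \<le> d" "m = b \<or> m = d" using False t by (auto simp: m_def)
    let ?P = "\<lambda>p q r s \<omega>. blinfun_apply (\<phi> \<omega>) (W q \<omega> - W p \<omega>) \<bullet> blinfun_apply (\<psi> \<omega>) (W s \<omega> - W r \<omega>)"
    have 1: "has_bochner_integral M (?P a c c d) 0"
      using increment_pairing_disjoint[of a c c d \<phi> \<psi>] rv[of c] \<phi>(2) t by simp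
    have 2: "has_bochner_integral M (?P c m c m) ((m - c) * operator_pairing \<phi> \<psi>)"
      using increment_pairing_same[of c m \<phi> \<psi>] rv[of c] \<phi>(2) t m by simp
    have 3: "has_bochner_integral M (?P c m m d) 0"
      using increment_pairing_disjoint[of c m m d \<phi> \<psi>] rv[of m] rv'[of m] t m by simp
    have 4: "has_bochner_integral M (?P m b c m) 0"
      using increment_pairing_disjoint[of c m m b \<psi> \<phi>] rv[of m] rv'[of m] t m by (simp add: inner_commute)
    \<comment> \<open>One of the two increments is zero, because \<open>m\<close> equals
      \<open>b\<close> or \<open>d\<close>.\<close>
    have 5: "has_bochner_integral M (?P m b m d) 0"
      using m(4) by (auto simp: has_bochner_integral_zero)
    have eq: "?P a b c d \<omega> = ?P a c c d \<omega> + (?P c m c m \<omega> +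
        (?P c m m d \<omega> + (?P m b c m \<omega> + ?P m b m d \<omega>)))" for \<omega>
      by (simp add: blinfun.diff_right algebra_simps inner_diff_left inner_diff_right)
    have "measure lborel {c<..min b d} = m - c" using m by (simp add: m_def)
    then show ?thesis
      unfolding int eq
      using has_bochner_integral_add[OF 1 has_bochner_integral_add[OF 2 has_bochner_integral_add[OF 3
          has_bochner_integral_add[OF 4 5]]]]
      by simp
  qed
qed

lemma increment_pairing:
  fixes \<phi> \<psi> :: "'w \<Rightarrow> ((real ^ 'd) \<Rightarrow>\<^sub>L 'h::{real_inner, second_countable_topology})"
  assumes t: "0 \<le> a" "a \<le> b" "b \<le> T" "0 \<le> c" "c \<le> d" "d \<le> T"
    and \<phi>: "bounded_operator_rv (F a) \<phi>" "bounded_operator_rv (F c) \<psi>"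
  shows "has_bochner_integral M
    (\<lambda>\<omega>. blinfun_apply (\<phi> \<omega>) (W b \<omega> - W a \<omega>) \<bullet> blinfun_apply (\<psi> \<omega>) (W d \<omega> - W c \<omega>))
    (measure lborel ({a<..b} \<inter> {c<..d}) * operator_pairing \<phi> \<psi>)"
proof (cases "a \<le> c")
  case True
  then show ?thesis using increment_pairing_ordered assms by blast
next
  case False
  then show ?thesis
    using increment_pairing_ordered[of c d a b \<psi> \<phi>] assms by (simp add: inner_commute Int_commute)
qed

end

section \<open>Hilbert-Schmidt norms, partitions, completed sigma-algebras and subsequences\<close>

lemma hilbert_schmidt_norm_sq:
  "(hilbert_schmidt_norm A)\<^sup>2 = (\<Sum>e\<in>Basis. (norm (blinfun_apply A e))\<^sup>2)"
  unfolding hilbert_schmidt_norm_def by (simp add: sum_nonneg)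

lemma norm_diff_sq_triangle:
  fixes x y z :: "'a::real_normed_vector"
  shows "(norm (x - z))\<^sup>2 \<le> 2 * (norm (x - y))\<^sup>2 + 2 * (norm (y - z))\<^sup>2"
proof -
  have "norm (x - z) \<le> norm (x - y) + norm (y - z)"
    using norm_triangle_ineq[of "x - y" "y - z"] by simp
  then have "(norm (x - z))\<^sup>2 \<le> (norm (x - y) + norm (y - z))\<^sup>2" by (rule power_mono) simp
  also have "\<dots> \<le> 2 * (norm (x - y))\<^sup>2 + 2 * (norm (y - z))\<^sup>2"
    using sum_squares_bound[of "norm (x - y)" "norm (y - z)"] by (simp add: power2_sum)
  finally show ?thesis .
qed

text \<open>The estimate is made basis vector by basis vector, so the triangle inequality in the
  target space suffices.\<close>

lemma hilbert_schmidt_norm_diff_sq_triangle: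
  "(hilbert_schmidt_norm (A - C))\<^sup>2 \<le> 2 * (hilbert_schmidt_norm (A - B))\<^sup>2 + 2 *
      (hilbert_schmidt_norm (B - C))\<^sup>2"
  unfolding hilbert_schmidt_norm_sq sum_distrib_left sum.distrib[symmetric] blinfun.diff_left
  by (intro sum_mono norm_diff_sq_triangle)

lemma borel_measurable_hilbert_schmidt_norm_sq:
  fixes \<Phi> :: "'b \<Rightarrow> ('u::euclidean_space \<Rightarrow>\<^sub>L 'h::{real_normed_vector, second_countable_topology})"
  assumes "\<And>x. (\<lambda>p. blinfun_apply (\<Phi> p) x) \<in> borel_measurable N"
  shows "(\<lambda>p. (hilbert_schmidt_norm (\<Phi> p))\<^sup>2) \<in> borel_measurable N"
  unfolding hilbert_schmidt_norm_sq using assms by measurable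

lemma nn_integral_le_two_sum:
  assumes "f \<in> borel_measurable N" "g \<in> borel_measurable N"
    and "\<And>x. x \<in> space N \<Longrightarrow> h x \<le> 2 * f x + 2 * g x"
    and "\<And>x. 0 \<le> f x" "\<And>x. 0 \<le> g x"
  shows "(\<integral>\<^sup>+x. ennreal (h x) \<partial>N) \<le> 2 * (\<integral>\<^sup>+x. ennreal (f x) \<partial>N) + 2 * (\<integral>\<^sup>+x. ennreal (g x) \<partial>N)"
proof -
  have "(\<integral>\<^sup>+x. ennreal (h x) \<partial>N) \<le> (\<integral>\<^sup>+x. 2 * ennreal (f x) + 2 * ennreal (g x) \<partial>N)"
  proof (rule nn_integral_mono)
    fix x assume "x \<in> space N"
    then have "ennreal (h x) \<le> ennreal (2 * f x + 2 * g x)" by (intro ennreal_leI assms(3))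
    also have "\<dots> = 2 * ennreal (f x) + 2 * ennreal (g x)"
      using assms(4,5)[of x] by (simp add: ennreal_mult')
    finally show "ennreal (h x) \<le> 2 * ennreal (f x) + 2 * ennreal (g x)" .
  qed
  also have "\<dots> = 2 * (\<integral>\<^sup>+x. ennreal (f x) \<partial>N) + 2 * (\<integral>\<^sup>+x. ennreal (g x) \<partial>N)"
    using assms(1,2) by (simp add: nn_integral_add nn_integral_cmult)
  finally show ?thesis .
qed

lemma ennreal_two_sum_tendsto_0:
  fixes f g :: "nat \<Rightarrow> ennreal"
  assumes "f \<longlonglongrightarrow> 0" "g \<longlonglongrightarrow> 0"
  shows "(\<lambda>m. 2 * f m + 2 * g m) \<longlonglongrightarrow> 0"
  using tendsto_add[OF ennreal_tendsto_cmult[OF _ assms(1), of 2] ennreal_tendsto_cmult[OF _ assms(2), of 2]]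
  by simp

lemma elementary_integrand_partition:
  assumes "elementary_integrand F t n \<tau> \<phi>" "i < n"
  shows "0 \<le> \<tau> i" "\<tau> i \<le> \<tau> (Suc i)" "\<tau> (Suc i) \<le> t" "bounded_operator_rv (F (\<tau> i)) (\<phi> i)"
proof -
  have e: "0 \<le> \<tau> 0" "\<And>i. i < n \<Longrightarrow> \<tau> i \<le> \<tau> (Suc i)" "\<tau> n \<le> t"
    using assms(1) by (auto simp: elementary_integrand_def)
  have "j \<le> n \<Longrightarrow> 0 \<le> \<tau> j" for j
    by (induction j) (use e in \<open>auto intro: order_trans\<close>)
  then show "0 \<le> \<tau> i" using assms(2) by simp
  show "\<tau> i \<le> \<tau> (Suc i)" using e assms(2) by simp
  \<comment> \<open>Monotonicity is given only between neighbours and the upper bound only at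
    \<open>n\<close>, so the induction runs downwards from \<open>n\<close>.\<close>
  have "j \<le> n \<Longrightarrow> \<tau> (n - j) \<le> \<tau> n" for j
  proof (induction j)
    case (Suc j)
    then have "\<tau> (n - Suc j) \<le> \<tau> (Suc (n - Suc j))" by (intro e) auto
    also have "Suc (n - Suc j) = n - j" using Suc by simp
    finally show ?case using Suc by simp
  qed simp
  from this[of "n - Suc i"] show "\<tau> (Suc i) \<le> t" using assms(2) e(3) by simp
  show "bounded_operator_rv (F (\<tau> i)) (\<phi> i)"
    using assms by (simp add: elementary_integrand_def bounded_operator_rv_def)
qed

text \<open>The preimages of a set under \<open>f\<close> and \<open>g\<close> differ by null sets,
  which already belong to the smaller sigma-algebra. This is how completeness of the filtration
  makes almost sure limits adapted.\<close>

lemma borel_measurable_AE_eq_subalgebra: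
  fixes f g :: "'b \<Rightarrow> 'c::topological_space"
  assumes G: "subalgebra N G" "null_sets N \<subseteq> sets G"
    and f: "f \<in> borel_measurable N" and g: "g \<in> borel_measurable G" and eq: "AE x in N. f x = g x"
  shows "f \<in> borel_measurable G"
proof (rule measurableI)
  fix A :: "'c set" assume A: "A \<in> sets borel"
  have sp: "space G = space N" and sub: "sets G \<subseteq> sets N" using G by (auto simp: subalgebra_def)
  have gN: "g \<in> borel_measurable N" by (rule measurable_from_subalg[OF G(1) g])
  let ?f = "f -` A \<inter> space N" and ?g = "g -` A \<inter> space N"
  have m: "?f \<in> sets N" "?g \<in> sets N" using A f gN by auto
  have "?f - ?g \<in> null_sets N" "?g - ?f \<in> null_sets N"
    using eq m by (auto simp: AE_iff_null_sets elim!: AE_mp)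
  then have "?f - ?g \<in> sets G" "?g - ?f \<in> sets G" using G(2) by auto
  moreover have "?g \<in> sets G" using measurable_sets[OF g A] sp by simp
  ultimately have "(?g \<union> (?f - ?g)) - (?g - ?f) \<in> sets G" by (blast intro: sets.Diff sets.Un)
  moreover have "(?g \<union> (?f - ?g)) - (?g - ?f) = ?f" by blast
  ultimately show "f -` A \<inter> space G \<in> sets G" by (simp add: sp)
qed auto

lemma L2_convergence_AE_subseq:
  fixes f :: "'b \<Rightarrow> 'c::{real_normed_vector, second_countable_topology}"
  assumes f: "f \<in> borel_measurable N" "\<And>m. g m \<in> borel_measurable N"
    and lim: "(\<lambda>m. \<integral>\<^sup>+x. ennreal ((norm (f x - g m x))\<^sup>2) \<partial>N) \<longlonglongrightarrow> 0"
  shows "\<exists>r :: nat \<Rightarrow> nat. AE x in N. (\<lambda>m. g (r m) x) \<longlonglongrightarrow> f x"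
proof -
  let ?e = "\<lambda>m. \<integral>\<^sup>+x. ennreal ((norm (f x - g m x))\<^sup>2) \<partial>N"
  \<comment> \<open>Early errors may be infinite. From \<open>m0\<close> on they are below 1, so the
    squared differences are integrable and the subsequence theorem for convergence in L1 applies to
    them.\<close>
  have "eventually (\<lambda>m. ?e m < 1) sequentially" by (rule order_tendstoD(2)[OF lim]) simp
  then obtain m0 where m0: "\<And>m. m \<ge> m0 \<Longrightarrow> ?e m < 1" by (auto simp: eventually_sequentially)
  define u where "u m x = (norm (f x - g (m + m0) x))\<^sup>2" for m x
  have um: "u m \<in> borel_measurable N" for m unfolding u_def using f by measurable
  have ue: "(\<integral>\<^sup>+x. ennreal (u m x) \<partial>N) = ?e (m + m0)" for m by (simp add: u_def)
  have int: "integrable N (u m)" for m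
  proof (rule integrableI_nonneg[OF um])
    show "(\<integral>\<^sup>+x. ennreal (u m x) \<partial>N) < \<infinity>"
      unfolding ue by (rule less_trans[OF m0]) auto
  qed (simp add: u_def)
  have "(\<integral>x. norm (u m x) \<partial>N) = enn2real (?e (m + m0))" for m
    using um[of m] unfolding u_def by (simp add: integral_eq_nn_integral)
  moreover have "(\<lambda>m. enn2real (?e (m + m0))) \<longlonglongrightarrow> 0"
    using LIMSEQ_ignore_initial_segment[OF lim, of m0]
    by (intro tendsto_enn2real) (auto simp: ennreal_0)
  ultimately have "(\<lambda>m. \<integral>x. norm (u m x) \<partial>N) \<longlonglongrightarrow> 0" by simp
  from tendsto_L1_AE_subseq[OF int this] obtain r :: "nat \<Rightarrow> nat" where
    "AE x in N. (\<lambda>m. u (r m) x) \<longlonglongrightarrow> 0" by blast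
  then have "AE x in N. (\<lambda>m. g (r m + m0) x) \<longlonglongrightarrow> f x"
  proof eventually_elim
    fix x assume "(\<lambda>m. u (r m) x) \<longlonglongrightarrow> 0"
    then have "(\<lambda>m. sqrt (u (r m) x)) \<longlonglongrightarrow> sqrt 0" by (rule tendsto_real_sqrt)
    then have "(\<lambda>m. norm (g (r m + m0) x - f x)) \<longlonglongrightarrow> 0"
      by (simp add: u_def norm_minus_commute)
    then show "(\<lambda>m. g (r m + m0) x) \<longlonglongrightarrow> f x"
      by (simp add: tendsto_norm_zero_iff LIM_zero_iff)
  qed
  then show ?thesis by (intro exI[of _ "\<lambda>m. r m + m0"])
qed

section \<open>Isometry, error estimate, uniqueness and adaptedness of the stochastic
  integral\<close>

context brownian_motion
begin

lemma bounded_operator_rv_measurable: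
  "t \<in> {0..T} \<Longrightarrow> bounded_operator_rv (F t) \<phi> \<Longrightarrow> (\<lambda>\<omega>. blinfun_apply (\<phi> \<omega>) x) \<in> borel_measurable M"
  by (rule F_measurable_M) (auto simp: bounded_operator_rv_def)

text \<open>Both sides expand into the same double sum \<open>?V\<close> of overlap lengths times
  operator pairings. Allowing any finite family of intervals, instead of one partition, covers the
  difference of two elementary integrals without a common refinement.\<close>

lemma ito_isometry_family:
  fixes \<phi> :: "'k \<Rightarrow> 'w \<Rightarrow> ((real ^ 'd) \<Rightarrow>\<^sub>L 'h::{real_inner, second_countable_topology})"
  assumes K: "finite K" and t: "t \<le> T"
    and ab: "\<And>k. k \<in> K \<Longrightarrow> 0 \<le> a k" "\<And>k. k \<in> K \<Longrightarrow> a k \<le> b k" "\<And>k. k \<in> K \<Longrightarrow> b k \<le> t"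
    and \<phi>: "\<And>k. k \<in> K \<Longrightarrow> bounded_operator_rv (F (a k)) (\<phi> k)"
  shows "(\<integral>\<^sup>+\<omega>. ennreal ((norm (\<Sum>k\<in>K. blinfun_apply (\<phi> k \<omega>) (W (b k) \<omega> - W (a k) \<omega>)))\<^sup>2) \<partial>M) =
    (\<integral>\<^sup>+(s, \<omega>). ennreal ((hilbert_schmidt_norm (\<Sum>k\<in>K. indicator {a k<..b k} s *\<^sub>R \<phi> k \<omega>))\<^sup>2)
      \<partial>(restrict_space lborel {0..t} \<Otimes>\<^sub>M M))"
proof -
  let ?R = "restrict_space lborel {0..t}"
  let ?D = "\<lambda>k \<omega>. W (b k) \<omega> - W (a k) \<omega>"
  let ?l = "\<lambda>k l. measure lborel ({a k<..b k} \<inter> {a l<..b l})"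
  let ?V = "\<Sum>k\<in>K. \<Sum>l\<in>K. ?l k l * operator_pairing (\<phi> k) (\<phi> l)"
  have ak: "a k \<in> {0..T}" if "k \<in> K" for k using ab[OF that] t by auto
  have "has_bochner_integral M (\<lambda>\<omega>. \<Sum>k\<in>K. \<Sum>l\<in>K. blinfun_apply (\<phi> k \<omega>) (?D k \<omega>) \<bullet> blinfun_apply (\<phi> l \<omega>)
      (?D l \<omega>)) ?V"
    using ab \<phi> t by (intro has_bochner_integral_sum increment_pairing) (auto intro: order_trans)
  moreover have "(norm (\<Sum>k\<in>K. blinfun_apply (\<phi> k \<omega>) (?D k \<omega>)))\<^sup>2 =
      (\<Sum>k\<in>K. \<Sum>l\<in>K. blinfun_apply (\<phi> k \<omega>) (?D k \<omega>) \<bullet> blinfun_apply (\<phi> l \<omega>) (?D l \<omega>))" for \<omega>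
    by (simp only: power2_norm_eq_inner inner_sum_left inner_sum_right) (rule sum.swap)
  ultimately have "has_bochner_integral M (\<lambda>\<omega>. (norm (\<Sum>k\<in>K. blinfun_apply (\<phi> k \<omega>) (?D k \<omega>)))\<^sup>2) ?V"
    by simp
  then have L: "(\<integral>\<^sup>+\<omega>. ennreal ((norm (\<Sum>k\<in>K. blinfun_apply (\<phi> k \<omega>) (?D k \<omega>)))\<^sup>2) \<partial>M) = ennreal ?V"
    by (subst nn_integral_eq_integral) (auto simp: has_bochner_integral_iff)
  let ?i = "\<lambda>k s. indicator {a k<..b k} s :: real"
  let ?h = "\<lambda>s \<omega>. (hilbert_schmidt_norm (\<Sum>k\<in>K. ?i k s *\<^sub>R \<phi> k \<omega>))\<^sup>2"
  let ?G = "\<lambda>s. \<Sum>k\<in>K. \<Sum>l\<in>K. (?i k s * ?i l s) * operator_pairing (\<phi> k) (\<phi> l)"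
  have h: "?h s \<omega> = (\<Sum>k\<in>K. \<Sum>l\<in>K. (?i k s * ?i l s) *
      (\<Sum>e\<in>Basis. blinfun_apply (\<phi> k \<omega>) e \<bullet> blinfun_apply (\<phi> l \<omega>) e))" for s \<omega>
  proof -
    have "?h s \<omega> = (\<Sum>e\<in>Basis. \<Sum>k\<in>K. \<Sum>l\<in>K. (?i k s * ?i l s) *
        (blinfun_apply (\<phi> k \<omega>) e \<bullet> blinfun_apply (\<phi> l \<omega>) e))"
      by (simp only: hilbert_schmidt_norm_sq blinfun.sum_left blinfun.scaleR_left power2_norm_eq_inner
          inner_sum_left inner_sum_right inner_scaleR_left inner_scaleR_right mult.assoc sum_distrib_left)
        (rule sum.cong[OF refl], subst sum.swap, simp add: mult_ac)
    also have "\<dots> = (\<Sum>k\<in>K. \<Sum>l\<in>K. \<Sum>e\<in>Basis. (?i k s * ?i l s) *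
        (blinfun_apply (\<phi> k \<omega>) e \<bullet> blinfun_apply (\<phi> l \<omega>) e))"
      by (subst sum.swap) (intro sum.cong refl, rule sum.swap)
    finally show ?thesis by (simp only: sum_distrib_left)
  qed
  have inner: "has_bochner_integral M (?h s) (?G s)" for s
  proof -
    \<comment> \<open>Coefficients with different indices are known at different times; at the later
      of the two start times both are.\<close>
    have pi: "integrable M (\<lambda>\<omega>. blinfun_apply (\<phi> k \<omega>) e \<bullet> blinfun_apply (\<phi> l \<omega>) e)" if kl: "k \<in> K" "l
        \<in> K" for k l e
    proof (rule integrable_operator_pairing[of "max (a k) (a l)"])
      show "max (a k) (a l) \<in> {0..T}" using ak kl by (auto simp: max_def)
      have *: "bounded_operator_rv (F (max (a k) (a l))) (\<phi> j)" if "j \<in> {k, l}" for j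
        by (rule bounded_operator_rv_mono[OF F_mono \<phi>]) (use that kl ak in auto)
      show "bounded_operator_rv (F (max (a k) (a l))) (\<phi> k)" "bounded_operator_rv (F (max (a k) (a l))) (\<phi> l)"
        by (auto intro: *)
    qed
    show ?thesis
      unfolding h
      by (intro has_bochner_integral_sum has_bochner_integral_mult_right has_bochner_integral_integrable
          Bochner_Integration.integrable_sum pi)
  qed
  \<comment> \<open>The terms of the double sum have no sign, but the sum is the expectation of a
    square. Nonnegativity is what allows passing between the Lebesgue integral and the nonnegative
    integral.\<close>
  have G_nonneg: "0 \<le> ?G s" for s
    using integral_nonneg_AE[of "?h s" M] has_bochner_integral_integral_eq[OF inner[of s]] by simp
  have "has_bochner_integral ?R ?G ?V"
  proof (intro has_bochner_integral_sum has_bochner_integral_mult_left)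
    fix k l assume k: "k \<in> K" "l \<in> K"
    let ?A = "{a k<..b k} \<inter> {a l<..b l}"
    have sub: "?A \<subseteq> {0..t}" using ab[OF k(1)] by auto
    have "has_bochner_integral ?R (indicator ?A :: real \<Rightarrow> real) (measure ?R ?A)"
    proof (rule has_bochner_integral_real_indicator)
      show "?A \<in> sets ?R" using sub by (auto simp: sets_restrict_space_iff)
      have "emeasure ?R ?A = emeasure lborel ?A" using sub by (intro emeasure_restrict_space) auto
      also have "\<dots> \<le> emeasure lborel {0..t}" using sub by (intro emeasure_mono) auto
      also have "\<dots> < \<infinity>" by (simp add: emeasure_lborel_Icc_eq)
      finally show "emeasure ?R ?A < \<infinity>" .
    qed
    moreover have "measure ?R ?A = measure lborel ?A"
      using sub by (intro measure_restrict_space) auto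
    moreover have "(\<lambda>s. ?i k s * ?i l s) = indicator ?A" by (rule ext) (rule indicator_inter_arith[symmetric])
    ultimately show "has_bochner_integral ?R (\<lambda>s. ?i k s * ?i l s) (?l k l)" by (simp only:)
  qed
  then have RG: "(\<integral>\<^sup>+s. ennreal (?G s) \<partial>?R) = ennreal ?V"
    using G_nonneg by (subst nn_integral_eq_integral) (auto simp: has_bochner_integral_iff)
  have "(\<integral>\<^sup>+(s, \<omega>). ennreal (?h s \<omega>) \<partial>(?R \<Otimes>\<^sub>M M)) = (\<integral>\<^sup>+s. \<integral>\<^sup>+\<omega>. ennreal (?h s \<omega>) \<partial>M \<partial>?R)"
  proof (subst nn_integral_fst[symmetric])
    have "(\<lambda>p. (hilbert_schmidt_norm (\<Sum>k\<in>K. ?i k (fst p) *\<^sub>R \<phi> k (snd p)))\<^sup>2) \<in> borel_measurable (?R \<Otimes>\<^sub>M M)"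
    proof (rule borel_measurable_hilbert_schmidt_norm_sq)
      fix x
      have [measurable]: "k \<in> K \<Longrightarrow> (\<lambda>\<omega>. blinfun_apply (\<phi> k \<omega>) x) \<in> borel_measurable M" for k
        by (rule bounded_operator_rv_measurable[OF ak \<phi>])
      have [measurable]: "?i k \<in> borel_measurable ?R" for k
        by (rule measurable_restrict_space1) simp
      show "(\<lambda>p. blinfun_apply (\<Sum>k\<in>K. ?i k (fst p) *\<^sub>R \<phi> k (snd p)) x) \<in> borel_measurable (?R \<Otimes>\<^sub>M M)"
        unfolding blinfun.sum_left blinfun.scaleR_left by measurable
    qed
    then show "(\<lambda>(s, \<omega>). ennreal (?h s \<omega>)) \<in> borel_measurable (?R \<Otimes>\<^sub>M M)"
      by (simp add: case_prod_beta)
  qed simp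
  also have "\<dots> = (\<integral>\<^sup>+s. ennreal (?G s) \<partial>?R)"
    using inner by (intro nn_integral_cong, subst nn_integral_eq_integral)
        (auto simp: has_bochner_integral_iff)
  finally show ?thesis using L RG by simp
qed

text \<open>The difference is a single family over the disjoint sum of the two index sets, with the
  sign moved into the operators.\<close>

lemma ito_isometry_elementary_diff:
  fixes \<phi> \<psi> :: "nat \<Rightarrow> 'w \<Rightarrow> ((real ^ 'd) \<Rightarrow>\<^sub>L 'h::{real_inner, banach, second_countable_topology})"
  assumes t: "t \<le> T" and \<phi>: "elementary_integrand F t n \<tau> \<phi>" and \<psi>: "elementary_integrand F t m \<rho> \<psi>"
  shows "(\<integral>\<^sup>+\<omega>. ennreal ((norm (elementary_integral W n \<tau> \<phi> \<omega> - elementary_integral W m \<rho> \<psi> \<omega>))\<^sup>2) \<partial>M) =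
    (\<integral>\<^sup>+(s, \<omega>). ennreal ((hilbert_schmidt_norm
        (elementary_process n \<tau> \<phi> s \<omega> - elementary_process m \<rho> \<psi> s \<omega>))\<^sup>2)
      \<partial>(restrict_space lborel {0..t} \<Otimes>\<^sub>M M))"
proof -
  let ?K = "{..<n} <+> {..<m}"
  let ?\<phi> = "case_sum \<phi> (\<lambda>i \<omega>. - \<psi> i \<omega>)"
  let ?a = "case_sum \<tau> \<rho>" and ?b = "case_sum (\<lambda>i. \<tau> (Suc i)) (\<lambda>i. \<rho> (Suc i))"
  note p = elementary_integrand_partition[OF \<phi>] elementary_integrand_partition[OF \<psi>]
  have neg: "bounded_operator_rv (F (\<rho> i)) (\<lambda>\<omega>. - \<psi> i \<omega>)" if "i < m" for i
    by (rule bounded_operator_rv_uminus[OF p(8)[OF that]])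
  have "elementary_integral W n \<tau> \<phi> \<omega> - elementary_integral W m \<rho> \<psi> \<omega> =
      (\<Sum>k\<in>?K. blinfun_apply (?\<phi> k \<omega>) (W (?b k) \<omega> - W (?a k) \<omega>))" for \<omega>
    by (simp add: elementary_integral_def sum.Plus comp_def blinfun.minus_left sum_negf)
  moreover have "elementary_process n \<tau> \<phi> s \<omega> - elementary_process m \<rho> \<psi> s \<omega> =
      (\<Sum>k\<in>?K. indicator {?a k<..?b k} s *\<^sub>R ?\<phi> k \<omega>)" for s \<omega>
    by (simp only: elementary_process_def sum.Plus[OF finite_lessThan finite_lessThan] comp_def sum.case
        scaleR_minus_right sum_negf diff_conv_add_uminus)
  ultimately show ?thesis
    by (simp only:) (rule ito_isometry_family[OF _ t]; use p neg in auto)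
qed

lemma elementary_integral_adapted:
  fixes \<phi> :: "nat \<Rightarrow> 'w \<Rightarrow> ((real ^ 'd) \<Rightarrow>\<^sub>L 'h::{real_inner, banach, second_countable_topology})"
  assumes t: "t \<in> {0..T}" and \<phi>: "elementary_integrand F t n \<tau> \<phi>"
  shows "elementary_integral W n \<tau> \<phi> \<in> borel_measurable (F t)"
proof -
  have "(\<lambda>\<omega>. blinfun_apply (\<phi> i \<omega>) (W (\<tau> (Suc i)) \<omega> - W (\<tau> i) \<omega>)) \<in> borel_measurable (F t)"
    if i: "i < n" for i
  proof -
    note p = elementary_integrand_partition[OF \<phi> i]
    have "bounded_operator_rv (F t) (\<phi> i)"
      by (rule bounded_operator_rv_mono[OF F_mono p(4)]) (use p t in auto)
    moreover have "(\<lambda>\<omega>. W (\<tau> (Suc i)) \<omega> - W (\<tau> i) \<omega>) \<in> borel_measurable (F t)"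
      by (rule increment_adapted) (use p t in auto)
    \<comment> \<open>A coefficient is known to be measurable only when applied to a fixed vector,
      whereas here the argument is random as well; expanding the increment over \<open>Basis\<close>
      reduces to fixed vectors.\<close>
    ultimately have "(\<lambda>\<omega>. \<Sum>e\<in>Basis. ((W (\<tau> (Suc i)) \<omega> - W (\<tau> i) \<omega>) \<bullet> e) *\<^sub>R blinfun_apply (\<phi> i \<omega>) e)
        \<in> borel_measurable (F t)"
      by (intro borel_measurable_sum borel_measurable_scaleR borel_measurable_inner)
        (auto simp: bounded_operator_rv_def)
    moreover have "(\<Sum>e\<in>Basis. (x \<bullet> e) *\<^sub>R blinfun_apply A e) = blinfun_apply A x"
      for x and A :: "(real ^ 'd) \<Rightarrow>\<^sub>L 'h"
      by (simp flip: blinfun.scaleR_right blinfun.sum_right add: euclidean_representation)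
    ultimately show ?thesis by simp
  qed
  then show ?thesis unfolding elementary_integral_def[abs_def] by auto
qed

lemma elementary_process_measurable:
  fixes \<phi> :: "nat \<Rightarrow> 'w \<Rightarrow> ((real ^ 'd) \<Rightarrow>\<^sub>L 'h::{real_inner, banach, second_countable_topology})"
  assumes t: "t \<le> T" and \<phi>: "elementary_integrand F t n \<tau> \<phi>"
  shows "(\<lambda>(s, \<omega>). blinfun_apply (elementary_process n \<tau> \<phi> s \<omega>) x)
    \<in> borel_measurable (restrict_space lborel {0..t} \<Otimes>\<^sub>M M)"
proof -
  have [measurable]: "(\<lambda>\<omega>. blinfun_apply (\<phi> i \<omega>) x) \<in> borel_measurable M" if "i < n" for i
  proof -
    note p = elementary_integrand_partition[OF \<phi> that]
    show ?thesis by (rule bounded_operator_rv_measurable[OF _ p(4)]) (use p t in auto)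
  qed
  have [measurable]: "(indicator {\<tau> i<..\<tau> (Suc i)} :: real \<Rightarrow> real) \<in> borel_measurable
      (restrict_space lborel {0..t})" for i
    by (rule measurable_restrict_space1) simp
  have "(\<lambda>p. \<Sum>i<n. indicator {\<tau> i<..\<tau> (Suc i)} (fst p) *\<^sub>R blinfun_apply (\<phi> i (snd p)) x)
      \<in> borel_measurable (restrict_space lborel {0..t} \<Otimes>\<^sub>M M)"
    by (intro borel_measurable_sum) measurable
  then show ?thesis
    by (simp add: elementary_process_def case_prod_beta blinfun.sum_left blinfun.scaleR_left)
qed

lemma ito_error_measurable:
  fixes \<Phi> :: "real \<Rightarrow> 'w \<Rightarrow> ((real ^ 'd) \<Rightarrow>\<^sub>L 'h::{real_inner, banach, second_countable_topology})"
  assumes t: "t \<le> T" and \<phi>: "elementary_integrand F t n \<tau> \<phi>"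
    and \<Phi>: "\<And>x. (\<lambda>(s, \<omega>). blinfun_apply (\<Phi> s \<omega>) x) \<in> borel_measurable (restrict_space lborel {0..t} \<Otimes>\<^sub>M M)"
  shows "(\<lambda>p. (hilbert_schmidt_norm (\<Phi> (fst p) (snd p) - elementary_process n \<tau> \<phi> (fst p) (snd p)))\<^sup>2)
    \<in> borel_measurable (restrict_space lborel {0..t} \<Otimes>\<^sub>M M)"
  using \<Phi> elementary_process_measurable[OF t \<phi>]
  by (intro borel_measurable_hilbert_schmidt_norm_sq) (auto simp: blinfun.diff_left case_prod_beta)

text \<open>The approximating sequence behind \<open>I\<close> is inserted between \<open>I\<close>
  and the given elementary integral, and the isometry compares the two elementary integrals. The
  factor 4 is the price of splitting a square into two twice, once for the integrals and once for
  the integrands. It is not sharp, but all later uses let the right-hand side tend to zero.\<close>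

lemma ito_integral_error:
  fixes \<Phi> :: "real \<Rightarrow> 'w \<Rightarrow> ((real ^ 'd) \<Rightarrow>\<^sub>L 'h::{real_inner, banach, second_countable_topology})"
  assumes t: "t \<in> {0..T}" and I: "has_ito_integral M F W t \<Phi> I" and \<psi>: "elementary_integrand F t m \<rho> \<psi>"
  shows "(\<integral>\<^sup>+\<omega>. ennreal ((norm (I \<omega> - elementary_integral W m \<rho> \<psi> \<omega>))\<^sup>2) \<partial>M) \<le>
    4 * (\<integral>\<^sup>+(s, \<omega>). ennreal ((hilbert_schmidt_norm (\<Phi> s \<omega> - elementary_process m \<rho> \<psi> s \<omega>))\<^sup>2)
      \<partial>(restrict_space lborel {0..t} \<Otimes>\<^sub>M M))"
proof -
  let ?N = "restrict_space lborel {0..t} \<Otimes>\<^sub>M M"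
  from t have t': "t \<le> T" by simp
  have Im [measurable]: "I \<in> borel_measurable M"
    and \<Phi>: "\<And>x. (\<lambda>(s, \<omega>). blinfun_apply (\<Phi> s \<omega>) x) \<in> borel_measurable ?N"
    using I by (auto simp: has_ito_integral_def)
  obtain n \<tau> \<phi> where e: "\<And>k::nat. elementary_integrand F t (n k) (\<tau> k) (\<phi> k)"
    and l1: "(\<lambda>k. \<integral>\<^sup>+(s, \<omega>). ennreal ((hilbert_schmidt_norm
                 (\<Phi> s \<omega> - elementary_process (n k) (\<tau> k) (\<phi> k) s \<omega>))\<^sup>2) \<partial>?N) \<longlonglongrightarrow> 0" (is "?d \<longlonglongrightarrow> 0")
    and l2: "(\<lambda>k. \<integral>\<^sup>+\<omega>. ennreal ((norm (I \<omega> - elementary_integral W (n k) (\<tau> k) (\<phi> k) \<omega>))\<^sup>2) \<partial>M) \<longlonglongrightarrow> 0"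
        (is "?e \<longlonglongrightarrow> 0")
    using I unfolding has_ito_integral_def by blast
  let ?L = "\<integral>\<^sup>+\<omega>. ennreal ((norm (I \<omega> - elementary_integral W m \<rho> \<psi> \<omega>))\<^sup>2) \<partial>M"
  let ?D = "\<integral>\<^sup>+(s, \<omega>). ennreal ((hilbert_schmidt_norm (\<Phi> s \<omega> - elementary_process m \<rho> \<psi> s \<omega>))\<^sup>2) \<partial>?N"
  have bound: "?L \<le> (2 * ?e k + 2 * (2 * ?d k)) + 4 * ?D" for k
  proof -
    have [measurable]: "elementary_integral W (n k) (\<tau> k) (\<phi> k) \<in> borel_measurable M"
      "elementary_integral W m \<rho> \<psi> \<in> borel_measurable M"
      using F_measurable_M[OF t elementary_integral_adapted[OF t e]]
        F_measurable_M[OF t elementary_integral_adapted[OF t \<psi>]] by auto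
    have "?L \<le> 2 * ?e k + 2 * (\<integral>\<^sup>+\<omega>. ennreal ((norm (elementary_integral W (n k) (\<tau> k) (\<phi> k) \<omega> -
          elementary_integral W m \<rho> \<psi> \<omega>))\<^sup>2) \<partial>M)"
      by (intro nn_integral_le_two_sum norm_diff_sq_triangle) measurable
    also have "(\<integral>\<^sup>+\<omega>. ennreal ((norm (elementary_integral W (n k) (\<tau> k) (\<phi> k) \<omega> -
          elementary_integral W m \<rho> \<psi> \<omega>))\<^sup>2) \<partial>M) =
        (\<integral>\<^sup>+p. ennreal ((hilbert_schmidt_norm (elementary_process (n k) (\<tau> k) (\<phi> k) (fst p) (snd p) -
          elementary_process m \<rho> \<psi> (fst p) (snd p)))\<^sup>2) \<partial>?N)"
      by (simp only: ito_isometry_elementary_diff[OF t' e \<psi>] case_prod_beta')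
    also have "\<dots> \<le> 2 * ?d k + 2 * ?D"
      unfolding case_prod_beta
    proof (rule nn_integral_le_two_sum)
      show "(hilbert_schmidt_norm (elementary_process (n k) (\<tau> k) (\<phi> k) (fst p) (snd p) -
          elementary_process m \<rho> \<psi> (fst p) (snd p)))\<^sup>2
        \<le> 2 * (hilbert_schmidt_norm (\<Phi> (fst p) (snd p) - elementary_process (n k) (\<tau> k) (\<phi> k) (fst p)
            (snd p)))\<^sup>2
          + 2 * (hilbert_schmidt_norm (\<Phi> (fst p) (snd p) - elementary_process m \<rho> \<psi> (fst p) (snd p)))\<^sup>2" for p
        using hilbert_schmidt_norm_diff_sq_triangle[of "elementary_process (n k) (\<tau> k) (\<phi> k) (fst p) (snd p)"
            "elementary_process m \<rho> \<psi> (fst p) (snd p)" "\<Phi> (fst p) (snd p)"]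
        by (simp add: hilbert_schmidt_norm_sq blinfun.diff_left norm_minus_commute)
    qed (use ito_error_measurable[OF t' e \<Phi>] ito_error_measurable[OF t' \<psi> \<Phi>] in auto)
    finally have "?L \<le> 2 * ?e k + 2 * (2 * ?d k + 2 * ?D)" by (auto simp: mult_left_mono)
    moreover have "2 * x + 2 * (2 * y + 2 * z) = (2 * x + 2 * (2 * y)) + 4 * z" for x y z :: ennreal
      by (simp add: distrib_left add.assoc mult.assoc[symmetric])
    ultimately show ?thesis by metis
  qed
  have "(\<lambda>k. (2 * ?e k + 2 * (2 * ?d k)) + 4 * ?D) \<longlonglongrightarrow> 0 + 4 * ?D"
  proof (intro tendsto_add[OF ennreal_two_sum_tendsto_0 tendsto_const] l2)
    show "(\<lambda>k. 2 * ?d k) \<longlonglongrightarrow> 0" using ennreal_tendsto_cmult[OF _ l1, of 2] by simp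
  qed
  then have "?L \<le> 0 + 4 * ?D"
    by (rule LIMSEQ_le_const) (use bound in auto)
  then show ?thesis by simp
qed

text \<open>By the error estimate, the elementary integrals that approximate the integrand for
  \<open>I\<close> also approximate \<open>J\<close>.\<close>

lemma has_ito_integral_unique:
  fixes \<Phi> :: "real \<Rightarrow> 'w \<Rightarrow> ((real ^ 'd) \<Rightarrow>\<^sub>L 'h::{real_inner, banach, second_countable_topology})"
  assumes t: "t \<in> {0..T}" and I: "has_ito_integral M F W t \<Phi> I" and J: "has_ito_integral M F W t \<Phi> J"
  shows "AE \<omega> in M. I \<omega> = J \<omega>"
proof -
  let ?N = "restrict_space lborel {0..t} \<Otimes>\<^sub>M M"
  have [measurable]: "I \<in> borel_measurable M" "J \<in> borel_measurable M"
    using I J by (auto simp: has_ito_integral_def)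
  obtain n \<tau> \<phi> where e: "\<And>k::nat. elementary_integrand F t (n k) (\<tau> k) (\<phi> k)"
    and l1: "(\<lambda>k. \<integral>\<^sup>+(s, \<omega>). ennreal ((hilbert_schmidt_norm
                 (\<Phi> s \<omega> - elementary_process (n k) (\<tau> k) (\<phi> k) s \<omega>))\<^sup>2) \<partial>?N) \<longlonglongrightarrow> 0" (is "?d \<longlonglongrightarrow> 0")
    using I unfolding has_ito_integral_def by blast
  let ?E = "\<lambda>k. elementary_integral W (n k) (\<tau> k) (\<phi> k)"
  let ?L = "\<integral>\<^sup>+\<omega>. ennreal ((norm (I \<omega> - J \<omega>))\<^sup>2) \<partial>M"
  have "?L \<le> 2 * (4 * ?d k) + 2 * (4 * ?d k)" for k
  proof -
    have [measurable]: "?E k \<in> borel_measurable M"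
      by (rule F_measurable_M[OF t elementary_integral_adapted[OF t e]])
    have "?L \<le> 2 * (\<integral>\<^sup>+\<omega>. ennreal ((norm (I \<omega> - ?E k \<omega>))\<^sup>2) \<partial>M) + 2 *
        (\<integral>\<^sup>+\<omega>. ennreal ((norm (?E k \<omega> - J \<omega>))\<^sup>2) \<partial>M)"
      by (intro nn_integral_le_two_sum norm_diff_sq_triangle) measurable
    also have "\<dots> \<le> 2 * (4 * ?d k) + 2 * (4 * ?d k)"
      using ito_integral_error[OF t I e[of k]] ito_integral_error[OF t J e[of k]]
      by (intro add_mono mult_left_mono) (auto simp: norm_minus_commute)
    finally show ?thesis .
  qed
  moreover have "(\<lambda>k. 2 * (4 * ?d k) + 2 * (4 * ?d k)) \<longlonglongrightarrow> 0"
    using ennreal_tendsto_cmult[OF _ l1, of 4] by (intro ennreal_two_sum_tendsto_0) auto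
  ultimately have "?L \<le> 0" by (intro LIMSEQ_le_const) auto
  then have "AE \<omega> in M. ennreal ((norm (I \<omega> - J \<omega>))\<^sup>2) = 0"
    by (subst nn_integral_0_iff_AE[symmetric]) auto
  then show ?thesis by eventually_elim (auto simp: ennreal_eq_0_iff)
qed

text \<open>The definition asks only for measurability with respect to \<open>M\<close>. A
  subsequence of adapted elementary integrals converges almost surely to \<open>I\<close>, and null
  sets belong to \<open>F 0\<close>, hence to \<open>F t\<close>.\<close>

lemma has_ito_integral_adapted:
  fixes \<Phi> :: "real \<Rightarrow> 'w \<Rightarrow> ((real ^ 'd) \<Rightarrow>\<^sub>L 'h::{real_inner, banach, second_countable_topology})"
  assumes t: "t \<in> {0..T}" and I: "has_ito_integral M F W t \<Phi> I"
  shows "I \<in> borel_measurable (F t)"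
proof -
  have Im: "I \<in> borel_measurable M" using I by (auto simp: has_ito_integral_def)
  obtain n \<tau> \<phi> where e: "\<And>k::nat. elementary_integrand F t (n k) (\<tau> k) (\<phi> k)"
    and l2: "(\<lambda>k. \<integral>\<^sup>+\<omega>. ennreal ((norm (I \<omega> - elementary_integral W (n k) (\<tau> k) (\<phi> k) \<omega>))\<^sup>2) \<partial>M) \<longlonglongrightarrow> 0"
    using I unfolding has_ito_integral_def by blast
  let ?E = "\<lambda>k. elementary_integral W (n k) (\<tau> k) (\<phi> k)"
  have EF [measurable]: "?E k \<in> borel_measurable (F t)" for k by (rule elementary_integral_adapted[OF t e])
  obtain r :: "nat \<Rightarrow> nat" where r: "AE \<omega> in M. (\<lambda>k. ?E (r k) \<omega>) \<longlonglongrightarrow> I \<omega>"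
    using L2_convergence_AE_subseq[OF Im F_measurable_M[OF t EF] l2] by blast
  show ?thesis
  proof (rule borel_measurable_AE_eq_subalgebra[OF subalgebra_F[OF t] _ Im])
    show "null_sets M \<subseteq> sets (F t)"
      using F_null_sets F_mono[of 0 t] t by (auto simp: subalgebra_def)
    show "(\<lambda>\<omega>. lim (\<lambda>k. ?E (r k) \<omega>)) \<in> borel_measurable (F t)" by measurable
    show "AE \<omega> in M. I \<omega> = lim (\<lambda>k. ?E (r k) \<omega>)"
      using r by eventually_elim (simp add: limI)
  qed
qed


text \<open>The equation for \<open>X\<close> at time \<xi> supplies an integral over
  \<open>{0..\<xi>}\<close>, while the lift at time t needs one over \<open>{0..t}\<close>. The same
  elementary integrands serve for both horizons. With \<open>r = t\<close> the lemma just inserts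
  the indicator of \<open>{0..t}\<close> into the integrand.\<close>

lemma has_ito_integral_extend:
  fixes \<Phi> :: "real \<Rightarrow> 'w \<Rightarrow> ((real ^ 'd) \<Rightarrow>\<^sub>L 'h::{real_inner, banach, second_countable_topology})"
  assumes rt: "r \<le> t" "t \<le> T" and I: "has_ito_integral M F W r \<Phi> I"
  shows "has_ito_integral M F W t (\<lambda>s \<omega>. indicator {0..r} s *\<^sub>R \<Phi> s \<omega>) I"
proof -
  let ?R = "\<lambda>t. restrict_space lborel {0..t}"
  let ?\<Phi> = "\<lambda>s \<omega>. indicator {0..r} s *\<^sub>R \<Phi> s \<omega>"
  have Im: "I \<in> borel_measurable M"
    and \<Phi>: "\<And>x. (\<lambda>(s, \<omega>). blinfun_apply (\<Phi> s \<omega>) x) \<in> borel_measurable (?R r \<Otimes>\<^sub>M M)"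
    using I by (auto simp: has_ito_integral_def)
  obtain n \<tau> \<phi> where e: "\<And>k::nat. elementary_integrand F r (n k) (\<tau> k) (\<phi> k)"
    and l1: "(\<lambda>k. \<integral>\<^sup>+(s, \<omega>). ennreal ((hilbert_schmidt_norm
                 (\<Phi> s \<omega> - elementary_process (n k) (\<tau> k) (\<phi> k) s \<omega>))\<^sup>2) \<partial>(?R r \<Otimes>\<^sub>M M)) \<longlonglongrightarrow> 0"
    and l2: "(\<lambda>k. \<integral>\<^sup>+\<omega>. ennreal ((norm (I \<omega> - elementary_integral W (n k) (\<tau> k) (\<phi> k) \<omega>))\<^sup>2) \<partial>M) \<longlonglongrightarrow> 0"
    using I unfolding has_ito_integral_def by blast
  have e': "elementary_integrand F t (n k) (\<tau> k) (\<phi> k)" for k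
    using e[of k] rt by (auto simp: elementary_integrand_def)
  \<comment> \<open>Nothing is known about \<Phi> at times after \<open>r\<close>, so measurability
    is obtained by gluing its restriction to times up to \<open>r\<close> with zero.\<close>
  have m: "(\<lambda>(s, \<omega>). blinfun_apply (?\<Phi> s \<omega>) x) \<in> borel_measurable (?R t \<Otimes>\<^sub>M M)" for x
  proof -
    let ?S = "{p \<in> space (?R t \<Otimes>\<^sub>M M). fst p \<le> r}"
    let ?N = "restrict_space (?R t \<Otimes>\<^sub>M M) {p. fst p \<le> r}"
    have fst [measurable]: "fst \<in> borel_measurable (?R t \<Otimes>\<^sub>M M)"
      by (rule measurable_compose[OF measurable_fst
          measurable_restrict_space1[OF measurable_ident_sets[OF sets_lborel]]])
    have "fst \<in> measurable ?N (?R r)"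
    proof (rule measurable_restrict_space2)
      show "fst \<in> space ?N \<rightarrow> {0..r}"
        by (auto simp: space_restrict_space space_pair_measure)
      show "fst \<in> measurable ?N lborel"
        using fst by (intro measurable_restrict_space1) simp
    qed
    moreover have "snd \<in> measurable ?N M" by (rule measurable_restrict_space1) simp
    ultimately have "(\<lambda>p. (fst p, snd p)) \<in> measurable ?N (?R r \<Otimes>\<^sub>M M)" by (rule measurable_Pair)
    from measurable_compose[OF this \<Phi>[of x]]
    have "(\<lambda>p. blinfun_apply (\<Phi> (fst p) (snd p)) x) \<in> borel_measurable ?N"
      by (simp add: case_prod_beta')
    then have "(\<lambda>p. if fst p \<le> r then blinfun_apply (\<Phi> (fst p) (snd p)) x else 0) \<in> borel_measurable
        (?R t \<Otimes>\<^sub>M M)"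
      by (intro measurable_If_restrict_space_iff[THEN iffD2] conjI) auto
    then show ?thesis
      by (rule measurable_cong[THEN iffD1, rotated])
        (auto simp: space_pair_measure space_restrict_space indicator_def blinfun.scaleR_left)
  qed
  have "(\<integral>\<^sup>+(s, \<omega>). ennreal ((hilbert_schmidt_norm (?\<Phi> s \<omega> - elementary_process (n k) (\<tau> k) (\<phi> k) s \<omega>))\<^sup>2)
      \<partial>(?R t \<Otimes>\<^sub>M M)) =
    (\<integral>\<^sup>+(s, \<omega>). ennreal ((hilbert_schmidt_norm (\<Phi> s \<omega> - elementary_process (n k) (\<tau> k) (\<phi> k) s \<omega>))\<^sup>2)
      \<partial>(?R r \<Otimes>\<^sub>M M))" (is "?A = ?B") for k
  proof -
    have "?A = (\<integral>\<^sup>+s. \<integral>\<^sup>+\<omega>. ennreal ((hilbert_schmidt_norm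
        (?\<Phi> s \<omega> - elementary_process (n k) (\<tau> k) (\<phi> k) s \<omega>))\<^sup>2) \<partial>M \<partial>?R t)"
      using ito_error_measurable[OF rt(2) e' m]
      by (subst nn_integral_fst[symmetric]) (auto simp: case_prod_beta')
    also have "\<dots> = (\<integral>\<^sup>+s. (\<integral>\<^sup>+\<omega>. ennreal ((hilbert_schmidt_norm
        (?\<Phi> s \<omega> - elementary_process (n k) (\<tau> k) (\<phi> k) s \<omega>))\<^sup>2) \<partial>M) * indicator {0..t} s \<partial>lborel)"
      by (subst nn_integral_restrict_space) auto
    also have "\<dots> = (\<integral>\<^sup>+s. (\<integral>\<^sup>+\<omega>. ennreal ((hilbert_schmidt_norm
        (\<Phi> s \<omega> - elementary_process (n k) (\<tau> k) (\<phi> k) s \<omega>))\<^sup>2) \<partial>M) * indicator {0..r} s \<partial>lborel)"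
    proof (intro nn_integral_cong)
      fix s :: real
      \<comment> \<open>All partition points lie below \<open>r\<close>, so after \<open>r\<close>
        both the truncated integrand and its approximation are zero and contribute no error.\<close>
      have "elementary_process (n k) (\<tau> k) (\<phi> k) s \<omega> = 0" if "s > r" for \<omega>
        unfolding elementary_process_def
        using elementary_integrand_partition(3)[OF e[of k]] that
        by (intro sum.neutral) (force simp: indicator_def)
      then show "(\<integral>\<^sup>+\<omega>. ennreal ((hilbert_schmidt_norm
          (?\<Phi> s \<omega> - elementary_process (n k) (\<tau> k) (\<phi> k) s \<omega>))\<^sup>2) \<partial>M) * indicator {0..t} s =
        (\<integral>\<^sup>+\<omega>. ennreal ((hilbert_schmidt_norm
          (\<Phi> s \<omega> - elementary_process (n k) (\<tau> k) (\<phi> k) s \<omega>))\<^sup>2) \<partial>M) * indicator {0..r} s"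
        using rt by (cases "s \<le> r") (auto simp: indicator_def hilbert_schmidt_norm_sq)
    qed
    also have "\<dots> = (\<integral>\<^sup>+s. \<integral>\<^sup>+\<omega>. ennreal ((hilbert_schmidt_norm
        (\<Phi> s \<omega> - elementary_process (n k) (\<tau> k) (\<phi> k) s \<omega>))\<^sup>2) \<partial>M \<partial>?R r)"
      by (subst nn_integral_restrict_space) auto
    also have "\<dots> = ?B"
      using ito_error_measurable[OF _ e \<Phi>] rt
      by (subst nn_integral_fst[symmetric]) (auto simp: case_prod_beta')
    finally show ?thesis .
  qed
  with l1 l2 e' m Im show ?thesis
    unfolding has_ito_integral_def
    by (intro conjI exI[of _ n] exI[of _ \<tau>] exI[of _ \<phi>] allI) auto
qed

end

section \<open>Functions of two variables as \<open>L\<^sup>2\<close>-valued maps\<close>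

text \<open>By Lindelof's theorem every open set is a countable union of balls, and the preimage of
  a ball is a sublevel set of a distance function. Measurability of maps into \<open>l2\<close>
  thereby reduces to real-valued functions.\<close>

lemma borel_measurable_dist_all:
  fixes f :: "'b \<Rightarrow> 'c::{metric_space, second_countable_topology}"
  assumes "\<And>y. (\<lambda>x. dist (f x) y) \<in> borel_measurable N"
  shows "f \<in> borel_measurable N"
proof (rule borel_measurableI)
  fix U :: "'c set" assume U: "open U"
  let ?B = "{ball y e |y e. ball y e \<subseteq> U}"
  obtain \<B> where \<B>: "\<B> \<subseteq> ?B" "countable \<B>" "\<Union>\<B> = \<Union>?B"
    using Lindelof[of ?B] by auto
  have "\<Union>?B = U"
  proof (rule subset_antisym)
    show "\<Union>?B \<subseteq> U" by auto
    show "U \<subseteq> \<Union>?B"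
    proof
      fix y assume "y \<in> U"
      then obtain e where "e > 0" "ball y e \<subseteq> U" using U by (auto simp: open_contains_ball)
      then show "y \<in> \<Union>?B" by (intro UnionI[of "ball y e"]) auto
    qed
  qed
  then have "f -` U \<inter> space N = (\<Union>S\<in>\<B>. f -` S \<inter> space N)" using \<B>(3) by auto
  also have "\<dots> \<in> sets N"
  proof (rule sets.countable_UN''[OF \<B>(2)])
    fix S assume "S \<in> \<B>"
    then obtain y e where S: "S = ball y e" using \<B>(1) by auto
    have "f -` S \<inter> space N = {x \<in> space N. dist (f x) y < e}" by (auto simp: S dist_commute)
    also have "\<dots> \<in> sets N" using assms[of y] by measurable
    finally show "f -` S \<inter> space N \<in> sets N" .
  qed
  finally show "f -` U \<inter> space N \<in> sets N" .
qed

text \<open>The distance to a fixed element is the root of an integral over \<open>x\<close> with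
  parameter \<omega>, which depends measurably on the parameter because \<open>f\<close> is jointly
  measurable.\<close>

lemma borel_measurable_l2_class:
  fixes f :: "'b \<Rightarrow> real \<Rightarrow> 'c::euclidean_space"
  assumes f [measurable]: "(\<lambda>(\<omega>, x). f \<omega> x) \<in> borel_measurable (N \<Otimes>\<^sub>M lborel)"
    and sq: "\<And>\<omega>. \<omega> \<in> space N \<Longrightarrow> square_integrable (f \<omega>)"
  shows "(\<lambda>\<omega>. l2_class (f \<omega>)) \<in> borel_measurable N"
proof (rule borel_measurable_dist_all)
  fix y :: "'c l2"
  obtain g where g: "square_integrable g" "y = l2_class g" using l2_class_ex by blast
  have [measurable]: "g \<in> borel_measurable lborel" using g by (simp add: square_integrable_def)
  have "(\<lambda>\<omega>. sqrt (LBINT x. (norm (f \<omega> x - g x))\<^sup>2)) \<in> borel_measurable N"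
    by measurable
  moreover have "dist (l2_class (f \<omega>)) y = sqrt (LBINT x. (norm (f \<omega> x - g x))\<^sup>2)" if "\<omega> \<in> space N" for \<omega>
    using norm_l2_class[OF square_integrable_diff[OF sq[OF that] g(1)]]
    by (simp add: g dist_norm l2_class_diff sq[OF that] real_sqrt_unique)
  ultimately show "(\<lambda>\<omega>. dist (l2_class (f \<omega>)) y) \<in> borel_measurable N"
    by (simp cong: measurable_cong)
qed

lemma inner_l2_class:
  "square_integrable f \<Longrightarrow> square_integrable g \<Longrightarrow> l2_class f \<bullet> l2_class g = (LBINT x. f x \<bullet> g x)"
  by transfer simp

lemma square_integrable_norm: "square_integrable f \<Longrightarrow> square_integrable (\<lambda>x. norm (f x))"
  by (auto simp: square_integrable_def)

lemma norm_l2_class_norm: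
  assumes "square_integrable f"
  shows "norm (l2_class (\<lambda>x. norm (f x))) = norm (l2_class f)"
proof -
  have "(norm (l2_class (\<lambda>x. norm (f x))))\<^sup>2 = (norm (l2_class f))\<^sup>2"
    by (simp add: norm_l2_class assms square_integrable_norm)
  then show ?thesis by (simp add: power2_eq_iff_nonneg)
qed

text \<open>Identifies a Bochner integral of classes with the class of the pointwise integrals. An
  element of a Hilbert space is determined by its inner products, and after pairing with a fixed
  element the claim is Fubini's theorem.\<close>

lemma integral_l2_class:
  fixes f :: "real \<Rightarrow> real \<Rightarrow> 'a::euclidean_space"
  assumes f: "(\<lambda>(s, x). f s x) \<in> borel_measurable (lborel \<Otimes>\<^sub>M lborel)"
    and sq: "\<And>s. square_integrable (f s)"
    and int: "integrable lborel (\<lambda>s. l2_class (f s))"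
    and fint: "\<And>x. integrable lborel (\<lambda>s. f s x)"
    and sqF: "square_integrable (\<lambda>x. LBINT s. f s x)"
  shows "(LBINT s. l2_class (f s)) = l2_class (\<lambda>x. LBINT s. f s x)"
proof (rule vector_eq_rdot[THEN iffD1], intro allI)
  fix y :: "'a l2"
  obtain g where g: "square_integrable g" "y = l2_class g" using l2_class_ex by blast
  have gm [measurable]: "g \<in> borel_measurable lborel" using g by (simp add: square_integrable_def)
  note f [measurable]
  have "(LBINT s. l2_class (f s)) \<bullet> y = (LBINT s. l2_class (f s) \<bullet> y)"
    using int by (intro integral_inner_left[symmetric]) auto
  also have "\<dots> = (LBINT s. LBINT x. f s x \<bullet> g x)" by (simp add: inner_l2_class sq g)
  also have "\<dots> = (LBINT x. LBINT s. f s x \<bullet> g x)"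
  proof (rule lborel_pair.Fubini_integral[symmetric], rule lborel_pair.Fubini_integrable)
    show "(\<lambda>(s, x). f s x \<bullet> g x) \<in> borel_measurable (lborel \<Otimes>\<^sub>M lborel)" by measurable
    show "AE s in lborel. integrable lborel (\<lambda>x. case (s, x) of (s, x) \<Rightarrow> f s x \<bullet> g x)"
      by (simp add: square_integrable_inner sq g)
    show "integrable lborel (\<lambda>s. LBINT x. norm (case (s, x) of (s, x) \<Rightarrow> f s x \<bullet> g x))"
    proof (rule Bochner_Integration.integrable_bound)
      show "integrable lborel (\<lambda>s. norm (l2_class (f s)) * norm y)" using int by simp
      show "(\<lambda>s. LBINT x. norm (case (s, x) of (s, x) \<Rightarrow> f s x \<bullet> g x)) \<in> borel_measurable lborel"
        by measurable
      show "AE s in lborel. norm (LBINT x. norm (case (s, x) of (s, x) \<Rightarrow> f s x \<bullet> g x))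
          \<le> norm (norm (l2_class (f s)) * norm y)"
      proof (rule AE_I2)
        fix s
        \<comment> \<open>Fubini needs the integral of the absolute value of the pointwise inner
          product, which Cauchy-Schwarz for \<open>f s\<close> and \<open>g\<close> themselves does
          not bound; it is applied to the classes of their pointwise norms.\<close>
        have "(LBINT x. \<bar>f s x \<bullet> g x\<bar>) \<le> (LBINT x. norm (f s x) \<bullet> norm (g x))"
        proof (rule integral_mono)
          show "integrable lborel (\<lambda>x. \<bar>f s x \<bullet> g x\<bar>)"
            by (intro integrable_abs square_integrable_inner sq g)
          show "integrable lborel (\<lambda>x. norm (f s x) \<bullet> norm (g x))"
            by (intro square_integrable_inner square_integrable_norm sq g)
          show "\<bar>f s x \<bullet> g x\<bar> \<le> norm (f s x) \<bullet> norm (g x)" for x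
            using Cauchy_Schwarz_ineq2[of "f s x" "g x"] by simp
        qed
        also have "\<dots> = l2_class (\<lambda>x. norm (f s x)) \<bullet> l2_class (\<lambda>x. norm (g x))"
          by (intro inner_l2_class[symmetric] square_integrable_norm sq g)
        also have "\<dots> \<le> norm (l2_class (f s)) * norm y"
          using norm_cauchy_schwarz[of "l2_class (\<lambda>x. norm (f s x))" "l2_class (\<lambda>x. norm (g x))"]
          by (simp add: norm_l2_class_norm sq g)
        finally show "norm (LBINT x. norm (case (s, x) of (s, x) \<Rightarrow> f s x \<bullet> g x))
          \<le> norm (norm (l2_class (f s)) * norm y)" by simp
      qed
    qed
  qed
  also have "\<dots> = (LBINT x. (LBINT s. f s x) \<bullet> g x)"
    using fint by simp
  also have "\<dots> = l2_class (\<lambda>x. LBINT s. f s x) \<bullet> y" by (simp add: inner_l2_class sqF g)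
  finally show "(LBINT s. l2_class (f s)) \<bullet> y = l2_class (\<lambda>x. LBINT s. f s x) \<bullet> y" .
qed

text \<open>A function measurable in one variable and continuous in the other is a limit of
  functions that are piecewise constant in the second. This turns adaptedness plus continuous paths
  into joint measurability.\<close>

lemma borel_measurable_pair_continuous:
  fixes f :: "'b \<Rightarrow> real \<Rightarrow> 'c::{real_normed_vector, second_countable_topology}"
  assumes f: "\<And>x. x \<in> {a..c} \<Longrightarrow> (\<lambda>\<omega>. f \<omega> x) \<in> borel_measurable G"
    and cont: "\<And>\<omega>. \<omega> \<in> space G \<Longrightarrow> continuous_on {a..c} (f \<omega>)"
  shows "(\<lambda>(\<omega>, x). indicator {a..c} x *\<^sub>R f \<omega> x) \<in> borel_measurable (G \<Otimes>\<^sub>M borel)"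
proof (cases "a \<le> c")
  case True
  \<comment> \<open>Grid points may fall outside \<open>{a..c}\<close>, where nothing is known about
    \<open>f\<close>; \<open>p\<close> moves them to the nearest point of the interval.\<close>
  define p where "p x = max a (min c x)" for x
  have p: "p x \<in> {a..c}" for x using True by (auto simp: p_def)
  have "(\<lambda>q. f (fst q) (p (snd q))) \<in> borel_measurable (G \<Otimes>\<^sub>M borel)"
  proof (rule borel_measurable_LIMSEQ_metric)
    fix n :: nat
    have "(\<lambda>q. f (fst q) (p (of_int i / real (Suc n)))) \<in> borel_measurable (G \<Otimes>\<^sub>M borel)" for i :: int
      by (rule measurable_compose[OF measurable_fst f[OF p]])
    moreover have "(\<lambda>q. \<lfloor>real (Suc n) * snd q\<rfloor>) \<in> measurable (G \<Otimes>\<^sub>M borel) (count_space UNIV)"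
      by measurable
    ultimately show "(\<lambda>q. f (fst q) (p (of_int \<lfloor>real (Suc n) * snd q\<rfloor> / real (Suc n))))
        \<in> borel_measurable (G \<Otimes>\<^sub>M borel)"
      by (rule measurable_compose_countable)
  next
    fix q assume "q \<in> space (G \<Otimes>\<^sub>M (borel :: real measure))"
    then have c: "continuous_on {a..c} (f (fst q))" by (intro cont) (auto simp: space_pair_measure)
    have "(\<lambda>n. of_int \<lfloor>real (Suc n) * snd q\<rfloor> / real (Suc n)) \<longlonglongrightarrow> snd q"
    proof (rule tendsto_sandwich)
      show "(\<lambda>n. snd q - 1 / real (Suc n)) \<longlonglongrightarrow> snd q"
        using tendsto_diff[OF tendsto_const LIMSEQ_inverse_real_of_nat] by (simp add: inverse_eq_divide)
      show "\<forall>\<^sub>F n in sequentially. snd q - 1 / real (Suc n) \<le> of_int \<lfloor>real (Suc n) * snd q\<rfloor> / real (Suc n)"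
      proof (intro always_eventually allI)
        fix n
        have "real (Suc n) * snd q - 1 \<le> of_int \<lfloor>real (Suc n) * snd q\<rfloor>" by linarith
        then have "(real (Suc n) * snd q - 1) / real (Suc n) \<le> of_int \<lfloor>real (Suc n) * snd q\<rfloor> / real (Suc n)"
          by (intro divide_right_mono) auto
        then show "snd q - 1 / real (Suc n) \<le> of_int \<lfloor>real (Suc n) * snd q\<rfloor> / real (Suc n)"
          by (simp add: diff_divide_distrib del: of_nat_Suc)
      qed
      show "\<forall>\<^sub>F n in sequentially. of_int \<lfloor>real (Suc n) * snd q\<rfloor> / real (Suc n) \<le> snd q"
        by (intro always_eventually allI) (simp add: divide_le_eq mult.commute del: of_nat_Suc)
    qed simp
    then have "(\<lambda>n. p (of_int \<lfloor>real (Suc n) * snd q\<rfloor> / real (Suc n))) \<longlonglongrightarrow> p (snd q)"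
      unfolding p_def by (intro tendsto_intros)
    then show "(\<lambda>n. f (fst q) (p (of_int \<lfloor>real (Suc n) * snd q\<rfloor> / real (Suc n)))) \<longlonglongrightarrow> f (fst q) (p (snd q))"
      by (intro continuous_on_tendsto_compose[OF c]) (use p in auto)
  qed
  then have "(\<lambda>q. indicator {a..c} (snd q) *\<^sub>R f (fst q) (p (snd q))) \<in> borel_measurable (G \<Otimes>\<^sub>M borel)"
    by measurable
  moreover have "indicator {a..c} x *\<^sub>R f \<omega> (p x) = indicator {a..c} x *\<^sub>R f \<omega> x" for \<omega> x
    by (auto simp: p_def indicator_def)
  ultimately show ?thesis by (simp add: case_prod_beta')
qed (simp add: indicator_def)

section \<open>The kernels\<close>

text \<open>The scalar factor by which \<open>sigma_lift T \<alpha> s\<close> acts on every vector,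
  already extended by zero outside \<open>{0..T}\<close>. It is read both as a function of \<xi> and
  as a function of \<open>s\<close>.\<close>

definition lift_kernel :: "real \<Rightarrow> real \<Rightarrow> real \<Rightarrow> real \<Rightarrow> real" where
  "lift_kernel T \<alpha> s \<xi> = indicator {0..T} \<xi> * (fractional_kernel \<alpha> (\<xi> - s) * indicator {s<..} \<xi>)"

lemma borel_measurable_lift_kernel [measurable]:
  "(\<lambda>p. lift_kernel T \<alpha> (fst p) (snd p)) \<in> borel_measurable (borel \<Otimes>\<^sub>M borel)"
proof -
  have "(\<lambda>p. indicator {0..T} (snd p) *
      ((snd p - fst p) powr (\<alpha> - 1) / Gamma \<alpha> * indicator {u::real. 0 < u} (snd p - fst p)))
      \<in> borel_measurable (borel \<Otimes>\<^sub>M borel)"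
    by measurable
  then show ?thesis
    by (rule measurable_cong[THEN iffD1, rotated])
      (auto simp: lift_kernel_def fractional_kernel_def indicator_def)
qed

lemma borel_measurable_lift_kernel1 [measurable]: "lift_kernel T \<alpha> s \<in> borel_measurable borel"
  using measurable_compose[OF measurable_Pair1' borel_measurable_lift_kernel[of T \<alpha>]] by simp

lemma square_integrable_lift_kernel:
  assumes "\<alpha> > 1 / 2" "s \<ge> 0"
  shows "square_integrable (lift_kernel T \<alpha> s)"
proof -
  \<comment> \<open>A unit vector of a one-dimensional space carries the vector-valued integrability
    result over to the scalar kernel.\<close>
  have "square_integrable (\<lambda>\<xi>. lift_kernel T \<alpha> s \<xi> *\<^sub>R (axis 1 1 :: real ^ 1))"
    using square_integrable_on_fractional_kernel[OF assms, of T "axis 1 1 :: real ^ 1"]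
    by (simp add: square_integrable_on_def lift_kernel_def)
  then show ?thesis
    by (rule square_integrable_bound) auto
qed

lemma square_integrable_lift_kernel_scaleR:
  fixes x :: "'a::euclidean_space"
  assumes "\<alpha> > 1 / 2" "s \<ge> 0"
  shows "square_integrable (\<lambda>\<xi>. lift_kernel T \<alpha> s \<xi> *\<^sub>R x)"
  using square_integrable_lift_kernel[OF assms, of T]
  by (auto simp: square_integrable_def power_mult_distrib)

lemma blinfun_apply_sigma_lift_kernel:
  fixes x :: "real ^ 'd"
  assumes "\<alpha> > 1 / 2" "s \<ge> 0"
  shows "blinfun_apply (sigma_lift T \<alpha> s) x = l2_class (\<lambda>\<xi>. lift_kernel T \<alpha> s \<xi> *\<^sub>R x)"
  by (simp add: blinfun_apply_sigma_lift[OF assms] hclass_def lift_kernel_def)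

lemma fractional_kernel_antimono:
  assumes "1 / 2 < \<alpha>" "\<alpha> < 1" "0 < u" "u \<le> v"
  shows "0 \<le> fractional_kernel \<alpha> v" "fractional_kernel \<alpha> v \<le> fractional_kernel \<alpha> u"
proof -
  have G: "0 < Gamma \<alpha>" using assms by (intro Gamma_real_pos) auto
  show "0 \<le> fractional_kernel \<alpha> v" using G by (simp add: fractional_kernel_def)
  show "fractional_kernel \<alpha> v \<le> fractional_kernel \<alpha> u"
    unfolding fractional_kernel_def
    using G assms by (intro divide_right_mono powr_mono2') auto
qed

text \<open>The squared L2 norm of k2 near its singularity, in which every error bound below is
  expressed.\<close>

definition kernel_energy :: "real \<Rightarrow> real \<Rightarrow> real" where
  "kernel_energy \<alpha> r = (LBINT u. indicator {0<..r} u * (fractional_kernel \<alpha> u)\<^sup>2)"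

lemma integrable_kernel_energy:
  assumes "1 / 2 < \<alpha>"
  shows "integrable lborel (\<lambda>u. indicator {0<..r} u * (fractional_kernel \<alpha> u)\<^sup>2)"
proof -
  have "integrable lborel (\<lambda>u. (lift_kernel r \<alpha> 0 u)\<^sup>2)"
    using square_integrable_lift_kernel[OF assms, of 0 r] by (simp add: square_integrable_def)
  moreover have "(lift_kernel r \<alpha> 0 u)\<^sup>2 = indicator {0<..r} u * (fractional_kernel \<alpha> u)\<^sup>2" for u
    by (auto simp: lift_kernel_def indicator_def)
  ultimately show ?thesis by simp
qed

lemma kernel_energy_mono:
  assumes "1 / 2 < \<alpha>" "r \<le> r'"
  shows "kernel_energy \<alpha> r \<le> kernel_energy \<alpha> r'"
  unfolding kernel_energy_def
  using assms by (intro integral_mono integrable_kernel_energy mult_right_mono) (auto simp: indicator_def)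

lemma kernel_energy_tendsto_0:
  assumes \<alpha>: "1 / 2 < \<alpha>" and r: "r \<longlonglongrightarrow> 0" "\<And>n. r n \<le> R"
  shows "(\<lambda>n. kernel_energy \<alpha> (r n)) \<longlonglongrightarrow> 0"
proof -
  have "(\<lambda>n. kernel_energy \<alpha> (r n)) \<longlonglongrightarrow> (LBINT u::real. 0)"
    unfolding kernel_energy_def
  proof (rule integral_dominated_convergence)
    show "integrable lborel (\<lambda>u. indicator {0<..R} u * (fractional_kernel \<alpha> u)\<^sup>2)"
      by (rule integrable_kernel_energy[OF \<alpha>])
    show "(\<lambda>u. indicator {0<..r n} u * (fractional_kernel \<alpha> u)\<^sup>2) \<in> borel_measurable lborel" for n
      by (rule borel_measurable_integrable[OF integrable_kernel_energy[OF \<alpha>]])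
    show "AE u in lborel. norm (indicator {0<..r n} u * (fractional_kernel \<alpha> u)\<^sup>2)
        \<le> indicator {0<..R} u * (fractional_kernel \<alpha> u)\<^sup>2" for n
      using r(2)[of n] by (intro AE_I2) (auto simp: indicator_def)
    show "AE u in lborel. (\<lambda>n. indicator {0<..r n} u * (fractional_kernel \<alpha> u)\<^sup>2) \<longlonglongrightarrow> 0"
    proof (rule AE_I2)
      fix u :: real
      have "eventually (\<lambda>n. indicator {0<..r n} u = (0 :: real)) sequentially"
      proof (cases "u > 0")
        case True
        from order_tendstoD(2)[OF r(1) this] show ?thesis by eventually_elim (auto simp: indicator_def)
      qed (auto simp: indicator_def)
      then show "(\<lambda>n. indicator {0<..r n} u * (fractional_kernel \<alpha> u)\<^sup>2) \<longlonglongrightarrow> 0"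
        by (intro tendsto_eventually) (auto elim: eventually_mono)
    qed
  qed simp
  then show ?thesis by simp
qed

lemma integral_lift_kernel_sq:
  assumes "0 \<le> s"
  shows "(LBINT \<xi>. (lift_kernel T \<alpha> s \<xi>)\<^sup>2) = kernel_energy \<alpha> (T - s)"
proof -
  have "(LBINT \<xi>. (lift_kernel T \<alpha> s \<xi>)\<^sup>2) = (LBINT u. (lift_kernel T \<alpha> s (s + 1 * u))\<^sup>2)"
    by (subst lborel_integral_real_affine[of 1 _ s]) auto
  also have "\<dots> = kernel_energy \<alpha> (T - s)"
    unfolding kernel_energy_def using assms
    by (intro Bochner_Integration.integral_cong) (auto simp: lift_kernel_def indicator_def)
  finally show ?thesis .
qed

text \<open>The kernel is nonnegative and decreasing, so \<open>(x - y)\<^sup>2 \<le> x\<^sup>2 - y\<^sup>2\<close> reduces the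
  continuity of the translates in \<open>L\<^sup>2\<close> to that of the energy.\<close>

lemma lift_kernel_translate:
  assumes \<alpha>: "1 / 2 < \<alpha>" "\<alpha> < 1" and s: "0 \<le> s" "s \<le> r" "r \<le> T"
  shows "(LBINT \<xi>. (lift_kernel T \<alpha> r \<xi> - lift_kernel T \<alpha> s \<xi>)\<^sup>2) \<le> 2 * kernel_energy \<alpha> (r - s)"
proof -
  let ?e = "\<lambda>\<xi>. indicator {0<..r - s} (\<xi> - s) * (fractional_kernel \<alpha> (\<xi> - s))\<^sup>2"
  have i: "integrable lborel (\<lambda>\<xi>. (lift_kernel T \<alpha> q \<xi>)\<^sup>2)" if "0 \<le> q" for q
    using square_integrable_lift_kernel[OF \<alpha>(1) that] by (simp add: square_integrable_def)
  have "integrable lborel (\<lambda>\<xi>. indicator {0<..r - s} (- s + 1 * \<xi>) * (fractional_kernel \<alpha> (- s + 1 * \<xi>))\<^sup>2)"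
    using integrable_kernel_energy[OF \<alpha>(1), of "r - s"] by (intro lborel_integrable_real_affine) auto
  then have ie: "integrable lborel ?e" by simp
  have e: "(LBINT \<xi>. ?e \<xi>) = kernel_energy \<alpha> (r - s)"
    unfolding kernel_energy_def by (subst lborel_integral_real_affine[of 1 _ "- s"]) auto
  \<comment> \<open>On \<open>{s<..r}\<close> only the earlier kernel is nonzero, and the difference
    of squares carries it with a minus sign. Adding its square twice restores the required sign,
    whence the factor 2.\<close>
  have "(LBINT \<xi>. (lift_kernel T \<alpha> r \<xi> - lift_kernel T \<alpha> s \<xi>)\<^sup>2) \<le>
      (LBINT \<xi>. 2 * ?e \<xi> + ((lift_kernel T \<alpha> r \<xi>)\<^sup>2 - (lift_kernel T \<alpha> s \<xi>)\<^sup>2))"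
  proof (rule integral_mono)
    show "integrable lborel (\<lambda>\<xi>. (lift_kernel T \<alpha> r \<xi> - lift_kernel T \<alpha> s \<xi>)\<^sup>2)"
      using square_integrable_diff[OF square_integrable_lift_kernel[OF \<alpha>(1), of r T]
          square_integrable_lift_kernel[OF \<alpha>(1), of s T]] s
      by (simp add: square_integrable_def)
    show "integrable lborel (\<lambda>\<xi>. 2 * ?e \<xi> + ((lift_kernel T \<alpha> r \<xi>)\<^sup>2 - (lift_kernel T \<alpha> s \<xi>)\<^sup>2))"
      using i[of r] i[of s] ie s by auto
    fix \<xi> :: real
    show "(lift_kernel T \<alpha> r \<xi> - lift_kernel T \<alpha> s \<xi>)\<^sup>2 \<le>
        2 * ?e \<xi> + ((lift_kernel T \<alpha> r \<xi>)\<^sup>2 - (lift_kernel T \<alpha> s \<xi>)\<^sup>2)"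
    proof (cases "r < \<xi> \<and> \<xi> \<le> T")
      case True
      let ?x = "fractional_kernel \<alpha> (\<xi> - r)" and ?y = "fractional_kernel \<alpha> (\<xi> - s)"
      have xy: "0 \<le> ?y" "?y \<le> ?x"
        using fractional_kernel_antimono[OF \<alpha>, of "\<xi> - r" "\<xi> - s"] True s by auto
      have "?y * ?y \<le> ?x * ?y" by (rule mult_right_mono) (use xy in auto)
      then have "(?x - ?y)\<^sup>2 \<le> ?x\<^sup>2 - ?y\<^sup>2" by (simp add: power2_eq_square algebra_simps)
      then show ?thesis using True s by (simp add: lift_kernel_def indicator_def)
    next
      case False
      then show ?thesis using s by (auto simp: lift_kernel_def indicator_def)
    qed
  qed
  also have "\<dots> = 2 * kernel_energy \<alpha> (r - s) + (kernel_energy \<alpha> (T - r) - kernel_energy \<alpha> (T - s))"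
    using i[of r] i[of s] ie s by (simp add: e integral_lift_kernel_sq)
  also have "\<dots> \<le> 2 * kernel_energy \<alpha> (r - s)"
    using kernel_energy_mono[OF \<alpha>(1), of "T - r" "T - s"] s by simp
  finally show ?thesis .
qed

section \<open>Convolution of the kernel k1 with a bounded path\<close>

context volterra_coefficients
begin

text \<open>Differences of points of \<open>{0..T}\<close> are at most T, so cutting at T loses
  nothing and makes the kernel globally square-integrable. Vanishing for \<open>u \<le> 0\<close>
  encodes the indicator of \<open>s < \<xi>\<close> when the argument is
  \<open>\<xi> - s\<close>.\<close>

definition truncated_kernel :: "real \<Rightarrow> real" where
  "truncated_kernel u = indicator {0<..T} u * k1 u"

lemma truncated_kernel_measurable [measurable]: "truncated_kernel \<in> borel_measurable borel"
proof -
  have "(\<lambda>u. indicator {0<..T} u *\<^sub>R k1 u) \<in> borel_measurable borel"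
    by (rule borel_measurable_continuous_on_indicator)
      (auto intro: continuous_on_subset[OF k1_continuous])
  then show ?thesis by (simp add: truncated_kernel_def[abs_def])
qed

lemma truncated_kernel_square_integrable: "square_integrable truncated_kernel"
proof -
  have "(truncated_kernel u)\<^sup>2 = indicator {0<..T} u *\<^sub>R (k1 u)\<^sup>2" for u
    by (auto simp: truncated_kernel_def indicator_def)
  then show ?thesis
    using k1_square_integrable[OF T_pos] by (simp add: square_integrable_def set_integrable_def)
qed

lemma truncated_kernel_integrable: "integrable lborel truncated_kernel"
proof (rule Bochner_Integration.integrable_bound)
  show "integrable lborel (\<lambda>u. (norm (truncated_kernel u))\<^sup>2 + indicator {0<..T} u)"
    using truncated_kernel_square_integrable T_pos
    by (intro Bochner_Integration.integrable_add) (auto simp: square_integrable_def)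
  have "\<bar>truncated_kernel u\<bar> \<le> \<bar>truncated_kernel u\<bar>\<^sup>2 + indicator {0<..T} u" for u
  proof (cases "u \<in> {0<..T}")
    case True
    have "0 \<le> (\<bar>truncated_kernel u\<bar> - 1)\<^sup>2" by simp
    then have "2 * \<bar>truncated_kernel u\<bar> \<le> \<bar>truncated_kernel u\<bar>\<^sup>2 + 1" by
        (simp add: power2_eq_square algebra_simps)
    then show ?thesis using True by simp
  qed (simp add: truncated_kernel_def)
  then show "AE u in lborel. norm (truncated_kernel u) \<le> norm
      ((norm (truncated_kernel u))\<^sup>2 + indicator {0<..T} u)"
    by (intro AE_I2) (simp add: abs_of_nonneg)
qed simp

definition truncated_convolution :: "(real \<Rightarrow> real ^ 'd) \<Rightarrow> real \<Rightarrow> real \<Rightarrow> real ^ 'd" where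
  "truncated_convolution g t \<xi> = (LBINT s. indicator {0..t} s *\<^sub>R truncated_kernel (\<xi> - s) *\<^sub>R g s)"

lemma truncated_kernel_reflect:
  "integrable lborel (\<lambda>s. truncated_kernel (\<xi> - s))"
  "(LBINT s. \<bar>truncated_kernel (\<xi> - s)\<bar>) = (LBINT u. \<bar>truncated_kernel u\<bar>)"
proof -
  show "integrable lborel (\<lambda>s. truncated_kernel (\<xi> - s))"
    using lborel_integrable_real_affine[OF truncated_kernel_integrable, of "-1" \<xi>] by simp
  show "(LBINT s. \<bar>truncated_kernel (\<xi> - s)\<bar>) = (LBINT u. \<bar>truncated_kernel u\<bar>)"
    using lborel_integral_real_affine[of "-1" "\<lambda>u. \<bar>truncated_kernel u\<bar>" \<xi>] by simp
qed

context
  fixes g :: "real \<Rightarrow> real ^ 'd" and C :: real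
  assumes g [measurable]: "g \<in> borel_measurable borel" and gC: "\<And>s. norm (g s) \<le> C"
begin

lemma truncated_convolution_integrable:
  "integrable lborel (\<lambda>s. indicator {0..t} s *\<^sub>R truncated_kernel (\<xi> - s) *\<^sub>R g s)"
proof (rule Bochner_Integration.integrable_bound)
  show "integrable lborel (\<lambda>s. C * truncated_kernel (\<xi> - s))"
    using truncated_kernel_reflect(1) by simp
  show "AE s in lborel. norm (indicator {0..t} s *\<^sub>R truncated_kernel (\<xi> - s) *\<^sub>R g s)
      \<le> norm (C * truncated_kernel (\<xi> - s))"
    by (intro AE_I2)
      (auto simp: indicator_def abs_mult mult.commute intro!: mult_right_mono order_trans[OF gC abs_ge_self])
qed measurable

lemma truncated_convolution_bound:
  "norm (truncated_convolution g t \<xi>) \<le> C * (LBINT u. \<bar>truncated_kernel u\<bar>)"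
proof -
  have "norm (truncated_convolution g t \<xi>) \<le> (LBINT s. norm
      (indicator {0..t} s *\<^sub>R truncated_kernel (\<xi> - s) *\<^sub>R g s))"
    unfolding truncated_convolution_def by (rule integral_norm_bound)
  also have "\<dots> \<le> (LBINT s. C * \<bar>truncated_kernel (\<xi> - s)\<bar>)"
  proof (rule integral_mono)
    show "integrable lborel (\<lambda>s. norm (indicator {0..t} s *\<^sub>R truncated_kernel (\<xi> - s) *\<^sub>R g s))"
      using truncated_convolution_integrable by (rule integrable_norm)
    show "integrable lborel (\<lambda>s. C * \<bar>truncated_kernel (\<xi> - s)\<bar>)"
      using truncated_kernel_reflect(1) by simp
    show "norm (indicator {0..t} s *\<^sub>R truncated_kernel (\<xi> - s) *\<^sub>R g s) \<le> C * \<bar>truncated_kernel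
        (\<xi> - s)\<bar>" for s
      using gC[of s] order_trans[OF norm_ge_zero gC[of s]]
      by (auto simp: indicator_def mult.commute intro!: mult_right_mono)
  qed
  finally show ?thesis by (simp add: truncated_kernel_reflect(2))
qed

text \<open>With \<open>min t \<xi>\<close> as upper limit one formula covers the drift of
  \<open>X \<xi>\<close> for \<xi> up to t and that of \<open>\<theta> t \<xi>\<close>
  beyond.\<close>

lemma truncated_convolution_eq:
  assumes "t \<in> {0..T}" "\<xi> \<in> {0..T}"
  shows "(LINT s:{0..min t \<xi>}|lborel. k1 (\<xi> - s) *\<^sub>R g s) = truncated_convolution g t \<xi>"
  unfolding truncated_convolution_def set_lebesgue_integral_def
proof (rule integral_cong_AE)
  show m: "(\<lambda>s. indicator {0..t} s *\<^sub>R truncated_kernel (\<xi> - s) *\<^sub>R g s) \<in> borel_measurable lborel"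
      by measurable
  \<comment> \<open>The integrands agree except possibly at \<open>s = \<xi>\<close>, where
    \<open>k1 0\<close> is an arbitrary value and the truncated kernel is 0. Changing one point
    preserves Borel measurability.\<close>
  have "(\<lambda>s. indicator {0..min t \<xi>} s *\<^sub>R k1 (\<xi> - s) *\<^sub>R g s) =
    (\<lambda>s. if s = \<xi> then indicator {0..min t \<xi>} \<xi> *\<^sub>R k1 0 *\<^sub>R g \<xi>
      else indicator {0..t} s *\<^sub>R truncated_kernel (\<xi> - s) *\<^sub>R g s)"
    by (rule ext) (use assms in \<open>auto simp: truncated_kernel_def indicator_def\<close>)
  then show "(\<lambda>s. indicator {0..min t \<xi>} s *\<^sub>R k1 (\<xi> - s) *\<^sub>R g s) \<in> borel_measurable lborel"
    by simp
  show "AE s in lborel. indicator {0..min t \<xi>} s *\<^sub>R k1 (\<xi> - s) *\<^sub>R g s =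
      indicator {0..t} s *\<^sub>R truncated_kernel (\<xi> - s) *\<^sub>R g s"
    using AE_lborel_singleton[of \<xi>]
    by eventually_elim (use assms in \<open>auto simp: truncated_kernel_def indicator_def\<close>)
qed

text \<open>As k1 may be singular at 0, no integrable majorant of its translates is at hand. By
  Scheffe's lemma pointwise convergence together with convergence of the L1 norms gives L1
  convergence of the translates, and boundedness of \<open>g\<close> carries this over to the
  convolution.\<close>

lemma truncated_convolution_continuous:
  assumes t: "t \<in> {0..T}"
  shows "continuous_on {t..T} (truncated_convolution g t)"
  unfolding continuous_on_sequentially comp_def
proof (intro allI ballI impI, elim conjE)
  fix x and \<xi> assume \<xi>: "\<xi> \<in> {t..T}" and x: "\<forall>n. x n \<in> {t..T}" "x \<longlonglongrightarrow> \<xi>"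
  let ?F = "\<lambda>n s. indicator {0..t} s * truncated_kernel (x n - s)"
  let ?f = "\<lambda>s. indicator {0..t} s * truncated_kernel (\<xi> - s)"
  have int: "integrable lborel (\<lambda>s. indicator {0..t} s * truncated_kernel (y - s))" for y
    by (rule Bochner_Integration.integrable_bound[OF truncated_kernel_reflect(1)[of y]])
      (auto simp: indicator_def)
  \<comment> \<open>For \<open>s < t\<close> all arguments \<open>x n - s\<close> and
    \<open>\<xi> - s\<close> are positive, where k1 is continuous; at \<open>s = t\<close> the
    singularity may be reached.\<close>
  have ne: "AE s in lborel. s \<noteq> t" by (rule AE_lborel_singleton)
  have pt: "AE s in lborel. (\<lambda>n. ?F n s) \<longlonglongrightarrow> ?f s"
    using ne
  proof eventually_elim
    fix s assume "s \<noteq> t"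
    show "(\<lambda>n. ?F n s) \<longlonglongrightarrow> ?f s"
    proof (cases "s \<in> {0..t}")
      case True
      with \<open>s \<noteq> t\<close> have s: "0 \<le> s" "s < t" by auto
      have "(\<lambda>n. k1 (x n - s)) \<longlonglongrightarrow> k1 (\<xi> - s)"
      proof (rule continuous_on_tendsto_compose[OF k1_continuous])
        show "(\<lambda>n. x n - s) \<longlonglongrightarrow> \<xi> - s" by (intro tendsto_intros x)
      qed (use \<xi> x s in \<open>auto intro!: always_eventually intro: less_le_trans\<close>)
      moreover have "truncated_kernel (y - s) = k1 (y - s)" if "y \<in> {t..T}" for y
        using s that by (auto simp: truncated_kernel_def)
      ultimately show ?thesis using \<xi> x True by simp
    qed simp
  qed
  \<comment> \<open>After reflection the integrand no longer moves: only the interval depends on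
    \<open>y\<close>, and \<open>truncated_kernel\<close> itself is the majorant for convergence of
    the L1 norms.\<close>
  have shift: "(LBINT s. norm (indicator {0..t} s * truncated_kernel (y - s))) =
      (LBINT u. indicator {y - t..y} u * \<bar>truncated_kernel u\<bar>)" for y
    using lborel_integral_real_affine[of "-1" "\<lambda>u. indicator {y - t..y} u * \<bar>truncated_kernel u\<bar>" y]
    by (simp, intro Bochner_Integration.integral_cong) (auto simp: indicator_def)
  have "(\<lambda>n. LBINT u. indicator {x n - t..x n} u * \<bar>truncated_kernel u\<bar>) \<longlonglongrightarrow>
      (LBINT u. indicator {\<xi> - t..\<xi>} u * \<bar>truncated_kernel u\<bar>)"
  proof (rule integral_dominated_convergence)
    show "integrable lborel (\<lambda>u. \<bar>truncated_kernel u\<bar>)" using truncated_kernel_integrable by simp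
    have "AE u in lborel. u \<noteq> \<xi> - t \<and> u \<noteq> \<xi>" by (intro AE_conjI AE_lborel_singleton)
    then show "AE u in lborel. (\<lambda>n. indicator {x n - t..x n} u * \<bar>truncated_kernel u\<bar>) \<longlonglongrightarrow>
      indicator {\<xi> - t..\<xi>} u * \<bar>truncated_kernel u\<bar>"
    proof eventually_elim
      fix u assume u: "u \<noteq> \<xi> - t \<and> u \<noteq> \<xi>"
      have xt: "(\<lambda>n. x n - t) \<longlonglongrightarrow> \<xi> - t" by (intro tendsto_intros x)
      have "eventually (\<lambda>n. (x n - t \<le> u) = (\<xi> - t \<le> u)) sequentially"
        using u order_tendstoD[OF xt, of u] by (cases "\<xi> - t < u") (auto elim: eventually_mono)
      moreover have "eventually (\<lambda>n. (u \<le> x n) = (u \<le> \<xi>)) sequentially"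
        using u order_tendstoD[OF x(2), of u] by (cases "u < \<xi>") (auto elim: eventually_mono)
      ultimately have "eventually (\<lambda>n. indicator {x n - t..x n} u * \<bar>truncated_kernel u\<bar> =
          indicator {\<xi> - t..\<xi>} u * \<bar>truncated_kernel u\<bar>) sequentially"
        by eventually_elim (simp add: indicator_def)
      then show "(\<lambda>n. indicator {x n - t..x n} u * \<bar>truncated_kernel u\<bar>) \<longlonglongrightarrow>
        indicator {\<xi> - t..\<xi>} u * \<bar>truncated_kernel u\<bar>" by (rule tendsto_eventually)
    qed
  qed (auto simp: indicator_def)
  then have "(\<lambda>n. LBINT s. norm (?F n s)) \<longlonglongrightarrow> (LBINT s. norm (?f s))" by (simp only: shift)
  then have nn: "(\<lambda>n. \<integral>\<^sup>+s. ennreal (norm (?F n s)) \<partial>lborel) \<longlonglongrightarrow> (\<integral>\<^sup>+s. ennreal (norm (?f s)) \<partial>lborel)"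
    using int by (subst (1 2) nn_integral_eq_integral) (auto intro!: tendsto_ennrealI)
  have L1: "(\<lambda>n. \<integral>\<^sup>+s. norm (?F n s - ?f s) \<partial>lborel) \<longlonglongrightarrow> 0"
    by (rule Scheffe_lemma1[OF int int pt]) (use lim_imp_Limsup[OF _ nn] in simp)
  have "(\<lambda>n. truncated_convolution g t (x n) - truncated_convolution g t \<xi>) \<longlonglongrightarrow> 0"
  proof (rule Lim_null_comparison)
    have C: "0 \<le> C" using order_trans[OF norm_ge_zero gC[of 0]] .
    have "norm (truncated_convolution g t (x n) - truncated_convolution g t \<xi>) \<le>
        C * (LBINT s. norm (?F n s - ?f s))" for n
    proof -
      have eq: "truncated_convolution g t (x n) - truncated_convolution g t \<xi> =
          (LBINT s. (?F n s - ?f s) *\<^sub>R g s)"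
        unfolding truncated_convolution_def
        by (subst Bochner_Integration.integral_diff[symmetric, OF truncated_convolution_integrable
            truncated_convolution_integrable])
          (simp add: scaleR_diff_left)
      have "norm (truncated_convolution g t (x n) - truncated_convolution g t \<xi>) \<le>
          (LBINT s. norm ((?F n s - ?f s) *\<^sub>R g s))"
        unfolding eq by (rule integral_norm_bound)
      also have "\<dots> \<le> (LBINT s. C * norm (?F n s - ?f s))"
      proof (rule integral_mono)
        show i: "integrable lborel (\<lambda>s. C * norm (?F n s - ?f s))" using int by auto
        show b: "norm ((?F n s - ?f s) *\<^sub>R g s) \<le> C * norm (?F n s - ?f s)" for s
          using mult_left_mono[OF gC[of s], of "norm (?F n s - ?f s)"] by (simp add: mult.commute)
        show "integrable lborel (\<lambda>s. norm ((?F n s - ?f s) *\<^sub>R g s))"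
          by (rule Bochner_Integration.integrable_bound[OF i]) (use b C in auto)
      qed
      finally show ?thesis by simp
    qed
    then show "\<forall>\<^sub>F n in sequentially. norm (truncated_convolution g t (x n) - truncated_convolution g t \<xi>) \<le>
        C * (LBINT s. norm (?F n s - ?f s))" by simp
    have "(\<lambda>n. LBINT s. norm (?F n s - ?f s)) \<longlonglongrightarrow> 0"
    proof -
      have "(\<integral>\<^sup>+s. norm (?F n s - ?f s) \<partial>lborel) = ennreal (LBINT s. norm (?F n s - ?f s))" for n
        using int by (intro nn_integral_eq_integral) auto
      then show ?thesis using tendsto_enn2real[of _ 0, OF L1[folded ennreal_0]] by simp
    qed
    then show "(\<lambda>n. C * (LBINT s. norm (?F n s - ?f s))) \<longlonglongrightarrow> 0" by (rule tendsto_mult_right_zero)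
  qed
  then show "(\<lambda>n. truncated_convolution g t (x n)) \<longlonglongrightarrow> truncated_convolution g t \<xi>"
    by (simp add: LIM_zero_iff)
qed

lemma lifted_drift_square_integrable:
  fixes v :: "real ^ 'd"
  shows "square_integrable (\<lambda>\<xi>. indicator {0..T} \<xi> *\<^sub>R truncated_kernel (\<xi> - s) *\<^sub>R v)"
    and "norm (l2_class (\<lambda>\<xi>. indicator {0..T} \<xi> *\<^sub>R truncated_kernel (\<xi> - s) *\<^sub>R v))
      \<le> norm (l2_class truncated_kernel) * norm v"
proof -
  let ?h = "\<lambda>\<xi>. indicator {0..T} \<xi> *\<^sub>R truncated_kernel (\<xi> - s) *\<^sub>R v"
  have i: "integrable lborel (\<lambda>\<xi>. (truncated_kernel (\<xi> - s))\<^sup>2 * (norm v)\<^sup>2)"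
    using lborel_integrable_real_affine[of "\<lambda>u. (truncated_kernel u)\<^sup>2" 1 "- s"]
        truncated_kernel_square_integrable
    by (intro integrable_mult_left) (simp add: square_integrable_def)
  have b: "(norm (?h \<xi>))\<^sup>2 \<le> (truncated_kernel (\<xi> - s))\<^sup>2 * (norm v)\<^sup>2" for \<xi>
    by (auto simp: indicator_def power_mult_distrib)
  show sq: "square_integrable ?h"
    unfolding square_integrable_def
    by (intro conjI Bochner_Integration.integrable_bound[OF i]) (use b in auto)
  have "(norm (l2_class ?h))\<^sup>2 \<le> (LBINT \<xi>. (truncated_kernel (\<xi> - s))\<^sup>2 * (norm v)\<^sup>2)"
    unfolding norm_l2_class[OF sq]
    by (rule integral_mono[OF _ i b]) (use sq in \<open>simp add: square_integrable_def\<close>)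
  also have "\<dots> = (norm (l2_class truncated_kernel) * norm v)\<^sup>2"
    using lborel_integral_real_affine[of 1 "\<lambda>u. (truncated_kernel u)\<^sup>2" "- s"]
    by (simp add: norm_l2_class[OF truncated_kernel_square_integrable] power_mult_distrib)
  finally show "norm (l2_class ?h) \<le> norm (l2_class truncated_kernel) * norm v"
    by (rule power2_le_imp_le) simp
qed

lemma truncated_convolution_measurable:
  "(\<lambda>(s, \<xi>). indicator {0..t} s *\<^sub>R indicator {0..T} \<xi> *\<^sub>R truncated_kernel (\<xi> - s) *\<^sub>R g s)
    \<in> borel_measurable (lborel \<Otimes>\<^sub>M lborel)"
  by measurable

text \<open>The norm in H of the drift at time \<open>s\<close> is at most that of the truncated
  kernel times \<open>C\<close>, by translation invariance. This uniform bound gives Bochner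
  integrability on \<open>{0..t}\<close>, after which the integral may be computed pointwise in
  \<xi>.\<close>

lemma integral_lifted_drift:
  assumes t: "t \<in> {0..T}"
  shows "integrable lborel (\<lambda>s. l2_class (\<lambda>\<xi>. indicator {0..t} s *\<^sub>R indicator {0..T} \<xi>
      *\<^sub>R truncated_kernel (\<xi> - s) *\<^sub>R g s))"
    and "square_integrable (\<lambda>\<xi>. indicator {0..T} \<xi> *\<^sub>R truncated_convolution g t \<xi>)"
    and "(LBINT s. l2_class (\<lambda>\<xi>. indicator {0..t} s *\<^sub>R indicator {0..T} \<xi> *\<^sub>R truncated_kernel (\<xi> - s)
        *\<^sub>R g s)) =
      l2_class (\<lambda>\<xi>. indicator {0..T} \<xi> *\<^sub>R truncated_convolution g t \<xi>)"
proof -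
  let ?f = "\<lambda>s \<xi>. indicator {0..t} s *\<^sub>R indicator {0..T} \<xi> *\<^sub>R truncated_kernel (\<xi> - s) *\<^sub>R g s"
  let ?K = "norm (l2_class truncated_kernel) * C"
  have sq: "square_integrable (?f s)" for s
    by (rule square_integrable_scaleR[OF lifted_drift_square_integrable(1)])
  show int: "integrable lborel (\<lambda>s. l2_class (?f s))"
  proof (rule Bochner_Integration.integrable_bound)
    show "integrable lborel (\<lambda>s. indicator {0..t} s * ?K)" using t by simp
    show "(\<lambda>s. l2_class (?f s)) \<in> borel_measurable lborel"
      by (rule borel_measurable_l2_class[OF truncated_convolution_measurable sq])
    show "AE s in lborel. norm (l2_class (?f s)) \<le> norm (indicator {0..t} s * ?K)"
    proof (rule AE_I2)
      fix s
      have "norm (l2_class (?f s)) \<le> indicator {0..t} s * (norm (l2_class truncated_kernel) * norm (g s))"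
        unfolding l2_class_scaleR[OF lifted_drift_square_integrable(1)] norm_scaleR
        using lifted_drift_square_integrable(2)[of s "g s"] by (auto simp: indicator_def)
      also have "\<dots> \<le> indicator {0..t} s * ?K"
        by (intro mult_left_mono gC) auto
      finally show "norm (l2_class (?f s)) \<le> norm (indicator {0..t} s * ?K)" by simp
    qed
  qed
  have F: "(LBINT s. ?f s \<xi>) = indicator {0..T} \<xi> *\<^sub>R truncated_convolution g t \<xi>" for \<xi>
    unfolding truncated_convolution_def by (cases "\<xi> \<in> {0..T}") (auto simp: indicator_def)
  show sqF: "square_integrable (\<lambda>\<xi>. indicator {0..T} \<xi> *\<^sub>R truncated_convolution g t \<xi>)"
  proof (rule square_integrable_bound)
    show "square_integrable (\<lambda>\<xi>. indicator {0..T} \<xi> *\<^sub>R (C * (LBINT u. \<bar>truncated_kernel u\<bar>)))"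
    proof -
      have "(norm (indicator {0..T} \<xi> *\<^sub>R (C * (LBINT u. \<bar>truncated_kernel u\<bar>))))\<^sup>2 =
          indicator {0..T} \<xi> * (C * (LBINT u. \<bar>truncated_kernel u\<bar>))\<^sup>2" for \<xi> :: real
        by (simp add: indicator_def)
      then show ?thesis using T_pos by (simp add: square_integrable_def)
    qed
    show "(\<lambda>\<xi>. indicator {0..T} \<xi> *\<^sub>R truncated_convolution g t \<xi>) \<in> borel_measurable lborel"
      unfolding truncated_convolution_def by measurable
    show "AE \<xi> in lborel. norm (indicator {0..T} \<xi> *\<^sub>R truncated_convolution g t \<xi>)
        \<le> norm (indicator {0..T} \<xi> *\<^sub>R (C * (LBINT u. \<bar>truncated_kernel u\<bar>)))"
      using order_trans[OF truncated_convolution_bound abs_ge_self, of t]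
      by (intro AE_I2) (auto simp: indicator_def)
  qed
  show "(LBINT s. l2_class (?f s)) = l2_class (\<lambda>\<xi>. indicator {0..T} \<xi> *\<^sub>R truncated_convolution g t \<xi>)"
    unfolding F[symmetric]
  proof (rule integral_l2_class[OF truncated_convolution_measurable sq int])
    show "integrable lborel (\<lambda>s. ?f s \<xi>)" for \<xi>
      using truncated_convolution_integrable[of t \<xi>] by (cases "\<xi> \<in> {0..T}") (auto simp: indicator_def)
    show "square_integrable (\<lambda>\<xi>. LBINT s. ?f s \<xi>)" unfolding F by (rule sqF)
  qed
qed

end
end

section \<open>Step approximation of the kernel\<close>

definition partition_point :: "real \<Rightarrow> nat \<Rightarrow> nat \<Rightarrow> real" where
  "partition_point t m i = t * real i / real (Suc m)"

text \<open>For fixed \<open>s\<close> this is the error of the H-valued step integrand, as a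
  function of \<xi>; for fixed \<xi> it is the error of the scalar step integrand, as a function of
  time. This double role brings both errors down to one double integral.\<close>

definition kernel_step_error :: "real \<Rightarrow> real \<Rightarrow> real \<Rightarrow> nat \<Rightarrow> real \<Rightarrow> real \<Rightarrow> real" where
  "kernel_step_error T \<alpha> t m s \<xi> = lift_kernel T \<alpha> s \<xi> -
    (\<Sum>i<Suc m. indicator {partition_point t m i<..partition_point t m (Suc i)} s * lift_kernel T \<alpha>
        (partition_point t m i) \<xi>)"

lemma partition_point_mono: "0 \<le> t \<Longrightarrow> i \<le> j \<Longrightarrow> partition_point t m i \<le> partition_point t m j"
  unfolding partition_point_def by (intro divide_right_mono mult_left_mono) auto

lemma partition_point_ends [simp]: "partition_point t m 0 = 0" "partition_point t m (Suc m) = t"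
  by (auto simp: partition_point_def)

lemma partition_point_nonneg: "0 \<le> t \<Longrightarrow> 0 \<le> partition_point t m i"
  using partition_point_mono[of t 0 i m] by simp

lemma partition_point_step: "partition_point t m (Suc i) = partition_point t m i + t / real (Suc m)"
  by (simp add: partition_point_def add_divide_distrib distrib_left del: of_nat_Suc)
      (simp add: add_divide_distrib distrib_left)

text \<open>The cells are open on the left, so time 0 lies in none of them; the later integrals over
  \<open>s\<close> discard it as a null set.\<close>

lemma partition_point_cell:
  assumes "0 < s" "s \<le> t"
  obtains i where "i < Suc m" "partition_point t m i < s" "s \<le> partition_point t m (Suc i)"
    "\<And>j. indicator {partition_point t m j<..partition_point t m (Suc j)} s = (if j = i then 1 else 0 :: real)"
proof -
  have t: "0 \<le> t" using assms by simp
  define i where "i = (LEAST i. s \<le> partition_point t m (Suc i))"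
  have m: "s \<le> partition_point t m (Suc m)" using assms by simp
  have i: "s \<le> partition_point t m (Suc i)" unfolding i_def by
      (rule LeastI[where P = "\<lambda>i. s \<le> partition_point t m (Suc i)", OF m])
  have im: "i < Suc m" unfolding i_def using Least_le[of "\<lambda>i. s \<le> partition_point t m (Suc i)", OF m] by simp
  have lo: "partition_point t m i < s"
  proof (cases i)
    case 0
    then show ?thesis using assms by simp
  next
    case (Suc k)
    then have "\<not> s \<le> partition_point t m (Suc k)"
      using not_less_Least[of k "\<lambda>i. s \<le> partition_point t m (Suc i)"] by (simp add: i_def)
    then show ?thesis using Suc by simp
  qed
  have "indicator {partition_point t m j<..partition_point t m (Suc j)} s =
      (if j = i then 1 else 0 :: real)" for j
  proof -
    consider "j < i" | "j = i" | "i < j" by linarith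
    then show ?thesis
    proof cases
      case 1
      then have "partition_point t m (Suc j) \<le> partition_point t m i" by (intro partition_point_mono t) simp
      then show ?thesis using 1 lo by simp
    next
      case 3
      then have "partition_point t m (Suc i) \<le> partition_point t m j" by (intro partition_point_mono t) simp
      then show ?thesis using 3 i by simp
    qed (use lo i in simp)
  qed
  with that im lo i show ?thesis by blast
qed

lemma borel_measurable_kernel_step_error [measurable]:
  "(\<lambda>p. kernel_step_error T \<alpha> t m (fst p) (snd p)) \<in> borel_measurable (borel \<Otimes>\<^sub>M borel)"
  unfolding kernel_step_error_def by measurable

lemma square_integrable_kernel_step_error:
  assumes "1 / 2 < \<alpha>" "0 \<le> t" "0 \<le> s"
  shows "square_integrable (kernel_step_error T \<alpha> t m s)"
  unfolding kernel_step_error_def[abs_def]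
proof (rule square_integrable_diff[OF square_integrable_lift_kernel[OF assms(1,3)] l2_class_sum(2)])
  show "square_integrable (\<lambda>\<xi>. indicator {partition_point t m i<..partition_point t m (Suc i)} s
      * lift_kernel T \<alpha> (partition_point t m i) \<xi>)" for i
    using square_integrable_scaleR[OF square_integrable_lift_kernel[OF assms(1)
        partition_point_nonneg[OF assms(2)]]]
    by simp
qed simp

lemma kernel_step_error_bound:
  assumes \<alpha>: "1 / 2 < \<alpha>" "\<alpha> < 1" and s: "0 < s" "s \<le> t" "t \<le> T"
  shows "(LBINT \<xi>. (kernel_step_error T \<alpha> t m s \<xi>)\<^sup>2) \<le> 2 * kernel_energy \<alpha> (t / real (Suc m))"
proof -
  obtain i where i: "i < Suc m" "partition_point t m i < s" "s \<le> partition_point t m (Suc i)"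
    and ind: "\<And>j. indicator {partition_point t m j<..partition_point t m (Suc j)} s =
        (if j = i then 1 else 0 :: real)"
    using partition_point_cell[OF s(1,2)] by blast
  have "(\<Sum>j<Suc m. indicator {partition_point t m j<..partition_point t m (Suc j)} s * lift_kernel T \<alpha>
      (partition_point t m j) \<xi>)
      = lift_kernel T \<alpha> (partition_point t m i) \<xi>" for \<xi>
  proof -
    have "(\<Sum>j<Suc m. indicator {partition_point t m j<..partition_point t m (Suc j)} s * lift_kernel T \<alpha>
        (partition_point t m j) \<xi>)
      = (\<Sum>j<Suc m. if j = i then lift_kernel T \<alpha> (partition_point t m j) \<xi> else 0)"
      by (intro sum.cong refl) (simp only: ind, simp)
    also have "\<dots> = lift_kernel T \<alpha> (partition_point t m i) \<xi>"
      using i(1) by (subst sum.delta) auto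
    finally show ?thesis .
  qed
  then have "(LBINT \<xi>. (kernel_step_error T \<alpha> t m s \<xi>)\<^sup>2) =
      (LBINT \<xi>. (lift_kernel T \<alpha> s \<xi> - lift_kernel T \<alpha> (partition_point t m i) \<xi>)\<^sup>2)"
    by (simp only: kernel_step_error_def)
  also have "\<dots> \<le> 2 * kernel_energy \<alpha> (s - partition_point t m i)"
    using lift_kernel_translate[OF \<alpha>, of "partition_point t m i" s T] partition_point_nonneg[of t m i] i s
    by simp
  also have "\<dots> \<le> 2 * kernel_energy \<alpha> (t / real (Suc m))"
    using kernel_energy_mono[OF \<alpha>(1), of "s - partition_point t m i" "t / real (Suc m)"] i(3)
    unfolding partition_point_step by simp
  finally show ?thesis .
qed

lemma nn_integral_kernel_step_error:
  assumes \<alpha>: "1 / 2 < \<alpha>" "\<alpha> < 1" and t: "0 \<le> t" "t \<le> T"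
  shows "(\<integral>\<^sup>+s. ennreal (LBINT \<xi>. (kernel_step_error T \<alpha> t m s \<xi>)\<^sup>2) \<partial>restrict_space lborel {0..t})
    \<le> ennreal (2 * kernel_energy \<alpha> (t / real (Suc m)) * t)"
proof -
  let ?K = "2 * kernel_energy \<alpha> (t / real (Suc m))"
  have "(\<integral>\<^sup>+s. ennreal (LBINT \<xi>. (kernel_step_error T \<alpha> t m s \<xi>)\<^sup>2) \<partial>restrict_space lborel {0..t})
      = (\<integral>\<^sup>+s. ennreal (LBINT \<xi>. (kernel_step_error T \<alpha> t m s \<xi>)\<^sup>2) * indicator {0..t} s \<partial>lborel)"
    by (rule nn_integral_restrict_space) simp
  also have "\<dots> \<le> (\<integral>\<^sup>+s. ennreal ?K * indicator {0..t} s \<partial>lborel)"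
  proof (rule nn_integral_mono_AE)
    show "AE s in lborel. ennreal (LBINT \<xi>. (kernel_step_error T \<alpha> t m s \<xi>)\<^sup>2) * indicator {0..t} s
        \<le> ennreal ?K * indicator {0..t} s"
      using AE_lborel_singleton[of 0]
    proof eventually_elim
      fix s :: real assume "s \<noteq> 0"
      then show "ennreal (LBINT \<xi>. (kernel_step_error T \<alpha> t m s \<xi>)\<^sup>2) * indicator {0..t} s
        \<le> ennreal ?K * indicator {0..t} s"
        using kernel_step_error_bound[OF \<alpha>, of s t T m] t
        by (cases "s \<in> {0..t}") (auto intro!: ennreal_leI)
    qed
  qed
  also have "\<dots> = ennreal (?K * t)"
    using t by (simp add: nn_integral_cmult ennreal_mult'' kernel_energy_def)
  finally show ?thesis .
qed

text \<open>The constant \<open>c\<close> is the dimension for the error of the integrand and four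
  times the dimension for the error of the integral.\<close>

lemma kernel_step_bound_tendsto_0:
  assumes \<alpha>: "1 / 2 < \<alpha>" and t: "0 \<le> t"
  shows "(\<lambda>m. ennreal (c * (2 * kernel_energy \<alpha> (t / real (Suc m)) * t))) \<longlonglongrightarrow> 0"
proof -
  have "(\<lambda>m. kernel_energy \<alpha> (t / real (Suc m))) \<longlonglongrightarrow> 0"
  proof (rule kernel_energy_tendsto_0[OF \<alpha>])
    show "(\<lambda>m. t / real (Suc m)) \<longlonglongrightarrow> 0"
      using tendsto_mult_right_zero[OF LIMSEQ_inverse_real_of_nat, of t] by (simp add: divide_inverse)
    show "t / real (Suc m) \<le> t" for m using t by (simp add: divide_le_eq mult_left_le_one_le field_simps)
  qed
  then have "(\<lambda>m. c * (2 * kernel_energy \<alpha> (t / real (Suc m)) * t)) \<longlonglongrightarrow> c * (2 * 0 * t)"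
    by (intro tendsto_intros)
  then show ?thesis using tendsto_ennrealI by fastforce
qed

lemma hilbert_schmidt_norm_scaleR_id:
  "(hilbert_schmidt_norm (c *\<^sub>R (id_blinfun :: 'a::euclidean_space \<Rightarrow>\<^sub>L 'a)))\<^sup>2 = real DIM('a) * c\<^sup>2"
  by (simp add: hilbert_schmidt_norm_sq blinfun.scaleR_left power_mult_distrib)

lemma square_integrable_bounded_support:
  fixes f :: "real \<Rightarrow> 'a::euclidean_space"
  assumes "(\<lambda>\<xi>. indicator {0..T} \<xi> *\<^sub>R f \<xi>) \<in> borel_measurable lborel" "\<And>\<xi>. \<xi> \<in> {0..T} \<Longrightarrow> norm (f \<xi>) \<le> C"
  shows "square_integrable_on T f"
  unfolding square_integrable_on_def
proof (rule square_integrable_bound[OF _ assms(1)])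
  have "(norm (indicator {0..T} \<xi> *\<^sub>R C))\<^sup>2 = indicator {0..T} \<xi> * C\<^sup>2" for \<xi> :: real
    by (simp add: indicator_def)
  then show "square_integrable (\<lambda>\<xi>. indicator {0..T} \<xi> *\<^sub>R C)"
    by (cases "0 \<le> T") (simp_all add: square_integrable_def)
  show "AE \<xi> in lborel. norm (indicator {0..T} \<xi> *\<^sub>R f \<xi>) \<le> norm (indicator {0..T} \<xi> *\<^sub>R C)"
    using order_trans[OF assms(2) abs_ge_self] by (intro AE_I2) (auto simp: indicator_def)
qed

section \<open>The lift\<close>

locale volterra_lift = brownian_motion M F T W + volterra_coefficients T \<alpha> k1 b
  for M :: "'w measure" and F :: "real \<Rightarrow> 'w measure" and T \<alpha> :: real
    and W :: "real \<Rightarrow> 'w \<Rightarrow> real ^ 'd" and k1 :: "real \<Rightarrow> real" and b :: "real \<Rightarrow> real ^ 'd \<Rightarrow> real ^ 'd" +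
  fixes x0 :: "real ^ 'd" and X :: "real \<Rightarrow> 'w \<Rightarrow> real ^ 'd" and J :: "real \<Rightarrow> real \<Rightarrow> 'w \<Rightarrow> real ^ 'd"
  assumes solution: "volterra_solution M F T W \<alpha> k1 b x0 X"
    and kernel_integral: "continuous_kernel_integral M F T W \<alpha> J"
begin

section \<open>Measurability and continuity of the drift, the forward process and the lift\<close>

abbreviation \<theta> :: "real \<Rightarrow> real \<Rightarrow> 'w \<Rightarrow> real ^ 'd" where
  "\<theta> \<equiv> forward_process k1 b x0 X J"

abbreviation w :: "real \<Rightarrow> 'w \<Rightarrow> real \<Rightarrow> real ^ 'd" where
  "w \<equiv> lifted_process X \<theta>"

text \<open>Extension by zero makes each path a bounded Borel function on the whole line, as the
  results on truncated convolutions require.\<close>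

definition drift :: "'w \<Rightarrow> real \<Rightarrow> real ^ 'd" where
  "drift \<omega> s = indicator {0..T} s *\<^sub>R b s (X s \<omega>)"

lemma X_continuous: "\<omega> \<in> space M \<Longrightarrow> continuous_on {0..T} (\<lambda>t. X t \<omega>)"
  using solution by (simp add: volterra_solution_def)

lemma X_adapted: "s \<in> {0..t} \<Longrightarrow> t \<le> T \<Longrightarrow> X s \<in> borel_measurable (F t)"
  by (rule F_measurable_mono[of s]) (use solution in \<open>auto simp: volterra_solution_def\<close>)

lemma X_bounded: "\<omega> \<in> space M \<Longrightarrow> \<exists>B. \<forall>s\<in>{0..T}. norm (X s \<omega>) \<le> B"
  using compact_imp_bounded[OF compact_continuous_image[OF X_continuous compact_Icc]]
  by (auto simp: bounded_iff)

text \<open>Progressive measurability: restricting time to \<open>{0..t}\<close> keeps the joint map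
  measurable with respect to \<open>F t\<close> instead of merely \<open>M\<close>. Adaptedness of
  the lift rests on it.\<close>

lemma X_pair_measurable:
  assumes "t \<in> {0..T}"
  shows "(\<lambda>(\<omega>, s). indicator {0..t} s *\<^sub>R X s \<omega>) \<in> borel_measurable (F t \<Otimes>\<^sub>M borel)"
  using assms by (intro borel_measurable_pair_continuous X_adapted)
    (auto simp: space_F intro: continuous_on_subset[OF X_continuous])

lemma drift_pair_measurable:
  assumes t: "t \<in> {0..T}"
  shows "(\<lambda>(\<omega>, s). indicator {0..t} s *\<^sub>R drift \<omega> s) \<in> borel_measurable (F t \<Otimes>\<^sub>M borel)"
proof -
  \<comment> \<open>The coefficient \<open>b\<close> is measurable only for times in
    \<open>{0..T}\<close>, so time is moved into that interval before \<open>b\<close> is applied;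
    the outer indicator removes the times at which this changes anything.\<close>
  let ?p = "\<lambda>s::real. max 0 (min T s)"
  have p: "?p \<in> measurable borel (restrict_space borel {0..T})"
    using T_pos by (intro measurable_restrict_space2) auto
  note X_pair_measurable[OF t, measurable]
  have "(\<lambda>q. (?p (snd q), indicator {0..t} (snd q) *\<^sub>R X (snd q) (fst q)))
      \<in> measurable (F t \<Otimes>\<^sub>M borel) (restrict_space borel {0..T} \<Otimes>\<^sub>M borel)"
    using X_pair_measurable[OF t]
    by (intro measurable_Pair measurable_compose[OF measurable_snd p]) (simp add: case_prod_beta')
  from measurable_compose[OF this b_measurable]
  have "(\<lambda>q. b (?p (snd q)) (indicator {0..t} (snd q) *\<^sub>R X (snd q) (fst q))) \<in> borel_measurable
      (F t \<Otimes>\<^sub>M borel)"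
    by simp
  then have "(\<lambda>q. indicator {0..t} (snd q) *\<^sub>R b (?p (snd q))
      (indicator {0..t} (snd q) *\<^sub>R X (snd q) (fst q)))
      \<in> borel_measurable (F t \<Otimes>\<^sub>M borel)"
    by measurable
  moreover have "indicator {0..t} s *\<^sub>R b (?p s) (indicator {0..t} s *\<^sub>R X s \<omega>) = indicator {0..t} s
      *\<^sub>R drift \<omega> s" for s \<omega>
    using t by (cases "s \<in> {0..t}") (auto simp: drift_def)
  ultimately show ?thesis by (simp add: case_prod_beta')
qed

lemma drift_measurable: "\<omega> \<in> space M \<Longrightarrow> drift \<omega> \<in> borel_measurable borel"
proof -
  assume \<omega>: "\<omega> \<in> space M"
  have T: "T \<in> {0..T}" using T_pos by simp
  have "(\<lambda>s. indicator {0..T} s *\<^sub>R drift \<omega> s) \<in> borel_measurable borel"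
    using measurable_compose[OF measurable_Pair1' drift_pair_measurable[OF T]] \<omega> space_F[OF T] by simp
  moreover have "indicator {0..T} s *\<^sub>R drift \<omega> s = drift \<omega> s" for s by (simp add: drift_def indicator_def)
  ultimately show ?thesis by simp
qed

lemma drift_bounded: "\<omega> \<in> space M \<Longrightarrow> \<exists>C. \<forall>s. norm (drift \<omega> s) \<le> C"
proof -
  assume \<omega>: "\<omega> \<in> space M"
  obtain B where B: "\<And>s. s \<in> {0..T} \<Longrightarrow> norm (X s \<omega>) \<le> B" using X_bounded[OF \<omega>] by blast
  obtain L where L: "L > 0" "\<And>s x. s \<in> {0..T} \<Longrightarrow> norm (b s x) \<le> L * (1 + norm x)"
    using b_linear_growth_Lipschitz by blast
  have "norm (drift \<omega> s) \<le> L * (1 + \<bar>B\<bar>)" for s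
  proof (cases "s \<in> {0..T}")
    case True
    have "norm (b s (X s \<omega>)) \<le> L * (1 + norm (X s \<omega>))" by (rule L(2)[OF True])
    also have "\<dots> \<le> L * (1 + \<bar>B\<bar>)" using L(1) B[OF True] by (intro mult_left_mono) auto
    finally show ?thesis using True by (simp add: drift_def)
  qed (use L in \<open>simp add: drift_def\<close>)
  then show ?thesis by blast
qed

abbreviation drift_convolution :: "real \<Rightarrow> 'w \<Rightarrow> real \<Rightarrow> real ^ 'd" where
  "drift_convolution t \<omega> \<xi> \<equiv> truncated_convolution (drift \<omega>) t \<xi>"

lemma drift_convolution_pair_measurable:
  assumes t: "t \<in> {0..T}"
  shows "(\<lambda>(\<omega>, \<xi>). drift_convolution t \<omega> \<xi>) \<in> borel_measurable (F t \<Otimes>\<^sub>M borel)"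
proof -
  have d: "(\<lambda>p. indicator {0..t} (snd p) *\<^sub>R drift (fst (fst p)) (snd p)) \<in> borel_measurable
      ((F t \<Otimes>\<^sub>M (borel :: real measure)) \<Otimes>\<^sub>M lborel)"
  proof -
    have "(\<lambda>p. (fst (fst p), snd p)) \<in> measurable ((F t \<Otimes>\<^sub>M (borel :: real measure)) \<Otimes>\<^sub>M lborel)
        (F t \<Otimes>\<^sub>M borel)"
      by measurable
    from measurable_compose[OF this drift_pair_measurable[OF t]] show ?thesis by simp
  qed
  have "(\<lambda>p. truncated_kernel (snd (fst p) - snd p) *\<^sub>R
      (indicator {0..t} (snd p) *\<^sub>R drift (fst (fst p)) (snd p)))
      \<in> borel_measurable ((F t \<Otimes>\<^sub>M borel) \<Otimes>\<^sub>M lborel)"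
    by (rule borel_measurable_scaleR[OF _ d]) measurable
  then have "(\<lambda>q. LBINT s. truncated_kernel (snd q - s) *\<^sub>R (indicator {0..t} s *\<^sub>R drift (fst q) s))
      \<in> borel_measurable (F t \<Otimes>\<^sub>M borel)"
    by (intro lborel.borel_measurable_lebesgue_integral) (simp add: case_prod_beta')
  then show ?thesis by (simp add: truncated_convolution_def case_prod_beta' mult.commute)
qed

lemma drift_integral_eq:
  assumes "\<omega> \<in> space M" "t \<in> {0..T}" "\<xi> \<in> {0..T}"
  shows "(LINT s:{0..min t \<xi>}|lborel. k1 (\<xi> - s) *\<^sub>R b s (X s \<omega>)) = drift_convolution t \<omega> \<xi>"
proof -
  obtain C where "\<And>s. norm (drift \<omega> s) \<le> C" using drift_bounded[OF assms(1)] by blast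
  from truncated_convolution_eq[OF drift_measurable[OF assms(1)] this assms(2,3)]
  have "drift_convolution t \<omega> \<xi> = (LINT s:{0..min t \<xi>}|lborel. k1 (\<xi> - s) *\<^sub>R drift \<omega> s)" ..
  also have "\<dots> = (LINT s:{0..min t \<xi>}|lborel. k1 (\<xi> - s) *\<^sub>R b s (X s \<omega>))"
    by (rule set_lebesgue_integral_cong) (use assms in \<open>auto simp: drift_def\<close>)
  finally show ?thesis ..
qed

lemma \<theta>_eq:
  assumes "\<omega> \<in> space M" "t \<in> {0..T}" "\<xi> \<in> {t..T}"
  shows "\<theta> t \<xi> \<omega> = x0 + drift_convolution t \<omega> \<xi> + J t \<xi> \<omega>"
  using drift_integral_eq[of \<omega> t \<xi>] assms by (simp add: forward_process_def min_def)

lemma \<theta>_continuous: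
  assumes \<omega>: "\<omega> \<in> space M" and t: "t \<in> {0..T}"
  shows "continuous_on {t..T} (\<lambda>\<xi>. \<theta> t \<xi> \<omega>)"
proof -
  obtain C where "\<And>s. norm (drift \<omega> s) \<le> C" using drift_bounded[OF \<omega>] by blast
  from truncated_convolution_continuous[OF drift_measurable[OF \<omega>] this t]
  have "continuous_on {t..T} (\<lambda>\<xi>. x0 + drift_convolution t \<omega> \<xi> + J t \<xi> \<omega>)"
    using kernel_integral \<omega> t by (intro continuous_intros) (auto simp: continuous_kernel_integral_def)
  then show ?thesis by (rule continuous_on_cong[THEN iffD1, rotated 2]) (auto simp: \<theta>_eq[OF \<omega> t])
qed

lemma J_integral:
  "t \<in> {0..T} \<Longrightarrow> \<xi> \<in> {t..T} \<Longrightarrow> has_ito_integral M F W t (\<lambda>s \<omega>. fractional_kernel \<alpha> (\<xi> - s) *\<^sub>R id_blinfun)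
      (J t \<xi>)"
  using kernel_integral by (auto simp: continuous_kernel_integral_def)

lemma \<theta>_adapted:
  assumes t: "t \<in> {0..T}" and \<xi>: "\<xi> \<in> {t..T}"
  shows "\<theta> t \<xi> \<in> borel_measurable (F t)"
proof -
  have [measurable]: "(\<lambda>\<omega>. drift_convolution t \<omega> \<xi>) \<in> borel_measurable (F t)"
    using measurable_compose[OF measurable_Pair2' drift_convolution_pair_measurable[OF t]] by simp
  have [measurable]: "J t \<xi> \<in> borel_measurable (F t)"
    by (rule has_ito_integral_adapted[OF t J_integral[OF t \<xi>]])
  have "(\<lambda>\<omega>. x0 + drift_convolution t \<omega> \<xi> + J t \<xi> \<omega>) \<in> borel_measurable (F t)" by measurable
  then show ?thesis
    by (rule measurable_cong[THEN iffD1, rotated]) (simp add: \<theta>_eq[OF _ t \<xi>] space_F[OF t])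
qed

lemma w_pair_measurable:
  assumes t: "t \<in> {0..T}"
  shows "(\<lambda>(\<omega>, \<xi>). indicator {0..T} \<xi> *\<^sub>R w t \<omega> \<xi>) \<in> borel_measurable (F t \<Otimes>\<^sub>M lborel)"
proof -
  have th: "(\<lambda>(\<omega>, \<xi>). indicator {t..T} \<xi> *\<^sub>R \<theta> t \<xi> \<omega>) \<in> borel_measurable (F t \<Otimes>\<^sub>M borel)"
    using \<theta>_adapted[OF t] \<theta>_continuous[OF _ t] space_F[OF t]
    by (intro borel_measurable_pair_continuous) auto
  \<comment> \<open>The indicators of \<open>{0..t}\<close> and \<open>{t..T}\<close> overlap at t;
    the additional factor leaves there the value of \<open>X\<close>, as in
    \<open>lifted_process\<close>.\<close>
  have "(\<lambda>(\<omega>, \<xi>). indicator {0..t} \<xi> *\<^sub>R X \<xi> \<omega> + indicator {t<..} \<xi> *\<^sub>R (indicator {t..T} \<xi> *\<^sub>R \<theta> t \<xi> \<omega>))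
      \<in> borel_measurable (F t \<Otimes>\<^sub>M borel)"
    using X_pair_measurable[OF t] th unfolding case_prod_beta'
    by (intro borel_measurable_add borel_measurable_scaleR[of "\<lambda>q. indicator {t<..} (snd q)"]) auto
  moreover have "indicator {0..t} \<xi> *\<^sub>R X \<xi> \<omega> + indicator {t<..} \<xi> *\<^sub>R (indicator {t..T} \<xi> *\<^sub>R \<theta> t \<xi> \<omega>) =
      indicator {0..T} \<xi> *\<^sub>R w t \<omega> \<xi>" for \<omega> \<xi>
    using t by (auto simp: lifted_process_def indicator_def)
  moreover have "borel_measurable (F t \<Otimes>\<^sub>M (lborel :: real measure)) =
      (borel_measurable (F t \<Otimes>\<^sub>M borel) :: (_ \<Rightarrow> real ^ 'd) set)"
    by (intro measurable_cong_sets sets_pair_measure_cong) auto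
  ultimately show ?thesis by simp
qed

lemma w_square_integrable:
  assumes t: "t \<in> {0..T}" and \<omega>: "\<omega> \<in> space M"
  shows "square_integrable_on T (w t \<omega>)"
proof -
  obtain B where B: "\<And>s. s \<in> {0..T} \<Longrightarrow> norm (X s \<omega>) \<le> B" using X_bounded[OF \<omega>] by blast
  obtain D where D: "\<And>\<xi>. \<xi> \<in> {t..T} \<Longrightarrow> norm (\<theta> t \<xi> \<omega>) \<le> D"
    using compact_imp_bounded[OF compact_continuous_image[OF \<theta>_continuous[OF \<omega> t] compact_Icc]]
    unfolding bounded_iff by blast
  show ?thesis
  proof (rule square_integrable_bounded_support)
    show "(\<lambda>\<xi>. indicator {0..T} \<xi> *\<^sub>R w t \<omega> \<xi>) \<in> borel_measurable lborel"
      using measurable_compose[OF measurable_Pair1' w_pair_measurable[OF t]] \<omega> space_F[OF t] by simp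
    show "norm (w t \<omega> \<xi>) \<le> max B D" if "\<xi> \<in> {0..T}" for \<xi>
      using B[of \<xi>] D[of \<xi>] that t by (auto simp: lifted_process_def)
  qed
qed

lemma w_continuous:
  assumes t: "t \<in> {0..T}"
  shows "AE \<omega> in M. continuous_on {0..T} (w t \<omega>)"
proof -
  obtain I where I: "has_ito_integral M F W t (\<lambda>s \<omega>. fractional_kernel \<alpha> (t - s) *\<^sub>R id_blinfun) I"
    "AE \<omega> in M. X t \<omega> = x0 + (LINT s:{0..t}|lborel. k1 (t - s) *\<^sub>R b s (X s \<omega>)) + I \<omega>"
    using solution t unfolding volterra_solution_def by blast
  have "AE \<omega> in M. I \<omega> = J t t \<omega>"
    by (rule has_ito_integral_unique[OF t I(1) J_integral]) (use t in auto)
  with I(2) AE_space show ?thesis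
  proof eventually_elim
    fix \<omega> assume X: "X t \<omega> = x0 + (LINT s:{0..t}|lborel. k1 (t - s) *\<^sub>R b s (X s \<omega>)) + I \<omega>"
      and IJ: "I \<omega> = J t t \<omega>" and \<omega>: "\<omega> \<in> space M"
    have "continuous_on ({0..t} \<union> {t..T}) (\<lambda>\<xi>. if \<xi> \<le> t then X \<xi> \<omega> else \<theta> t \<xi> \<omega>)"
    proof (rule continuous_on_If)
      show "continuous_on {0..t} (\<lambda>\<xi>. X \<xi> \<omega>)"
        using t by (intro continuous_on_subset[OF X_continuous[OF \<omega>]]) auto
      show "continuous_on {t..T} (\<lambda>\<xi>. \<theta> t \<xi> \<omega>)" by (rule \<theta>_continuous[OF \<omega> t])
      show "X \<xi> \<omega> = \<theta> t \<xi> \<omega>" if "\<xi> \<in> {0..t}" "\<not> \<xi> \<le> t" for \<xi> using that by simp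
      show "X \<xi> \<omega> = \<theta> t \<xi> \<omega>" if "\<xi> \<in> {t..T}" "\<xi> \<le> t" for \<xi>
        using that X IJ by (simp add: forward_process_def)
    qed auto
    moreover have "{0..t} \<union> {t..T} = {0..T}" using t by auto
    ultimately show "continuous_on {0..T} (w t \<omega>)" by (simp add: lifted_process_def[abs_def])
  qed
qed

lemma w_adapted:
  assumes t: "t \<in> {0..T}"
  shows "(\<lambda>\<omega>. hclass T (w t \<omega>)) \<in> borel_measurable (F t)"
  unfolding hclass_def
  using w_square_integrable[OF t] space_F[OF t]
  by (intro borel_measurable_l2_class[OF w_pair_measurable[OF t]]) (simp add: square_integrable_on_def)

section \<open>The drift of the lift as a Bochner integral\<close>

lemma B_lift_eq:
  assumes t: "t \<in> {0..T}"
  shows "indicator {0..t} s *\<^sub>R B_lift T k1 b s (w s \<omega>) =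
    l2_class (\<lambda>\<xi>. indicator {0..t} s *\<^sub>R indicator {0..T} \<xi> *\<^sub>R truncated_kernel (\<xi> - s) *\<^sub>R drift \<omega> s)"
proof (cases "s \<in> {0..t}")
  case True
  \<comment> \<open>The value \<open>w s \<omega> s\<close> falls in the first branch of
    \<open>lifted_process\<close> and equals \<open>X s \<omega>\<close>. Hence \<open>B\<close>
    along the lift depends on the path of \<open>X\<close> alone and is explicit, although the
    equation for \<open>w\<close> looks implicit.\<close>
  have "indicator {0..T} \<xi> *\<^sub>R (k1 (\<xi> - s) * indicator {s<..} \<xi>) *\<^sub>R b s (w s \<omega> s) =
      indicator {0..T} \<xi> *\<^sub>R truncated_kernel (\<xi> - s) *\<^sub>R drift \<omega> s" for \<xi>
    using True t by (auto simp: lifted_process_def truncated_kernel_def drift_def indicator_def)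
  then show ?thesis using True by (simp add: B_lift_def hclass_def)
qed (simp add: l2_class_0)

lemma B_lift_integral:
  assumes t: "t \<in> {0..T}" and \<omega>: "\<omega> \<in> space M"
  shows "set_integrable lborel {0..t} (\<lambda>s. B_lift T k1 b s (w s \<omega>))"
    and "square_integrable (\<lambda>\<xi>. indicator {0..T} \<xi> *\<^sub>R drift_convolution t \<omega> \<xi>)"
    and "(LINT s:{0..t}|lborel. B_lift T k1 b s (w s \<omega>)) =
      l2_class (\<lambda>\<xi>. indicator {0..T} \<xi> *\<^sub>R drift_convolution t \<omega> \<xi>)"
proof -
  obtain C where C: "\<And>s. norm (drift \<omega> s) \<le> C" using drift_bounded[OF \<omega>] by blast
  note i = integral_lifted_drift[OF drift_measurable[OF \<omega>] C t]
  show "set_integrable lborel {0..t} (\<lambda>s. B_lift T k1 b s (w s \<omega>))"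
    unfolding set_integrable_def B_lift_eq[OF t] by (rule i(1))
  show "square_integrable (\<lambda>\<xi>. indicator {0..T} \<xi> *\<^sub>R drift_convolution t \<omega> \<xi>)" by (rule i(2))
  show "(LINT s:{0..t}|lborel. B_lift T k1 b s (w s \<omega>)) =
      l2_class (\<lambda>\<xi>. indicator {0..T} \<xi> *\<^sub>R drift_convolution t \<omega> \<xi>)"
    unfolding set_lebesgue_integral_def B_lift_eq[OF t] by (rule i(3))
qed


section \<open>The integral at a fixed point and the step integrands of \<sigma>\<close>

lemma nn_integral_deterministic:
  assumes [measurable]: "f \<in> borel_measurable borel"
  shows "(\<integral>\<^sup>+(s, \<omega>). f s \<partial>(restrict_space lborel {0..t} \<Otimes>\<^sub>M M)) = (\<integral>\<^sup>+s. f s \<partial>restrict_space lborel {0..t})"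
proof -
  have "f \<in> borel_measurable (restrict_space lborel {0..t})" by (rule measurable_restrict_space1) simp
  from measurable_compose[OF measurable_fst this]
  have "(\<lambda>p. f (fst p)) \<in> borel_measurable (restrict_space lborel {0..t} \<Otimes>\<^sub>M M)" .
  then have "(\<integral>\<^sup>+(s, \<omega>). f s \<partial>(restrict_space lborel {0..t} \<Otimes>\<^sub>M M)) =
      (\<integral>\<^sup>+s. \<integral>\<^sup>+\<omega>. f s \<partial>M \<partial>restrict_space lborel {0..t})"
    by (subst nn_integral_fst[symmetric]) (auto simp: case_prod_beta')
  then show ?thesis by (simp add: emeasure_space_1)
qed

text \<open>For \<xi> up to t the kernel switches the integrand off at \<xi>, so the integral over
  \<open>{0..\<xi>}\<close> in the equation for \<open>X\<close> extends to \<open>{0..t}\<close>;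
  beyond t the version \<open>J t \<xi>\<close> applies directly. The exceptional null set may
  depend on \<xi>.\<close>

lemma pointwise_ito_integral:
  assumes t: "t \<in> {0..T}" and \<xi>: "\<xi> \<in> {0..T}"
  shows "\<exists>I. has_ito_integral M F W t (\<lambda>s \<omega>. (indicator {0..t} s * lift_kernel T \<alpha> s \<xi>) *\<^sub>R id_blinfun) I \<and>
    (AE \<omega> in M. w t \<omega> \<xi> - x0 - drift_convolution t \<omega> \<xi> = I \<omega>)"
proof (cases "\<xi> \<le> t")
  case True
  obtain I where I: "has_ito_integral M F W \<xi> (\<lambda>s \<omega>. fractional_kernel \<alpha> (\<xi> - s) *\<^sub>R id_blinfun) I"
    "AE \<omega> in M. X \<xi> \<omega> = x0 + (LINT s:{0..\<xi>}|lborel. k1 (\<xi> - s) *\<^sub>R b s (X s \<omega>)) + I \<omega>"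
    using solution \<xi> unfolding volterra_solution_def by blast
  have "(\<lambda>s (\<omega>::'w). indicator {0..\<xi>} s *\<^sub>R fractional_kernel \<alpha> (\<xi> - s) *\<^sub>R
      (id_blinfun :: (real ^ 'd) \<Rightarrow>\<^sub>L (real ^ 'd))) =
      (\<lambda>s \<omega>. (indicator {0..t} s * lift_kernel T \<alpha> s \<xi>) *\<^sub>R id_blinfun)"
    \<comment> \<open>At \<open>s = \<xi>\<close> both integrands are zero: the strict indicator
      vanishes on one side, and \<open>0 powr (\<alpha> - 1) = 0\<close> on the other.\<close>
    using True \<xi> by (intro ext) (auto simp: lift_kernel_def indicator_def fractional_kernel_def)
  then have "has_ito_integral M F W t (\<lambda>s \<omega>. (indicator {0..t} s * lift_kernel T \<alpha> s \<xi>) *\<^sub>R id_blinfun) I"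
    using has_ito_integral_extend[OF True _ I(1)] t by simp
  moreover have "AE \<omega> in M. w t \<omega> \<xi> - x0 - drift_convolution t \<omega> \<xi> = I \<omega>"
    using I(2) AE_space
  proof eventually_elim
    fix \<omega> assume "X \<xi> \<omega> = x0 + (LINT s:{0..\<xi>}|lborel. k1 (\<xi> - s) *\<^sub>R b s (X s \<omega>)) + I \<omega>" "\<omega> \<in> space M"
    then show "w t \<omega> \<xi> - x0 - drift_convolution t \<omega> \<xi> = I \<omega>"
      using drift_integral_eq[of \<omega> t \<xi>] t \<xi> True by (simp add: lifted_process_def min_absorb2)
  qed
  ultimately show ?thesis by blast
next
  case False
  then have \<xi>': "\<xi> \<in> {t..T}" using \<xi> by auto
  have "(\<lambda>s (\<omega>::'w). indicator {0..t} s *\<^sub>R fractional_kernel \<alpha> (\<xi> - s) *\<^sub>R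
      (id_blinfun :: (real ^ 'd) \<Rightarrow>\<^sub>L (real ^ 'd))) =
      (\<lambda>s \<omega>. (indicator {0..t} s * lift_kernel T \<alpha> s \<xi>) *\<^sub>R id_blinfun)"
    using False \<xi> by (intro ext) (auto simp: lift_kernel_def indicator_def)
  then have "has_ito_integral M F W t (\<lambda>s \<omega>. (indicator {0..t} s * lift_kernel T \<alpha> s \<xi>) *\<^sub>R id_blinfun)
      (J t \<xi>)"
    using has_ito_integral_extend[OF order_refl _ J_integral[OF t \<xi>']] t by simp
  moreover have "AE \<omega> in M. w t \<omega> \<xi> - x0 - drift_convolution t \<omega> \<xi> = J t \<xi> \<omega>"
    using \<theta>_eq[OF _ t \<xi>'] False by (intro AE_I2) (simp add: lifted_process_def)
  ultimately show ?thesis by blast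
qed

abbreviation sigma_step :: "real \<Rightarrow> nat \<Rightarrow> nat \<Rightarrow> 'w \<Rightarrow> ((real ^ 'd) \<Rightarrow>\<^sub>L (real ^ 'd) l2)" where
  "sigma_step t m i \<omega> \<equiv> sigma_lift T \<alpha> (partition_point t m i)"

lemma elementary_integrand_constant:
  assumes t: "t \<in> {0..T}"
  shows "elementary_integrand F t (Suc m) (partition_point t m) (\<lambda>i \<omega>. A i)"
  using partition_point_mono[of t] t by (auto simp: elementary_integrand_def simp del: of_nat_Suc)

text \<open>\<sigma> and its step approximation act on each vector through a scalar kernel, so every
  basis vector contributes the same integral and the dimension appears as a factor.\<close>

lemma sigma_step_error:
  assumes t: "t \<in> {0..T}" and s: "0 \<le> s"
  shows "(hilbert_schmidt_norm (sigma_lift T \<alpha> s - elementary_process (Suc m) (partition_point t m)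
      (sigma_step t m) s \<omega>))\<^sup>2
    = real CARD('d) * (LBINT \<xi>. (kernel_step_error T \<alpha> t m s \<xi>)\<^sup>2)"
proof -
  let ?i = "\<lambda>i. indicator {partition_point t m i<..partition_point t m (Suc i)} s :: real"
  have pn: "0 \<le> partition_point t m i" for i using partition_point_nonneg t by auto
  note sq = square_integrable_lift_kernel_scaleR[OF alpha(1)]
  have "(norm (blinfun_apply (sigma_lift T \<alpha> s - elementary_process (Suc m) (partition_point t m)
      (sigma_step t m) s \<omega>) e))\<^sup>2
      = (LBINT \<xi>. (kernel_step_error T \<alpha> t m s \<xi>)\<^sup>2)" if e: "e \<in> Basis" for e :: "real ^ 'd"
  proof -
    have sqs: "square_integrable (\<lambda>\<xi>. ?i i *\<^sub>R lift_kernel T \<alpha> (partition_point t m i) \<xi> *\<^sub>R e)" for i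
      by (rule square_integrable_scaleR[OF sq[OF pn]])
    have "blinfun_apply (sigma_lift T \<alpha> s - elementary_process (Suc m) (partition_point t m)
        (sigma_step t m) s \<omega>) e
        = l2_class (\<lambda>\<xi>. lift_kernel T \<alpha> s \<xi> *\<^sub>R e) -
          (\<Sum>i<Suc m. ?i i *\<^sub>R l2_class (\<lambda>\<xi>. lift_kernel T \<alpha> (partition_point t m i) \<xi> *\<^sub>R e))"
      by (simp only: elementary_process_def blinfun.diff_left blinfun.sum_left blinfun.scaleR_left
          blinfun_apply_sigma_lift_kernel[OF alpha(1) s] blinfun_apply_sigma_lift_kernel[OF alpha(1) pn])
    also have "\<dots> = l2_class (\<lambda>\<xi>. lift_kernel T \<alpha> s \<xi> *\<^sub>R e) -
          l2_class (\<lambda>\<xi>. \<Sum>i<Suc m. ?i i *\<^sub>R lift_kernel T \<alpha> (partition_point t m i) \<xi> *\<^sub>R e)"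
      by (simp only: l2_class_sum(1)[OF finite_lessThan sqs] l2_class_scaleR[OF sq[OF pn]])
    also have "\<dots> = l2_class (\<lambda>\<xi>. lift_kernel T \<alpha> s \<xi> *\<^sub>R e -
          (\<Sum>i<Suc m. ?i i *\<^sub>R lift_kernel T \<alpha> (partition_point t m i) \<xi> *\<^sub>R e))"
      by (rule l2_class_diff[symmetric, OF sq[OF s] l2_class_sum(2)[OF finite_lessThan sqs]])
    also have "\<dots> = l2_class (\<lambda>\<xi>. kernel_step_error T \<alpha> t m s \<xi> *\<^sub>R e)"
      by (simp only: kernel_step_error_def scaleR_diff_left scaleR_sum_left scaleR_scaleR)
    finally have "blinfun_apply (sigma_lift T \<alpha> s - elementary_process (Suc m) (partition_point t m)
        (sigma_step t m) s \<omega>) e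
        = l2_class (\<lambda>\<xi>. kernel_step_error T \<alpha> t m s \<xi> *\<^sub>R e)" .
    moreover have "square_integrable (\<lambda>\<xi>. kernel_step_error T \<alpha> t m s \<xi> *\<^sub>R e)"
      using square_integrable_kernel_step_error[OF alpha(1), of t s T m] t s
      by (auto simp: square_integrable_def power_mult_distrib)
    ultimately show ?thesis using e by (simp add: norm_l2_class power_mult_distrib)
  qed
  then show ?thesis by (simp add: hilbert_schmidt_norm_sq)
qed

lemma sigma_lift_measurable:
  "(\<lambda>(s, \<omega>). blinfun_apply (sigma_lift T \<alpha> s) x) \<in> borel_measurable (restrict_space lborel {0..t} \<Otimes>\<^sub>M M)"
proof -
  let ?R = "restrict_space lborel {0..t}"
  have [measurable]: "(\<lambda>s. s) \<in> borel_measurable ?R" by (rule measurable_restrict_space1) simp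
  have "(\<lambda>s. l2_class (\<lambda>\<xi>. lift_kernel T \<alpha> s \<xi> *\<^sub>R x)) \<in> borel_measurable ?R"
  proof (rule borel_measurable_l2_class)
    have "(\<lambda>p. (fst p, snd p)) \<in> measurable (?R \<Otimes>\<^sub>M lborel) (borel \<Otimes>\<^sub>M borel)"
      by (intro measurable_Pair measurable_compose[OF measurable_fst])
          (auto intro: measurable_restrict_space1)
    from measurable_compose[OF this borel_measurable_lift_kernel[of T \<alpha>]]
    show "(\<lambda>(s, \<xi>). lift_kernel T \<alpha> s \<xi> *\<^sub>R x) \<in> borel_measurable (?R \<Otimes>\<^sub>M lborel)"
      by (simp add: case_prod_beta')
    show "square_integrable (\<lambda>\<xi>. lift_kernel T \<alpha> s \<xi> *\<^sub>R x)" if "s \<in> space ?R" for s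
      using that by (intro square_integrable_lift_kernel_scaleR alpha) (auto simp: space_restrict_space)
  qed
  then have "(\<lambda>s. blinfun_apply (sigma_lift T \<alpha> s) x) \<in> borel_measurable ?R"
    by (rule measurable_cong[THEN iffD1, rotated])
      (auto simp: space_restrict_space blinfun_apply_sigma_lift_kernel[OF alpha(1)])
  from measurable_compose[OF measurable_fst this] show ?thesis by (simp add: case_prod_beta')
qed

lemma elementary_integral_sigma_step:
  assumes t: "t \<in> {0..T}"
  shows "elementary_integral W (Suc m) (partition_point t m) (sigma_step t m) \<omega> =
      l2_class (\<lambda>\<xi>. \<Sum>i<Suc m. lift_kernel T \<alpha> (partition_point t m i) \<xi> *\<^sub>R
          (W (partition_point t m (Suc i)) \<omega> - W (partition_point t m i) \<omega>))"
    and "square_integrable (\<lambda>\<xi>. \<Sum>i<Suc m. lift_kernel T \<alpha> (partition_point t m i) \<xi> *\<^sub>R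
        (W (partition_point t m (Suc i)) \<omega> - W (partition_point t m i) \<omega>))"
proof -
  have pn: "0 \<le> partition_point t m i" for i using partition_point_nonneg t by auto
  note sq = square_integrable_lift_kernel_scaleR[OF alpha(1) pn]
  show "elementary_integral W (Suc m) (partition_point t m) (sigma_step t m) \<omega> =
      l2_class (\<lambda>\<xi>. \<Sum>i<Suc m. lift_kernel T \<alpha> (partition_point t m i) \<xi> *\<^sub>R
          (W (partition_point t m (Suc i)) \<omega> - W (partition_point t m i) \<omega>))"
    by (simp only: elementary_integral_def blinfun_apply_sigma_lift_kernel[OF alpha(1) pn]
        l2_class_sum(1)[OF finite_lessThan sq])
  show "square_integrable (\<lambda>\<xi>. \<Sum>i<Suc m. lift_kernel T \<alpha> (partition_point t m i) \<xi> *\<^sub>R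
      (W (partition_point t m (Suc i)) \<omega> - W (partition_point t m i) \<omega>))"
    by (rule l2_class_sum(2)[OF finite_lessThan sq])
qed

text \<open>The value at \<xi> of the step integral of \<sigma> is an elementary integral of
  multiples of the identity. The 4 comes from \<open>ito_integral_error\<close>, and the dimension
  is the squared Hilbert-Schmidt norm of the identity.\<close>

lemma pointwise_error:
  assumes t: "t \<in> {0..T}" and \<xi>: "\<xi> \<in> {0..T}"
  shows "(\<integral>\<^sup>+\<omega>. ennreal ((norm ((w t \<omega> \<xi> - x0 - drift_convolution t \<omega> \<xi>) -
      (\<Sum>i<Suc m. lift_kernel T \<alpha> (partition_point t m i) \<xi> *\<^sub>R
          (W (partition_point t m (Suc i)) \<omega> - W (partition_point t m i) \<omega>))))\<^sup>2) \<partial>M)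
    \<le> ennreal (4 * real CARD('d)) * (\<integral>\<^sup>+s. ennreal ((kernel_step_error T \<alpha> t m s \<xi>)\<^sup>2)
        \<partial>restrict_space lborel {0..t})"
proof -
  let ?\<psi> = "\<lambda>i (\<omega>::'w). lift_kernel T \<alpha> (partition_point t m i) \<xi> *\<^sub>R
      (id_blinfun :: (real ^ 'd) \<Rightarrow>\<^sub>L (real ^ 'd))"
  obtain I where I: "has_ito_integral M F W t (\<lambda>s \<omega>. (indicator {0..t} s * lift_kernel T \<alpha> s \<xi>)
      *\<^sub>R id_blinfun) I"
    and Z: "AE \<omega> in M. w t \<omega> \<xi> - x0 - drift_convolution t \<omega> \<xi> = I \<omega>"
    using pointwise_ito_integral[OF t \<xi>] by blast
  have "(\<integral>\<^sup>+\<omega>. ennreal ((norm ((w t \<omega> \<xi> - x0 - drift_convolution t \<omega> \<xi>) -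
      (\<Sum>i<Suc m. lift_kernel T \<alpha> (partition_point t m i) \<xi> *\<^sub>R
          (W (partition_point t m (Suc i)) \<omega> - W (partition_point t m i) \<omega>))))\<^sup>2) \<partial>M)
    = (\<integral>\<^sup>+\<omega>. ennreal ((norm (I \<omega> - elementary_integral W (Suc m) (partition_point t m) ?\<psi> \<omega>))\<^sup>2) \<partial>M)"
    by (rule nn_integral_cong_AE, use Z in eventually_elim)
        (simp add: elementary_integral_def blinfun.scaleR_left)
  also have "\<dots> \<le> 4 * (\<integral>\<^sup>+(s, \<omega>). ennreal ((hilbert_schmidt_norm
      ((indicator {0..t} s * lift_kernel T \<alpha> s \<xi>) *\<^sub>R id_blinfun -
      elementary_process (Suc m) (partition_point t m) ?\<psi> s \<omega>))\<^sup>2) \<partial>(restrict_space lborel {0..t} \<Otimes>\<^sub>M M))"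
    by (rule ito_integral_error[OF t I elementary_integrand_constant[OF t]])
  also have "(\<integral>\<^sup>+(s, \<omega>). ennreal ((hilbert_schmidt_norm
      ((indicator {0..t} s * lift_kernel T \<alpha> s \<xi>) *\<^sub>R id_blinfun -
      elementary_process (Suc m) (partition_point t m) ?\<psi> s \<omega>))\<^sup>2) \<partial>(restrict_space lborel {0..t} \<Otimes>\<^sub>M M)) =
    (\<integral>\<^sup>+(s, \<omega>). ennreal (real CARD('d) * (kernel_step_error T \<alpha> t m s \<xi>)\<^sup>2)
        \<partial>(restrict_space lborel {0..t} \<Otimes>\<^sub>M M))"
  proof (rule nn_integral_cong)
    fix p assume "p \<in> space (restrict_space lborel {0..t} \<Otimes>\<^sub>M M)"
    then obtain s \<omega> where p: "p = (s, \<omega>)" "s \<in> {0..t}" by (auto simp: space_pair_measure space_restrict_space)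
    have "(indicator {0..t} s * lift_kernel T \<alpha> s \<xi>) *\<^sub>R id_blinfun - elementary_process (Suc m)
        (partition_point t m) ?\<psi> s \<omega> =
        kernel_step_error T \<alpha> t m s \<xi> *\<^sub>R (id_blinfun :: (real ^ 'd) \<Rightarrow>\<^sub>L (real ^ 'd))"
      using p(2) by (simp only: elementary_process_def kernel_step_error_def scaleR_diff_left
          scaleR_sum_left scaleR_scaleR
          indicator_simps mult_1_left)
    then show "(case p of (s, \<omega>) \<Rightarrow> ennreal ((hilbert_schmidt_norm
        ((indicator {0..t} s * lift_kernel T \<alpha> s \<xi>) *\<^sub>R id_blinfun -
        elementary_process (Suc m) (partition_point t m) ?\<psi> s \<omega>))\<^sup>2)) =
      (case p of (s, \<omega>) \<Rightarrow> ennreal (real CARD('d) * (kernel_step_error T \<alpha> t m s \<xi>)\<^sup>2))"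
      by (simp only: p(1) prod.case hilbert_schmidt_norm_scaleR_id) simp
  qed
  also have "\<dots> = (\<integral>\<^sup>+s. ennreal (real CARD('d) * (kernel_step_error T \<alpha> t m s \<xi>)\<^sup>2)
      \<partial>restrict_space lborel {0..t})"
    by (rule nn_integral_deterministic) (use measurable_compose[OF measurable_Pair2'
        borel_measurable_kernel_step_error] in simp)
  also have "\<dots> = ennreal (real CARD('d)) * (\<integral>\<^sup>+s. ennreal ((kernel_step_error T \<alpha> t m s \<xi>)\<^sup>2)
      \<partial>restrict_space lborel {0..t})"
    by (subst nn_integral_cmult[symmetric])
      (auto simp: ennreal_mult intro!: measurable_restrict_space1 borel_measurable_power
        measurable_compose[OF _ measurable_ennreal]
            measurable_compose[OF measurable_Pair2' borel_measurable_kernel_step_error, simplified])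
  finally show ?thesis by (simp add: ennreal_mult'' mult.assoc)
qed


text \<open>The candidate for the H-valued stochastic integral, defined as what the lift leaves
  after \<open>x0\<close> and the drift. The equation for the lift then holds for every \<omega> by
  construction, and the content lies in showing that this remainder is a version of the integral of
  \<sigma>.\<close>

definition stochastic_part :: "real \<Rightarrow> 'w \<Rightarrow> real \<Rightarrow> real ^ 'd" where
  "stochastic_part t \<omega> \<xi> = indicator {0..T} \<xi> *\<^sub>R (w t \<omega> \<xi> - x0 - drift_convolution t \<omega> \<xi>)"

lemma square_integrable_constant: "square_integrable (\<lambda>\<xi>. indicator {0..T} \<xi> *\<^sub>R x0)"
proof -
  have "square_integrable_on T (\<lambda>_. x0)"
    by (rule square_integrable_bounded_support) auto
  then show ?thesis by (simp add: square_integrable_on_def)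
qed

lemma stochastic_part_eq:
  assumes t: "t \<in> {0..T}" and \<omega>: "\<omega> \<in> space M"
  shows "square_integrable (stochastic_part t \<omega>)"
    and "hclass T (w t \<omega>) = hclass T (\<lambda>_. x0) + (LINT s:{0..t}|lborel. B_lift T k1 b s (w s \<omega>)) +
      l2_class (stochastic_part t \<omega>)"
proof -
  note sw = w_square_integrable[OF t \<omega>, unfolded square_integrable_on_def]
  note sd = B_lift_integral(2)[OF t \<omega>]
  have e: "stochastic_part t \<omega> = (\<lambda>\<xi>. indicator {0..T} \<xi> *\<^sub>R w t \<omega> \<xi> - indicator {0..T} \<xi> *\<^sub>R x0
      - indicator {0..T} \<xi> *\<^sub>R drift_convolution t \<omega> \<xi>)"
    by (rule ext) (simp only: stochastic_part_def scaleR_diff_right)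
  note swx = square_integrable_diff[OF sw square_integrable_constant]
  show "square_integrable (stochastic_part t \<omega>)"
    unfolding e by (rule square_integrable_diff[OF swx sd])
  show "hclass T (w t \<omega>) = hclass T (\<lambda>_. x0) + (LINT s:{0..t}|lborel. B_lift T k1 b s (w s \<omega>)) +
      l2_class (stochastic_part t \<omega>)"
    unfolding e hclass_def B_lift_integral(3)[OF t \<omega>] l2_class_diff[OF swx sd]
        l2_class_diff[OF sw square_integrable_constant]
    by simp
qed

lemma stochastic_part_measurable:
  assumes t: "t \<in> {0..T}"
  shows "(\<lambda>(\<omega>, \<xi>). stochastic_part t \<omega> \<xi>) \<in> borel_measurable (M \<Otimes>\<^sub>M lborel)"
proof -
  have id: "(\<lambda>p. p) \<in> measurable (M \<Otimes>\<^sub>M lborel) (F t \<Otimes>\<^sub>M lborel)"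
  proof -
    have "(\<lambda>\<omega>. \<omega>) \<in> measurable M (F t)"
      by (rule measurable_from_subalg[OF subalgebra_F[OF t]]) simp
    from measurable_Pair[OF measurable_compose[OF measurable_fst this] measurable_snd]
    show ?thesis by simp
  qed
  have eq: "borel_measurable (F t \<Otimes>\<^sub>M (lborel :: real measure)) =
      (borel_measurable (F t \<Otimes>\<^sub>M borel) :: (_ \<Rightarrow> real ^ 'd) set)"
    by (intro measurable_cong_sets sets_pair_measure_cong) auto
  have V: "(\<lambda>p. drift_convolution t (fst p) (snd p)) \<in> borel_measurable (F t \<Otimes>\<^sub>M lborel)"
    using drift_convolution_pair_measurable[OF t] unfolding eq by (simp add: case_prod_beta')
  have w: "(\<lambda>p. indicator {0..T} (snd p) *\<^sub>R w t (fst p) (snd p)) \<in> borel_measurable (F t \<Otimes>\<^sub>M lborel)"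
    using w_pair_measurable[OF t] by (simp add: case_prod_beta')
  have ind: "(\<lambda>p. indicator {0..T} (snd p) :: real) \<in> borel_measurable (F t \<Otimes>\<^sub>M lborel)" by measurable
  have "(\<lambda>p. indicator {0..T} (snd p) *\<^sub>R w t (fst p) (snd p) - indicator {0..T} (snd p) *\<^sub>R x0
      - indicator {0..T} (snd p) *\<^sub>R drift_convolution t (fst p) (snd p)) \<in> borel_measurable (F t \<Otimes>\<^sub>M lborel)"
    by (rule borel_measurable_diff[OF borel_measurable_diff[OF w borel_measurable_scaleR[OF ind]]
        borel_measurable_scaleR[OF ind V]]) simp
  then have "(\<lambda>p. stochastic_part t (fst p) (snd p)) \<in> borel_measurable (F t \<Otimes>\<^sub>M lborel)"
    by (simp only: stochastic_part_def scaleR_diff_right)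
  from measurable_compose[OF id this] show ?thesis by (simp add: case_prod_beta')
qed

lemma stochastic_part_error:
  assumes t: "t \<in> {0..T}"
  shows "(\<integral>\<^sup>+\<omega>. ennreal ((norm (l2_class (stochastic_part t \<omega>) -
      elementary_integral W (Suc m) (partition_point t m) (sigma_step t m) \<omega>))\<^sup>2) \<partial>M)
    \<le> ennreal (4 * real CARD('d) * (2 * kernel_energy \<alpha> (t / real (Suc m)) * t))"
proof -
  let ?S = "\<lambda>\<omega> \<xi>. \<Sum>i<Suc m. lift_kernel T \<alpha> (partition_point t m i) \<xi> *\<^sub>R
      (W (partition_point t m (Suc i)) \<omega> - W (partition_point t m i) \<omega>)"
  let ?h = "\<lambda>\<omega> \<xi>. ennreal ((norm (stochastic_part t \<omega> \<xi> - ?S \<omega> \<xi>))\<^sup>2)"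
  let ?R = "restrict_space lborel {0..t}"
  let ?e = "\<lambda>s \<xi>. ennreal ((kernel_step_error T \<alpha> t m s \<xi>)\<^sup>2)"
  interpret MP: pair_sigma_finite M "lborel :: real measure" ..
  have pW: "partition_point t m i \<in> {0..T}" if "i \<le> Suc m" for i
    using partition_point_nonneg[of t m i] partition_point_mono[of t i "Suc m" m] t that by auto
  have Sm: "(\<lambda>p. ?S (fst p) (snd p)) \<in> borel_measurable (M \<Otimes>\<^sub>M lborel)"
  proof (intro borel_measurable_sum borel_measurable_scaleR borel_measurable_diff)
    fix i assume "i \<in> {..<Suc m}"
    then show "(\<lambda>p. W (partition_point t m (Suc i)) (fst p)) \<in> borel_measurable
        (M \<Otimes>\<^sub>M (lborel :: real measure))"
      "(\<lambda>p. W (partition_point t m i) (fst p)) \<in> borel_measurable (M \<Otimes>\<^sub>M (lborel :: real measure))"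
      by (auto intro!: measurable_compose[OF measurable_fst W_measurable] pW simp del: partition_point_ends)
  qed measurable
  have hm: "(\<lambda>(\<omega>, \<xi>). ?h \<omega> \<xi>) \<in> borel_measurable (M \<Otimes>\<^sub>M lborel)"
    using borel_measurable_diff[OF stochastic_part_measurable[OF t, unfolded case_prod_beta'] Sm]
    unfolding case_prod_beta' by measurable
  have em: "(\<lambda>(\<xi>, s). ?e s \<xi>) \<in> borel_measurable (lborel \<Otimes>\<^sub>M ?R)"
  proof -
    have "(\<lambda>p. (snd p, fst p)) \<in> measurable ((lborel :: real measure) \<Otimes>\<^sub>M ?R) (borel \<Otimes>\<^sub>M borel)"
      by (intro measurable_Pair measurable_compose[OF measurable_snd])
          (auto intro: measurable_restrict_space1)
    from measurable_compose[OF this borel_measurable_kernel_step_error[of T \<alpha> t m]]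
    show ?thesis unfolding case_prod_beta' by simp
  qed
  have "sigma_finite_measure ?R" by (rule sigma_finite_measure_restrict_space)
      (auto intro: sigma_finite_lborel)
  then interpret LR: pair_sigma_finite "lborel :: real measure" ?R
    by (intro pair_sigma_finite.intro sigma_finite_lborel)
  have "(\<integral>\<^sup>+\<omega>. ennreal ((norm (l2_class (stochastic_part t \<omega>) -
      elementary_integral W (Suc m) (partition_point t m) (sigma_step t m) \<omega>))\<^sup>2) \<partial>M) =
    (\<integral>\<^sup>+\<omega>. \<integral>\<^sup>+\<xi>. ?h \<omega> \<xi> \<partial>lborel \<partial>M)"
  proof (rule nn_integral_cong)
    fix \<omega> assume \<omega>: "\<omega> \<in> space M"
    note s = stochastic_part_eq(1)[OF t \<omega>] elementary_integral_sigma_step(2)[OF t, of m \<omega>]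
    show "ennreal ((norm (l2_class (stochastic_part t \<omega>) -
      elementary_integral W (Suc m) (partition_point t m) (sigma_step t m) \<omega>))\<^sup>2) = (\<integral>\<^sup>+\<xi>. ?h \<omega> \<xi> \<partial>lborel)"
      unfolding elementary_integral_sigma_step(1)[OF t] l2_class_diff[OF s, symmetric]
      by (rule norm_l2_class_nn[OF square_integrable_diff[OF s]])
  qed
  \<comment> \<open>The norm in H is an integral over \<xi> for each \<omega>; exchanging the order
    fixes \<xi>, so that the scalar estimate applies and its null set may vary with \<xi>.\<close>
  also have "\<dots> = (\<integral>\<^sup>+\<xi>. \<integral>\<^sup>+\<omega>. ?h \<omega> \<xi> \<partial>M \<partial>lborel)"
    using MP.Fubini'[OF hm] by simp
  also have "\<dots> \<le> (\<integral>\<^sup>+\<xi>. ennreal (4 * real CARD('d)) * (\<integral>\<^sup>+s. ?e s \<xi> \<partial>?R) \<partial>lborel)"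
  proof (rule nn_integral_mono)
    fix \<xi> :: real
    show "(\<integral>\<^sup>+\<omega>. ?h \<omega> \<xi> \<partial>M) \<le> ennreal (4 * real CARD('d)) * (\<integral>\<^sup>+s. ?e s \<xi> \<partial>?R)"
    proof (cases "\<xi> \<in> {0..T}")
      case True
      then show ?thesis using pointwise_error[OF t True, of m] by
          (simp only: stochastic_part_def indicator_simps scaleR_one)
    next
      case False
      then have "?h \<omega> \<xi> = 0" for \<omega> by (simp add: stochastic_part_def lift_kernel_def)
      then show ?thesis by simp
    qed
  qed
  also have "\<dots> = ennreal (4 * real CARD('d)) * (\<integral>\<^sup>+\<xi>. \<integral>\<^sup>+s. ?e s \<xi> \<partial>?R \<partial>lborel)"
    using LR.M2.borel_measurable_nn_integral_fst[OF em] by (intro nn_integral_cmult) simp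
  \<comment> \<open>A second exchange returns to fixed times \<open>s\<close>: the inner integral
    over \<xi> is then the squared distance of the kernel from its step approximation, which the
    energy controls.\<close>
  also have "(\<integral>\<^sup>+\<xi>. \<integral>\<^sup>+s. ?e s \<xi> \<partial>?R \<partial>lborel) = (\<integral>\<^sup>+s. \<integral>\<^sup>+\<xi>. ?e s \<xi> \<partial>lborel \<partial>?R)"
    using LR.Fubini'[OF em] by simp
  also have "\<dots> = (\<integral>\<^sup>+s. ennreal (LBINT \<xi>. (kernel_step_error T \<alpha> t m s \<xi>)\<^sup>2) \<partial>?R)"
    using square_integrable_kernel_step_error[OF alpha(1), of t _ T m] t
    by (intro nn_integral_cong nn_integral_eq_integral)
        (auto simp: square_integrable_def space_restrict_space)
  also have "ennreal (4 * real CARD('d)) * \<dots> \<le> ennreal (4 * real CARD('d)) * ennreal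
      (2 * kernel_energy \<alpha> (t / real (Suc m)) * t)"
    using nn_integral_kernel_step_error[OF alpha, of t T m] t by (intro mult_left_mono) auto
  also have "\<dots> = ennreal (4 * real CARD('d) * (2 * kernel_energy \<alpha> (t / real (Suc m)) * t))"
    by (rule ennreal_mult'[symmetric]) simp
  finally show ?thesis .
qed

lemma sigma_lift_ito_integral:
  assumes t: "t \<in> {0..T}"
  shows "has_ito_integral M F W t (\<lambda>s \<omega>. sigma_lift T \<alpha> s) (\<lambda>\<omega>. l2_class (stochastic_part t \<omega>))"
  unfolding has_ito_integral_def
proof (intro conjI allI exI)
  show "(\<lambda>\<omega>. l2_class (stochastic_part t \<omega>)) \<in> borel_measurable M"
    by (rule borel_measurable_l2_class[OF stochastic_part_measurable[OF t] stochastic_part_eq(1)[OF t]])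
  show "(\<lambda>(s, \<omega>). blinfun_apply (sigma_lift T \<alpha> s) x) \<in> borel_measurable
      (restrict_space lborel {0..t} \<Otimes>\<^sub>M M)" for x
    by (rule sigma_lift_measurable)
  show "elementary_integrand F t (Suc m) (partition_point t m) (sigma_step t m)" for m
    by (rule elementary_integrand_constant[OF t])
  have t0: "0 \<le> t" using t by simp
  let ?E = "\<lambda>m. \<integral>\<^sup>+(s, \<omega>). ennreal ((hilbert_schmidt_norm (sigma_lift T \<alpha> s -
      elementary_process (Suc m) (partition_point t m) (sigma_step t m) s \<omega>))\<^sup>2)
          \<partial>(restrict_space lborel {0..t} \<Otimes>\<^sub>M M)"
  have "?E m \<le> ennreal (real CARD('d) * (2 * kernel_energy \<alpha> (t / real (Suc m)) * t))" for m
  proof -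
    have meas: "(\<lambda>s. LBINT \<xi>. (kernel_step_error T \<alpha> t m s \<xi>)\<^sup>2) \<in> borel_measurable borel"
      using borel_measurable_kernel_step_error[of T \<alpha> t m]
      by (intro lborel.borel_measurable_lebesgue_integral)
          (simp add: case_prod_beta' cong: measurable_cong_sets)
    have "?E m = (\<integral>\<^sup>+(s, \<omega>). ennreal (real CARD('d) * (LBINT \<xi>. (kernel_step_error T \<alpha> t m s \<xi>)\<^sup>2))
        \<partial>(restrict_space lborel {0..t} \<Otimes>\<^sub>M M))"
      using sigma_step_error[OF t] by (intro nn_integral_cong)
          (auto simp: space_pair_measure space_restrict_space simp del: lessThan_Suc sum.lessThan_Suc)
    also have "\<dots> = (\<integral>\<^sup>+s. ennreal (real CARD('d) * (LBINT \<xi>. (kernel_step_error T \<alpha> t m s \<xi>)\<^sup>2))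
        \<partial>restrict_space lborel {0..t})"
      by (rule nn_integral_deterministic) (use meas in measurable)
    also have "\<dots> = ennreal (real CARD('d)) * (\<integral>\<^sup>+s. ennreal (LBINT \<xi>. (kernel_step_error T \<alpha> t m s \<xi>)\<^sup>2)
        \<partial>restrict_space lborel {0..t})"
    proof -
      have "(\<lambda>s. LBINT \<xi>. (kernel_step_error T \<alpha> t m s \<xi>)\<^sup>2) \<in> borel_measurable
          (restrict_space lborel {0..t})"
        by (rule measurable_restrict_space1) (use meas in simp)
      then show ?thesis by (subst nn_integral_cmult[symmetric]) (auto simp: ennreal_mult)
    qed
    also have "\<dots> \<le> ennreal (real CARD('d)) * ennreal (2 * kernel_energy \<alpha> (t / real (Suc m)) * t)"
      using nn_integral_kernel_step_error[OF alpha, of t T m] t by (intro mult_left_mono) auto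
    finally show ?thesis by (simp add: ennreal_mult' del: of_nat_Suc)
  qed
  then show "?E \<longlonglongrightarrow> 0"
    by (intro tendsto_sandwich[OF _ _ tendsto_const
        kernel_step_bound_tendsto_0[OF alpha(1) t0, of "real CARD('d)"]])
      (simp_all del: of_nat_Suc)
  show "(\<lambda>m. \<integral>\<^sup>+\<omega>. ennreal ((norm (l2_class (stochastic_part t \<omega>) -
      elementary_integral W (Suc m) (partition_point t m) (sigma_step t m) \<omega>))\<^sup>2) \<partial>M) \<longlonglongrightarrow> 0"
    by (rule tendsto_sandwich[OF _ _ tendsto_const
          kernel_step_bound_tendsto_0[OF alpha(1) t0, of "4 * real CARD('d)"]])
      (use stochastic_part_error[OF t] in \<open>simp_all only: always_eventually zero_le simp_thms\<close>)
qed

end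

theorem proposition1:
  fixes M :: "'w measure" and F :: "real \<Rightarrow> 'w measure" and T \<alpha> :: real
    and W X :: "real \<Rightarrow> 'w \<Rightarrow> real ^ 'd"
    and k1 :: "real \<Rightarrow> real" and b :: "real \<Rightarrow> real ^ 'd \<Rightarrow> real ^ 'd" and x0 :: "real ^ 'd"
    and J \<theta> :: "real \<Rightarrow> real \<Rightarrow> 'w \<Rightarrow> real ^ 'd" and w :: "real \<Rightarrow> 'w \<Rightarrow> real \<Rightarrow> real ^ 'd"
  assumes "brownian_motion M F T W"
    and "volterra_coefficients T \<alpha> k1 b"
    and "volterra_solution M F T W \<alpha> k1 b x0 X"
    and "continuous_kernel_integral M F T W \<alpha> J"
  defines "\<theta> \<equiv> forward_process k1 b x0 X J"
    and "w \<equiv> lifted_process X \<theta>"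
  shows "lifted_solution M F T W \<alpha> k1 b (hclass T (\<lambda>_. x0)) w"
proof -
  interpret volterra_lift M F T \<alpha> W k1 b x0 X J
    using assms(1-4) by (intro volterra_lift.intro volterra_lift_axioms.intro)
  show ?thesis
    unfolding lifted_solution_def w_def \<theta>_def
  proof (intro ballI conjI)
    fix t assume t: "t \<in> {0..T}"
    show "square_integrable_on T (lifted_process X (forward_process k1 b x0 X J) t \<omega>)" if "\<omega> \<in> space M" for \<omega>
      by (rule w_square_integrable[OF t that])
    show "AE \<omega> in M. continuous_on {0..T} (lifted_process X (forward_process k1 b x0 X J) t \<omega>)"
      by (rule w_continuous[OF t])
    show "(\<lambda>\<omega>. hclass T (lifted_process X (forward_process k1 b x0 X J) t \<omega>)) \<in> borel_measurable (F t)"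
      by (rule w_adapted[OF t])
    show "AE \<omega> in M. set_integrable lborel {0..t}
        (\<lambda>s. B_lift T k1 b s (lifted_process X (forward_process k1 b x0 X J) s \<omega>))"
      by (rule AE_I2[OF B_lift_integral(1)[OF t]])
    show "\<exists>I. has_ito_integral M F W t (\<lambda>s \<omega>. sigma_lift T \<alpha> s) I \<and>
        (AE \<omega> in M. hclass T (lifted_process X (forward_process k1 b x0 X J) t \<omega>) = hclass T (\<lambda>_. x0) +
          (LINT s:{0..t}|lborel. B_lift T k1 b s (lifted_process X (forward_process k1 b x0 X J) s \<omega>)) + I \<omega>)"
      using sigma_lift_ito_integral[OF t] stochastic_part_eq(2)[OF t]
      by (intro exI[of _ "\<lambda>\<omega>. l2_class (stochastic_part t \<omega>)"] conjI AE_I2)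
  qed
qed

end
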